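(* Let $M,M'\ge 0$. The semiflow $\mathcal{S}$ generated by $S(t)$ is uniformly dissipative on the phase space $$\mathbb{X}_0^{M,M'}=\{(u,v)\in\mathbb{X}_0:\ |\beta\langle v\rangle+\langle u\rangle|\le M,\ |\langle v\rangle|\le M'\}.$$ Namely, there exists a constant $R_0$ independent of the initial data such that, for every bounded set $B_0\subset\mathbb{X}_0^{M,M'}$, there exists $t_{B_0}>0$ such that, for all $(\phi_0,\phi_1)\in B_0$, $$\|S(t)(\phi_0,\phi_1)\|_{\mathbb{X}_0}\le R_0,\qquad\forall\, t\ge t_{B_0}.$$
   Context: Setting: $Q=(0,1)^n$ with $n\le 3$; $\beta>0$ and $\epsilon\in\mathbb{R}$ are constants; $f(s)=s^3+(1-\epsilon)s$, $F(s)=\frac{1-\epsilon}{2}s^2+\frac14 s^4$. $H^m_p(Q)$ is the Sobolev space of $Q$-periodic functions with usual norm $\|\cdot\|_m$, $L^2_p(Q)=H^0_p(Q)$ with norm $\|\cdot\|$, $H^{-m}_p(Q)$ is the dual of $H^m_p(Q)$; $\langle u\rangle=\int_Q u\,dx$ (duality with $1$ for elements of dual spaces), $\overline u=u-\langle u\rangle$; $A_0=-\Delta$ on zero-mean periodic functions, with powers $A_0^s$ acting on zero-mean elements; $D(A_0^{-1})$ is the space of zero-mean elements of $H^{-2}_p(Q)$; $\|u\|_{-1}^2=\|A_0^{-1/2}\overline u\|^2+\langle u\rangle^2$ on $H^{-1}_p(Q)$. $\mathbb{X}_0=H^2_p(Q)\times H^{-1}_p(Q)$ with its product norm. Problem: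 $\beta\phi_{tt}+\phi_t=\Delta[\Delta^2\phi+2\Delta\phi+f(\phi)]$ in $Q\times(0,\infty)$, periodic boundary conditions, $\phi|_{t=0}=\phi_0$, $\phi_t|_{t=0}=\phi_1$. An energy solution on $(0,T)$ ($0<T\le\infty$) is a pair $(\phi,\phi_t)\in L^\infty(0,T;\mathbb{X}_0)$ with $\phi_{tt}\in L^\infty(0,T;H^{-4}_p(Q))$, $\mathcal{E}(t)=\frac\beta2\|\overline{\phi_t}\|_{-1}^2+\int_Q(\frac12|\Delta\phi|^2-|\nabla\phi|^2+F(\phi))dx$ in $L^\infty(0,T)$, satisfying $A_0^{-1}(\beta\phi_{tt}+\phi_t)+\Delta^2\phi+2\Delta\phi+f(\phi)-\langle f(\phi)\rangle=0$ in $D(A_0^{-1})$ a.e. in $(0,T)$ and the initial conditions. For each $(\phi_0,\phi_1)\in\mathbb{X}_0$ there is a unique global energy solution, continuous in time with values in $\mathbb{X}_0$; the semigroup is $S(t)(\phi_0,\phi_1)=(\phi(t),\phi_t(t))$, $t\ge0$, and $\mathcal{S}=(\mathbb{X}_0,S(t))$. *)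

theory Defs
  imports "HOL-Analysis.Analysis"
begin

text \<open>
  The space dimension is \<open>n = CARD('n)\<close>. Elements of the periodic Sobolev spaces are represented by
  periodic functions on all of \<open>\<real>\<^sup>n\<close> (two functions that agree almost everywhere represent the
  same element). Elements of the dual spaces are represented by functionals that are
  only relevant on the predual space.
\<close>

type_synonym 'n func = "real^'n \<Rightarrow> real"
type_synonym 'n functional = "'n func \<Rightarrow> real"


section \<open>Periodic Sobolev spaces\<close>

definition cell :: "(real^'n::finite) set" where
  "cell = box 0 1"

definition periodic :: "'n::finite func \<Rightarrow> bool" where
  "periodic u \<longleftrightarrow> (\<forall>x i. u (x + axis i 1) = u x)"

definition L2p :: "('n::finite func) set" where
  "L2p = {u \<in> borel_measurable lebesgue. periodic u \<and> integrable (lebesgue_on cell) (\<lambda>x. (u x)\<^sup>2)}"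

definition ip :: "'n::finite func \<Rightarrow> 'n func \<Rightarrow> real" where
  "ip u w = (LINT x|lebesgue_on cell. u x * w x)"

definition L2norm :: "'n::finite func \<Rightarrow> real" where
  "L2norm u = sqrt (ip u u)"

definition pderiv_dir :: "'n::finite \<Rightarrow> 'n func \<Rightarrow> 'n func" where
  "pderiv_dir i f = (\<lambda>x. deriv (\<lambda>s. f (x + s *\<^sub>R axis i 1)) 0)"

definition pderivs :: "'n::finite list \<Rightarrow> 'n func \<Rightarrow> 'n func" where
  "pderivs js f = foldr pderiv_dir js f"

definition smooth_periodic :: "('n::finite func) set" where
  "smooth_periodic = {f. periodic f \<and> (\<forall>js x. pderivs js f differentiable (at x))}"

definition has_weak_deriv :: "'n::finite list \<Rightarrow> 'n func \<Rightarrow> 'n func \<Rightarrow> bool" where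
  "has_weak_deriv js u g \<longleftrightarrow>
     (\<forall>\<psi> \<in> smooth_periodic. ip u (pderivs js \<psi>) = (- 1) ^ length js * ip g \<psi>)"

text \<open>The weak derivative is determined up to a null set.\<close>

definition wderiv :: "'n::finite list \<Rightarrow> 'n func \<Rightarrow> 'n func" where
  "wderiv js u = (SOME g. g \<in> L2p \<and> has_weak_deriv js u g)"

definition Hp :: "nat \<Rightarrow> ('n::finite func) set" where
  "Hp m = {u \<in> L2p. \<forall>js. length js \<le> m \<longrightarrow> (\<exists>g \<in> L2p. has_weak_deriv js u g)}"

text \<open>The sum over index lists of length \<open>k\<close> is the squared norm of the full derivative tensor
  \<open>\<nabla>\<^sup>k u\<close>.\<close>

definition Hnorm :: "nat \<Rightarrow> 'n::finite func \<Rightarrow> real" where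
  "Hnorm m u = sqrt (\<Sum>js | length js \<le> m. (L2norm (wderiv js u))\<^sup>2)"

definition lap :: "'n::finite func \<Rightarrow> 'n func" where
  "lap u = (\<lambda>x. \<Sum>i\<in>UNIV. wderiv [i, i] u x)"

definition grad_sq :: "'n::finite func \<Rightarrow> 'n func" where
  "grad_sq u = (\<lambda>x. \<Sum>i\<in>UNIV. (wderiv [i] u x)\<^sup>2)"

definition mean :: "'n::finite func \<Rightarrow> real" where
  "mean u = (LINT x|lebesgue_on cell. u x)"


section \<open>Dual spaces\<close>

definition Hdual :: "nat \<Rightarrow> ('n::finite functional) set" where
  "Hdual m = {v.
     (\<forall>u \<in> Hp m. \<forall>w \<in> Hp m. \<forall>a b. v (\<lambda>x. a * u x + b * w x) = a * v u + b * v w) \<and>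
     (\<exists>C. \<forall>u \<in> Hp m. \<bar>v u\<bar> \<le> C * Hnorm m u)}"

definition dual_norm :: "nat \<Rightarrow> 'n::finite functional \<Rightarrow> real" where
  "dual_norm m v = (SUP u \<in> {u \<in> Hp m. Hnorm m u \<le> 1}. \<bar>v u\<bar>)"

text \<open>The embedding of \<open>L\<^sup>2\<close> into the dual spaces, and the distributional Laplacian of a functional.\<close>

definition emb :: "'n::finite func \<Rightarrow> 'n functional" where
  "emb u = (\<lambda>w. ip u w)"

definition dlap :: "'n::finite functional \<Rightarrow> 'n functional" where
  "dlap v = (\<lambda>w. v (lap w))"

definition dmean :: "'n::finite functional \<Rightarrow> real" where
  "dmean v = v (\<lambda>_. 1)"

definition dbar :: "'n::finite functional \<Rightarrow> 'n functional" where
  "dbar v = (\<lambda>w. v w - dmean v * mean w)"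


section \<open>Powers of the negative Laplacian on zero-mean elements\<close>

definition phase :: "int^'n::finite \<Rightarrow> real^'n \<Rightarrow> real" where
  "phase k x = 2 * pi * (\<Sum>i\<in>UNIV. of_int (k $ i) * x $ i)"

definition cosk :: "int^'n::finite \<Rightarrow> 'n func" where
  "cosk k = (\<lambda>x. cos (phase k x))"

definition sink :: "int^'n::finite \<Rightarrow> 'n func" where
  "sink k = (\<lambda>x. sin (phase k x))"

definition eigval :: "int^'n::finite \<Rightarrow> real" where
  "eigval k = 4 * pi\<^sup>2 * (\<Sum>i\<in>UNIV. (of_int (k $ i))\<^sup>2)"

lemma phase_shift:
  fixes k :: "int^'n::finite"
  shows "phase k (x + s *\<^sub>R axis i 1) = phase k x + s * (2 * pi * of_int (k $ i))"
proof -
  have "(\<Sum>j\<in>UNIV. of_int (k $ j) * (x + s *\<^sub>R axis i 1) $ j) =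
    (\<Sum>j\<in>UNIV. of_int (k $ j) * x $ j + (if j = i then s * of_int (k $ j) else 0))"
    by (rule sum.cong) (auto simp: axis_def ring_distribs)
  also have "\<dots> = (\<Sum>j\<in>UNIV. of_int (k $ j) * x $ j) + s * of_int (k $ i)"
    by (simp add: sum.distrib)
  finally show ?thesis
    unfolding phase_def by (simp only: ring_distribs mult_ac)
qed

lemma pderiv_dir_trig:
  fixes k :: "int^'n::finite"
  shows "pderiv_dir i (\<lambda>x. a * cosk k x + b * sink k x) =
    (\<lambda>x. (2 * pi * of_int (k $ i) * b) * cosk k x + (- 2 * pi * of_int (k $ i) * a) * sink k x)"
proof
  fix x
  have "((\<lambda>s. a * cos (phase k x + s * (2 * pi * of_int (k $ i))) +
      b * sin (phase k x + s * (2 * pi * of_int (k $ i)))) has_real_derivative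
      (2 * pi * of_int (k $ i) * b) * cos (phase k x) +
      (- 2 * pi * of_int (k $ i) * a) * sin (phase k x)) (at 0)"
    by (rule derivative_eq_intros refl | simp)+
  then show "pderiv_dir i (\<lambda>x. a * cosk k x + b * sink k x) x =
    (2 * pi * of_int (k $ i) * b) * cosk k x + (- 2 * pi * of_int (k $ i) * a) * sink k x"
    unfolding pderiv_dir_def cosk_def sink_def phase_shift by (rule DERIV_imp_deriv)
qed

lemma trig_smooth_periodic:
  fixes k :: "int^'n::finite"
  shows "(\<lambda>x. a * cosk k x + b * sink k x) \<in> smooth_periodic"
proof -
  have phase1: "phase k (x + axis i 1) = phase k x + 2 * pi * of_int (k $ i)" for x i
    using phase_shift[of k x 1 i] by simp
  have "periodic (\<lambda>x. a * cosk k x + b * sink k x)"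
    unfolding periodic_def cosk_def sink_def phase1
    by (simp only: sin_add cos_add sin_int_2pin cos_int_2pin) simp
  moreover have "\<exists>c d. pderivs js (\<lambda>x. a * cosk k x + b * sink k x) =
      (\<lambda>x. c * cosk k x + d * sink k x)" for js
  proof (induction js)
    case Nil
    show ?case
      by (rule exI[of _ a], rule exI[of _ b]) (simp add: pderivs_def)
  next
    case (Cons i js)
    then obtain c d where "pderivs js (\<lambda>x. a * cosk k x + b * sink k x) =
      (\<lambda>x. c * cosk k x + d * sink k x)"
      by blast
    then have "pderivs (i # js) (\<lambda>x. a * cosk k x + b * sink k x) =
      pderiv_dir i (\<lambda>x. c * cosk k x + d * sink k x)"
      by (simp add: pderivs_def)
    then show ?case
      unfolding pderiv_dir_trig by blast
  qed
  moreover have "(\<lambda>x. c * cosk k x + d * sink k x) differentiable (at x)" for c d x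
  proof -
    have "bounded_linear (phase k)"
      unfolding phase_def
      by (rule bounded_linear_const_mult, rule bounded_linear_sum, rule bounded_linear_const_mult)
        (rule bounded_linear_vec_nth)
    then have D: "(phase k has_derivative phase k) (at x)"
      by (rule bounded_linear_imp_has_derivative)
    show ?thesis
      unfolding cosk_def sink_def
      by (rule differentiableI, rule has_derivative_add)
        (rule has_derivative_mult_right, rule has_derivative_cos has_derivative_sin, rule D)+
  qed
  ultimately have "\<forall>js x. pderivs js (\<lambda>x. a * cosk k x + b * sink k x) differentiable (at x)"
    by metis
  with \<open>periodic (\<lambda>x. a * cosk k x + b * sink k x)\<close> show ?thesis
    unfolding smooth_periodic_def by blast
qed

lemma integrable_L2p_mult:
  fixes u \<psi> :: "'n::finite func"
  assumes "u \<in> L2p" and "\<psi> \<in> smooth_periodic" and "\<And>x. \<bar>\<psi> x\<bar> \<le> C"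
  shows "integrable (lebesgue_on cell) (\<lambda>x. u x * \<psi> x)"
proof (rule Bochner_Integration.integrable_bound)
  have cell: "(cell :: (real^'n) set) \<in> lmeasurable"
    unfolding cell_def by (rule lmeasurable_box)
  have "u \<in> borel_measurable lebesgue" and u2: "integrable (lebesgue_on cell) (\<lambda>x. (u x)\<^sup>2)"
    using assms(1) unfolding L2p_def by blast+
  then have u: "u \<in> borel_measurable (lebesgue_on cell)"
    by (intro measurable_restrict_space1)
  have "pderivs [] \<psi> differentiable (at x)" for x
    using assms(2) unfolding smooth_periodic_def by blast
  then have "continuous_on UNIV \<psi>"
    unfolding pderivs_def foldr.simps id_apply
    by (intro continuous_at_imp_continuous_on ballI differentiable_imp_continuous_within)
  then have "\<psi> \<in> borel_measurable lebesgue"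
    by (intro measurable_completion) (simp add: borel_measurable_continuous_onI)
  then have "\<psi> \<in> borel_measurable (lebesgue_on cell)"
    by (intro measurable_restrict_space1)
  with u show "(\<lambda>x. u x * \<psi> x) \<in> borel_measurable (lebesgue_on cell)"
    by (rule borel_measurable_times)
  have "finite_measure (lebesgue_on (cell :: (real^'n) set))"
    using cell by (rule finite_measure_lebesgue_on)
  then show "integrable (lebesgue_on cell) (\<lambda>x. C * (1 + (u x)\<^sup>2))"
    by (intro integrable_mult_right Bochner_Integration.integrable_add u2
        finite_measure.integrable_const)
  have "norm (u x * \<psi> x) \<le> norm (C * (1 + (u x)\<^sup>2))" for x
  proof -
    have "0 \<le> (\<bar>u x\<bar> - 1 / 2)\<^sup>2"
      by simp
    also have "\<dots> = (u x)\<^sup>2 - \<bar>u x\<bar> + 1 / 4"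
      unfolding power2_diff by (simp add: power_divide)
    finally have "\<bar>u x\<bar> \<le> 1 + (u x)\<^sup>2"
      by simp
    moreover have "\<bar>\<psi> x\<bar> \<le> C"
      by (rule assms(3))
    ultimately have "\<bar>\<psi> x\<bar> * \<bar>u x\<bar> \<le> C * (1 + (u x)\<^sup>2)"
      by (intro mult_mono) simp_all
    then show ?thesis
      unfolding real_norm_def abs_mult[of "u x"] mult.commute[of "\<bar>u x\<bar>"] by linarith
  qed
  then show "AE x in lebesgue_on cell. norm (u x * \<psi> x) \<le> norm (C * (1 + (u x)\<^sup>2))"
    by simp
qed

lemma lap_trig:
  fixes k :: "int^'n::finite" and a b :: real
  assumes "w \<in> Hp 2"
  defines "e \<equiv> (\<lambda>x. a * cosk k x + b * sink k x)"
  shows "ip (lap w) e = - eigval k * ip w e"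
proof -
  have e: "e \<in> smooth_periodic"
    unfolding e_def by (rule trig_smooth_periodic)
  have bound: "\<bar>e x\<bar> \<le> \<bar>a\<bar> + \<bar>b\<bar>" for x
  proof -
    have "\<bar>a * cos y\<bar> \<le> \<bar>a\<bar>" "\<bar>b * sin y\<bar> \<le> \<bar>b\<bar>" for y
      by (simp_all add: abs_mult mult_left_le)
    then show ?thesis
      unfolding e_def cosk_def sink_def
      by (rule order_trans[OF abs_triangle_ineq add_mono])
  qed
  have wd: "wderiv [i, i] w \<in> L2p \<and> has_weak_deriv [i, i] w (wderiv [i, i] w)" for i
  proof -
    have "\<exists>g. g \<in> L2p \<and> has_weak_deriv [i, i] w g"
      using assms(1) by (auto simp: Hp_def Bex_def)
    then show ?thesis
      unfolding wderiv_def by (rule someI_ex)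
  qed
  have pd: "pderivs [i, i] e = (\<lambda>x. - (4 * pi\<^sup>2 * (of_int (k $ i))\<^sup>2) * e x)" for i
    unfolding pderivs_def foldr.simps o_apply id_apply e_def pderiv_dir_trig
    by (rule ext) (simp only: power2_eq_square ring_distribs, simp)
  have *: "ip (wderiv [i, i] w) e = - (4 * pi\<^sup>2 * (of_int (k $ i))\<^sup>2) * ip w e" for i
  proof -
    have "ip w (pderivs [i, i] e) = (- 1) ^ length [i, i] * ip (wderiv [i, i] w) e"
      using wd[of i] e unfolding has_weak_deriv_def by blast
    then have "ip (wderiv [i, i] w) e = ip w (pderivs [i, i] e)"
      by simp
    also have "\<dots> = - (4 * pi\<^sup>2 * (of_int (k $ i))\<^sup>2) * ip w e"
      unfolding pd ip_def mult.left_commute[of "w _"] by (rule integral_mult_right_zero)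
    finally show ?thesis .
  qed
  have "ip (lap w) e = (\<Sum>i\<in>UNIV. ip (wderiv [i, i] w) e)"
    unfolding ip_def lap_def sum_distrib_right
    by (rule Bochner_Integration.integral_sum) (use wd integrable_L2p_mult[OF _ e bound] in blast)
  also have "\<dots> = - eigval k * ip w e"
    unfolding * eigval_def sum_distrib_right[symmetric] sum_negf sum_distrib_left[symmetric] ..
  finally show ?thesis .
qed

text \<open>
  \<open>cosk k\<close> and \<open>sink k\<close> are eigenfunctions of \<open>- \<Delta>\<close> for \<open>eigval k\<close>
  (see \<open>lap_trig\<close> for the weak Laplacian); every zero-mean periodic \<open>w\<close> is
  \<open>\<Sum>k\<noteq>0. ip w (cosk k) * cosk k + ip w (sink k) * sink k\<close> (both \<open>k\<close> and \<open>- k\<close> occur in the sum,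
  so there is no factor 2). The power \<open>A\<^sub>0\<^sup>s\<close> multiplies the \<open>k\<close>-th mode by \<open>eigval k powr s\<close>.
  The value on \<open>v\<close> is meaningful only for \<open>dmean v = 0\<close>: the mode \<open>k = 0\<close> is ignored.
\<close>

definition A0_pow :: "real \<Rightarrow> 'n::finite functional \<Rightarrow> 'n functional" where
  "A0_pow s v = (\<lambda>w. \<Sum>\<^sub>\<infinity>k \<in> - {0}. eigval k powr s *
     (v (cosk k) * ip w (cosk k) + v (sink k) * ip w (sink k)))"

text \<open>The function in \<open>L\<^sup>2\<close> that represents a functional on \<open>L\<^sup>2\<close>.\<close>

definition L2_rep :: "'n::finite functional \<Rightarrow> 'n func" where
  "L2_rep v = (SOME u. u \<in> L2p \<and> (\<forall>w \<in> L2p. v w = ip u w))"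

definition Hm1norm :: "'n::finite functional \<Rightarrow> real" where
  "Hm1norm v = sqrt ((L2norm (L2_rep (A0_pow (- 1 / 2) (dbar v))))\<^sup>2 + (dmean v)\<^sup>2)"


section \<open>The phase space\<close>

type_synonym 'n state = "'n func \<times> 'n functional"

definition X0 :: "('n::finite state) set" where
  "X0 = Hp 2 \<times> Hdual 1"

definition X0norm :: "'n::finite state \<Rightarrow> real" where
  "X0norm z = sqrt ((Hnorm 2 (fst z))\<^sup>2 + (Hm1norm (snd z))\<^sup>2)"

definition X0_MM :: "real \<Rightarrow> real \<Rightarrow> real \<Rightarrow> ('n::finite state) set" where
  "X0_MM \<beta> M M' = {(u, v) \<in> X0. \<bar>\<beta> * dmean v + mean u\<bar> \<le> M \<and> \<bar>dmean v\<bar> \<le> M'}"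


section \<open>Functions of time\<close>

text \<open>Strong (Bochner) measurability: almost everywhere limit of simple functions.\<close>

definition strongly_measurable ::
  "real set \<Rightarrow> 'c::minus set \<Rightarrow> ('c \<Rightarrow> real) \<Rightarrow> (real \<Rightarrow> 'c) \<Rightarrow> bool" where
  "strongly_measurable I X N z \<longleftrightarrow>
     (\<exists>s :: nat \<Rightarrow> real \<Rightarrow> 'c.
        (\<forall>j. finite (s j ` I) \<and> s j ` I \<subseteq> X \<and> (\<forall>c. {t \<in> I. s j t = c} \<in> sets lebesgue)) \<and>
        (AE t in lebesgue_on I. (\<lambda>j. N (z t - s j t)) \<longlonglongrightarrow> 0))"

definition Linfty ::
  "real set \<Rightarrow> 'c::minus set \<Rightarrow> ('c \<Rightarrow> real) \<Rightarrow> (real \<Rightarrow> 'c) \<Rightarrow> bool" where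
  "Linfty I X N z \<longleftrightarrow>
     (AE t in lebesgue_on I. z t \<in> X) \<and> strongly_measurable I X N z \<and>
     (\<exists>C. AE t in lebesgue_on I. N (z t) \<le> C)"

definition test_fun :: "real set \<Rightarrow> (real \<Rightarrow> real) set" where
  "test_fun I = {\<eta>. (\<forall>k t. (deriv ^^ k) \<eta> differentiable (at t)) \<and>
                   (\<exists>K. compact K \<and> K \<subseteq> I \<and> (\<forall>t. t \<notin> K \<longrightarrow> \<eta> t = 0))}"

text \<open>\<open>v\<close> is the distributional time derivative of \<open>u\<close>, as functions with values in the dual of
  \<open>Hp m\<close>.\<close>

definition has_time_deriv ::
  "real set \<Rightarrow> nat \<Rightarrow> (real \<Rightarrow> 'n::finite functional) \<Rightarrow> (real \<Rightarrow> 'n functional) \<Rightarrow> bool" where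
  "has_time_deriv I m u v \<longleftrightarrow>
     (\<forall>w \<in> Hp m. \<forall>\<eta> \<in> test_fun I.
        (LINT t|lebesgue_on I. deriv \<eta> t * u t w) = - (LINT t|lebesgue_on I. \<eta> t * v t w))"


section \<open>Energy solutions and the solution semigroup\<close>

definition f_nl :: "real \<Rightarrow> real \<Rightarrow> real" where
  "f_nl \<epsilon> s = s ^ 3 + (1 - \<epsilon>) * s"

definition F_nl :: "real \<Rightarrow> real \<Rightarrow> real" where
  "F_nl \<epsilon> s = (1 - \<epsilon>) / 2 * s\<^sup>2 + 1 / 4 * s ^ 4"

definition energy :: "real \<Rightarrow> real \<Rightarrow> 'n::finite state \<Rightarrow> real" where
  "energy \<beta> \<epsilon> z = \<beta> / 2 * (Hm1norm (dbar (snd z)))\<^sup>2 +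
     (LINT x|lebesgue_on cell.
        1 / 2 * (lap (fst z) x)\<^sup>2 - grad_sq (fst z) x + F_nl \<epsilon> (fst z x))"

text \<open>
  \<open>equation \<beta> \<epsilon> \<phi> \<phi>t \<phi>tt\<close> is
  \<open>A\<^sub>0\<^sup>-\<^sup>1 (\<beta> \<phi>tt + \<phi>t) + \<Delta>\<^sup>2 \<phi> + 2 \<Delta> \<phi> + f(\<phi>) - \<langle>f(\<phi>)\<rangle> = 0\<close>
  at a fixed time, in the space of zero-mean elements of the dual of \<open>Hp 2\<close>. The first conjunct says
  that \<open>\<beta> \<phi>tt + \<phi>t\<close> is in the domain of \<open>A\<^sub>0\<^sup>-\<^sup>1\<close>.
\<close>

definition equation ::
  "real \<Rightarrow> real \<Rightarrow> 'n::finite func \<Rightarrow> 'n functional \<Rightarrow> 'n functional \<Rightarrow> bool" where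
  "equation \<beta> \<epsilon> \<phi> \<phi>t \<phi>tt \<longleftrightarrow>
     dmean (\<lambda>w. \<beta> * \<phi>tt w + \<phi>t w) = 0 \<and>
     (\<forall>w \<in> Hp 2.
        A0_pow (- 1) (\<lambda>w. \<beta> * \<phi>tt w + \<phi>t w) w + dlap (emb (lap \<phi>)) w + 2 * emb (lap \<phi>) w
        + emb (\<lambda>x. f_nl \<epsilon> (\<phi> x) - mean (\<lambda>y. f_nl \<epsilon> (\<phi> y))) w = 0)"

text \<open>
  The regularity \<open>\<phi> \<in> W\<^sup>1\<^sup>,\<^sup>\<infinity>(0,T; H\<^sup>-\<^sup>1)\<close>, \<open>\<phi>t \<in> W\<^sup>1\<^sup>,\<^sup>\<infinity>(0,T; H\<^sup>-\<^sup>4)\<close> gives \<open>\<phi>\<close> and \<open>\<phi>t\<close> representatives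
  that are continuous in time with values in these dual spaces; the initial conditions refer to
  them.
\<close>

definition energy_solution ::
  "real \<Rightarrow> real \<Rightarrow> ereal \<Rightarrow> 'n::finite state \<Rightarrow> (real \<Rightarrow> 'n state) \<Rightarrow> bool" where
  "energy_solution \<beta> \<epsilon> T z0 z \<longleftrightarrow>
     (let I = {t. 0 < t \<and> ereal t < T}; I0 = {t. 0 \<le> t \<and> ereal t < T};
          \<phi> = (\<lambda>t. fst (z t)); \<phi>t = (\<lambda>t. snd (z t))
      in Linfty I X0 X0norm z \<and>
         has_time_deriv I 1 (\<lambda>t. emb (\<phi> t)) \<phi>t \<and>
         (\<exists>\<phi>tt. Linfty I (Hdual 4) (dual_norm 4) \<phi>tt \<and> has_time_deriv I 4 \<phi>t \<phi>tt \<and>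
                (AE t in lebesgue_on I. equation \<beta> \<epsilon> (\<phi> t) (\<phi>t t) (\<phi>tt t))) \<and>
         (\<lambda>t. energy \<beta> \<epsilon> (z t)) \<in> borel_measurable (lebesgue_on I) \<and>
         (\<exists>C. AE t in lebesgue_on I. \<bar>energy \<beta> \<epsilon> (z t)\<bar> \<le> C) \<and>
         (\<forall>w \<in> Hp 1. continuous_on I0 (\<lambda>t. emb (\<phi> t) w)) \<and>
         (\<forall>w \<in> Hp 4. continuous_on I0 (\<lambda>t. \<phi>t t w)) \<and>
         (AE x in lebesgue. \<phi> 0 x = fst z0 x) \<and> (\<forall>w \<in> Hp 1. \<phi>t 0 w = snd z0 w))"

definition continuous_in_X0 :: "(real \<Rightarrow> 'n::finite state) \<Rightarrow> bool" where
  "continuous_in_X0 z \<longleftrightarrow>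
     (\<forall>t\<ge>0. z t \<in> X0 \<and> ((\<lambda>s. X0norm (z s - z t)) \<longlongrightarrow> 0) (at t within {0..}))"

text \<open>Since global energy solutions are unique, this determines \<open>S t z0\<close> for \<open>t \<ge> 0\<close>, \<open>z0 \<in> X0\<close>
  as an element of the phase space (that is, up to the choice of representatives).\<close>

definition solution_semigroup ::
  "real \<Rightarrow> real \<Rightarrow> (real \<Rightarrow> 'n::finite state \<Rightarrow> 'n state) \<Rightarrow> bool" where
  "solution_semigroup \<beta> \<epsilon> S \<longleftrightarrow>
     (\<forall>z0 \<in> X0. energy_solution \<beta> \<epsilon> \<infinity> z0 (\<lambda>t. S t z0) \<and> continuous_in_X0 (\<lambda>t. S t z0))"

end

theory Submission
  imports Defs
begin

text \<open>
  In Fourier modes \<open>a = \<langle>\<phi>, e\<rangle>\<close>, \<open>b = \<langle>\<phi>\<^sub>t, e\<rangle>\<close> the equation becomes the system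
  \<open>a' = b\<close>, \<open>\<beta> b' + b = - \<lambda> ((\<lambda>\<^sup>2 - 2 \<lambda>) a + \<langle>f(\<phi>), e\<rangle>)\<close> of classical ordinary differential
  equations. The energy \<open>\<E>\<close> of the truncation \<open>p\<^sub>N\<close> of \<open>\<phi>\<close>, perturbed by
  \<open>\<delta> \<Sum> (\<beta> a b + a\<^sup>2 / 2) / \<lambda>\<close>, is a Lyapunov functional \<open>\<Lambda>\<^sub>N\<close> satisfying
  \<open>\<Lambda>\<^sub>N' + \<kappa> \<Lambda>\<^sub>N \<le> C + \<bar>r\<^sub>N\<bar>\<close>, where \<open>r\<^sub>N\<close> pairs \<open>f(p\<^sub>N) - f(\<phi>)\<close> with \<open>\<phi>\<^sub>t + \<delta> \<phi>\<close>. In dimension at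
  most three, \<open>H\<^sup>2\<close> embeds into the continuous functions, hence \<open>f(p\<^sub>N) \<rightarrow> f(\<phi>)\<close> in \<open>H\<^sup>1\<close> and
  \<open>r\<^sub>N\<close>, a pairing of \<open>H\<^sup>1\<close> with \<open>H\<^sup>-\<^sup>1\<close>, tends to zero; this replaces the energy identity,
  which is not available directly since \<open>\<phi>\<^sub>t\<close> has only the regularity \<open>H\<^sup>-\<^sup>1\<close>. The mean values
  are controlled by \<open>\<beta> \<langle>\<phi>\<^sub>t\<rangle>' + \<langle>\<phi>\<^sub>t\<rangle> = 0\<close>.
\<close>

text \<open>The energy alone dissipates only the velocity part \<open>Xs\<close>; the term with
  \<open>\<delta>\<close> makes the derivative control \<open>Ys\<close> and the quartic integral
  \<open>Zs\<close> as well. The value \<open>\<delta> = 1 / (4 * (\<beta> + 1))\<close> is small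
  enough for the energy to absorb that term, and
  \<open>\<kappa> = min (1 / (2 * \<beta>)) (\<delta> / 4)\<close> is the rate that the dissipation
  then affords. The second time derivative is only an essentially bounded function with values in
  the dual of \<open>Hp 4\<close>. Continuity of the trajectory in \<open>X0\<close> makes the modes
  of the nonlinearity continuous in time, so the lemma of du Bois-Reymond yields classical
  derivatives. \<open>M\<close> and \<open>M'\<close> enter because frequency zero lies outside the
  dissipation: the truncated potential energy leaves the term \<open>b0\<close> times the integral
  of \<open>f\<close>, and \<open>f\<close> is tested with the truncation minus its mean. Quartic
  growth absorbs both effects once \<open>\<bar>b0\<bar> \<le> M'\<close> and
  \<open>\<bar>a0\<bar> \<le> M + \<beta> * M'\<close>. The estimate of the error uses the essential
  bound of the individual solution. Uniformity is saved by letting the truncation tend to infinity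
  at a fixed time: that bound disappears, and the radius depends only on data fixed in
  advance.\<close>

type_synonym 'n mode = "(int^'n) \<times> bool"

definition trig :: "'n::finite mode \<Rightarrow> 'n func" where
  "trig m = (if snd m then cosk (fst m) else sink (fst m))"

definition lam :: "'n::finite mode \<Rightarrow> real" where
  "lam m = eigval (fst m)"

definition Modes :: "nat \<Rightarrow> 'n::finite mode set" where
  "Modes N = {k. \<forall>i. \<bar>k $ i\<bar> \<le> int N} \<times> UNIV"

definition coef :: "'n::finite func \<Rightarrow> 'n mode \<Rightarrow> real" where
  "coef u m = ip u (trig m)"

definition tsum :: "nat \<Rightarrow> ('n::finite mode \<Rightarrow> real) \<Rightarrow> 'n func" where
  "tsum N d = (\<lambda>x. \<Sum>m\<in>Modes N. d m * trig m x)"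

text \<open>
  The functions \<open>trig m\<close> are linearly dependent, since the modes \<open>k\<close> and \<open>- k\<close> carry the same
  functions up to sign. Among the families \<open>d\<close> with a given sum, the one satisfying \<open>mode_symm\<close>
  is the family of Fourier coefficients, so that \<open>\<Sum> (d m)\<^sup>2\<close> is the squared norm without factor 2.
\<close>

definition mode_symm :: "('n::finite mode \<Rightarrow> real) \<Rightarrow> bool" where
  "mode_symm d \<longleftrightarrow> (\<forall>k. d (- k, True) = d (k, True) \<and> d (- k, False) = - d (k, False))"

section \<open>Integration over the cell\<close>

lemma abs_mult_le_squares: "\<bar>a * b\<bar> \<le> a\<^sup>2 + b\<^sup>2" for a b :: real
proof -
  have "2 * \<bar>a\<bar> * \<bar>b\<bar> \<le> \<bar>a\<bar>\<^sup>2 + \<bar>b\<bar>\<^sup>2" by (rule sum_squares_bound)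
  moreover have "0 \<le> \<bar>a\<bar> * \<bar>b\<bar>" by simp
  ultimately show ?thesis unfolding abs_mult power2_abs by linarith
qed

lemma power2_sum_le: "(a + b)\<^sup>2 \<le> 2 * a\<^sup>2 + 2 * b\<^sup>2" for a b :: real
  using sum_squares_bound[of a b] unfolding power2_sum by linarith

lemma one_le_four_pi_sq: "1 \<le> 4 * pi\<^sup>2"
proof -
  have "1 * 1 \<le> pi * pi"
    using pi_ge_two by (intro mult_mono) auto
  then show ?thesis by (simp add: power2_eq_square)
qed

lemma cell_lmeasurable [simp]: "(cell :: (real^'n::finite) set) \<in> lmeasurable"
  unfolding cell_def by (rule lmeasurable_box)

lemma finite_measure_cell: "finite_measure (lebesgue_on (cell :: (real^'n::finite) set))"
  by (intro finite_measure_lebesgue_on cell_lmeasurable)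

lemma Basis_vec_axis: "(Basis :: (real^'n::finite) set) = range (\<lambda>i. axis i 1)"
  by (auto simp: Basis_vec_def)

lemma cell_iff: "(x :: real^'n::finite) \<in> cell \<longleftrightarrow> (\<forall>i. 0 < x $ i \<and> x $ i < 1)"
  by (simp add: cell_def mem_box Basis_vec_axis inner_axis)

lemma measure_cell [simp]: "measure lebesgue (cell :: (real^'n::finite) set) = 1"
proof -
  have "measure lborel (box (0::real^'n) 1) = (\<Prod>b\<in>(Basis :: (real^'n) set). (1 - 0) \<bullet> b)"
    unfolding measure_lborel_box_eq by (simp, simp add: Basis_vec_axis inner_axis)
  also have "\<dots> = 1"
    by (rule prod.neutral) (auto simp: Basis_vec_axis inner_axis)
  finally show ?thesis
    by (simp add: cell_def)
qed

lemma integral_const_cell [simp]: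
  "(LINT x|lebesgue_on (cell :: (real^'n::finite) set). c) = (c::real)"
  using measure_restrict_space[of cell lebesgue "cell :: (real^'n) set"]
  by (simp add: fmeasurableD)

lemma measure_lebesgue_on_cell [simp]: "measure (lebesgue_on cell) (cell :: (real^'n::finite) set) = 1"
  using measure_restrict_space[of cell lebesgue "cell :: (real^'n) set"]
  by (simp add: fmeasurableD)

lemma integrable_const_cell [simp]:
  "integrable (lebesgue_on (cell :: (real^'n::finite) set)) (\<lambda>x. c::real)"
  by (intro finite_measure.integrable_const finite_measure_cell)

lemma continuous_cell:
  fixes h :: "real^'n::finite \<Rightarrow> real"
  assumes "continuous_on UNIV h"
  shows "integrable (lebesgue_on cell) h" (is ?A)
    and "(LINT x|lebesgue_on cell. h x) = integral (cbox 0 1) h" (is ?B)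
    and "h \<in> borel_measurable lebesgue"
proof -
  have "h absolutely_integrable_on (cbox 0 1)"
    by (rule absolutely_integrable_continuous) (use assms continuous_on_subset in blast)
  then have "h absolutely_integrable_on cell"
    unfolding cell_def
    by (rule set_integrable_subset) (auto simp: box_subset_cbox)
  then show A: ?A
    by (subst integrable_restrict_space) (auto simp: set_integrable_def fmeasurableD)
  show ?B
    using lebesgue_integral_eq_integral[OF A] integral_open_interval[of 0 1 h]
    by (simp add: cell_def fmeasurableD)
  show "h \<in> borel_measurable lebesgue"
    using assms by (intro measurable_completion) (simp add: borel_measurable_continuous_onI)
qed

text \<open>The cell shifted by \<open>s\<close> along axis \<open>i\<close> is cut at the
  hyperplane where that coordinate equals 1; the piece beyond it is moved back by one period and
  fills the slab that the shift left empty. Since \<open>s\<close> lies in \<open>[0, 1]\<close>,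
  one cut suffices.\<close>

lemma periodic_shift_integral:
  fixes h :: "real^'n::finite \<Rightarrow> real"
  assumes h: "continuous_on UNIV h" and per: "periodic h" and s: "0 \<le> s" "s \<le> 1"
  shows "integral (cbox 0 1) (\<lambda>x. h (x + s *\<^sub>R axis i 1)) = integral (cbox 0 1) h"
proof -
  let ?e = "axis i 1 :: real^'n"
  have hc: "h integrable_on cbox a b" for a b
    using h continuous_on_subset by (intro integrable_continuous) blast
  have tr: "integral (cbox a b) (\<lambda>x. h (x + c)) = integral (cbox (a + c) (b + c)) h" for a b c
  proof -
    have "((\<lambda>x. h (1 *\<^sub>R x + c)) has_integral (1 / \<bar>1\<bar> ^ DIM(real^'n)) *\<^sub>R integral (cbox (a + c) (b + c)) h)
      ((\<lambda>x. (1 / 1) *\<^sub>R x + - ((1 / 1) *\<^sub>R c)) ` cbox (a + c) (b + c))"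
      by (rule has_integral_affinity) (auto intro: integrable_integral hc)
    moreover have "(\<lambda>x. (1 / 1) *\<^sub>R x + - ((1 / 1) *\<^sub>R c)) ` cbox (a + c) (b + c) = cbox a b"
      using cbox_translation[of "- c" "a + c" "b + c"] by (simp add: add.commute)
    ultimately show ?thesis
      by (simp add: integral_unique)
  qed
  have B: "?e \<in> Basis" by (auto simp: Basis_vec_axis)
  have split: "integral (cbox a b) h =
      integral (cbox a b \<inter> {x. x \<bullet> ?e \<le> c}) h + integral (cbox a b \<inter> {x. x \<bullet> ?e \<ge> c}) h" for a b c
    by (rule integral_split[OF hc B])
  have c1: "cbox (s *\<^sub>R ?e) (1 + s *\<^sub>R ?e) \<inter> {x. x \<bullet> ?e \<le> 1} = cbox (s *\<^sub>R ?e) 1"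
    using s unfolding set_eq_iff Int_iff mem_Collect_eq inner_axis mem_box_cart by (simp add: axis_def) (smt (verit) mult_cancel_left1 mult_zero_right)
  have c2: "cbox (s *\<^sub>R ?e) (1 + s *\<^sub>R ?e) \<inter> {x. x \<bullet> ?e \<ge> 1} = cbox (0 + ?e) ((1 - (1 - s) *\<^sub>R ?e) + ?e)"
    using s unfolding set_eq_iff Int_iff mem_Collect_eq inner_axis mem_box_cart by (simp add: axis_def) (smt (verit) mult_cancel_left1 mult_zero_right)
  have c3: "cbox 0 1 \<inter> {x. x \<bullet> ?e \<ge> s} = cbox (s *\<^sub>R ?e) 1"
    using s unfolding set_eq_iff Int_iff mem_Collect_eq inner_axis mem_box_cart by (simp add: axis_def) (smt (verit) mult_cancel_left1 mult_zero_right)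
  have c4: "cbox 0 1 \<inter> {x. x \<bullet> ?e \<le> s} = cbox 0 (1 - (1 - s) *\<^sub>R ?e)"
    using s unfolding set_eq_iff Int_iff mem_Collect_eq inner_axis mem_box_cart by (simp add: axis_def) (smt (verit) mult_cancel_left1 mult_zero_right)
  have "integral (cbox 0 1) (\<lambda>x. h (x + s *\<^sub>R ?e)) = integral (cbox (s *\<^sub>R ?e) (1 + s *\<^sub>R ?e)) h"
    using tr[of 0 1 "s *\<^sub>R ?e"] by simp
  also have "\<dots> = integral (cbox (s *\<^sub>R ?e) 1) h + integral (cbox (0 + ?e) ((1 - (1 - s) *\<^sub>R ?e) + ?e)) h"
    by (subst split[where c = 1]) (simp only: c1 c2)
  also have "integral (cbox (0 + ?e) ((1 - (1 - s) *\<^sub>R ?e) + ?e)) h = integral (cbox 0 (1 - (1 - s) *\<^sub>R ?e)) h"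
    using per by (subst tr[symmetric]) (simp add: periodic_def)
  also have "integral (cbox (s *\<^sub>R ?e) 1) h + \<dots> = integral (cbox 0 1) h"
    by (subst split[where c = s and a = 0]) (simp only: c3 c4 add.commute)
  finally show ?thesis .
qed

text \<open>The integral of the shifted function does not depend on the shift, so its derivative,
  taken under the integral, vanishes. That derivative is one-sided, within \<open>{0..1}\<close>,
  where the shift lemma applies. Orthogonality of the modes and all integrations by parts rest on
  this.\<close>

lemma integral_periodic_derivative:
  fixes h h' :: "real^'n::finite \<Rightarrow> real"
  assumes h: "continuous_on UNIV h" and h': "continuous_on UNIV h'" and per: "periodic h"
    and d: "\<And>x. ((\<lambda>s. h (x + s *\<^sub>R axis i 1)) has_real_derivative h' x) (at 0)"
  shows "(LINT x|lebesgue_on cell. h' x) = 0"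
proof -
  let ?e = "axis i 1 :: real^'n"
  let ?G = "\<lambda>s. integral (cbox 0 1) (\<lambda>x. h (x + s *\<^sub>R ?e))"
  have D: "((\<lambda>s. h (x + s *\<^sub>R ?e)) has_real_derivative h' (x + s *\<^sub>R ?e)) (at s within {0..1})" for x s
  proof -
    have "((\<lambda>\<sigma>. h ((x + s *\<^sub>R ?e) + \<sigma> *\<^sub>R ?e)) has_real_derivative h' (x + s *\<^sub>R ?e)) (at 0)"
      by (rule d)
    then have "((\<lambda>\<sigma>. h (x + (\<sigma> + s) *\<^sub>R ?e)) has_real_derivative h' (x + s *\<^sub>R ?e)) (at 0)"
      by (simp add: algebra_simps)
    then have "((\<lambda>\<sigma>. h (x + \<sigma> *\<^sub>R ?e)) has_real_derivative h' (x + s *\<^sub>R ?e)) (at (0 + s))"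
      by (subst DERIV_shift)
    then show ?thesis by (simp add: has_field_derivative_at_within)
  qed
  have "(?G has_field_derivative integral (cbox 0 1) (\<lambda>x. h' (x + 0 *\<^sub>R ?e))) (at 0 within {0..1})"
  proof (rule leibniz_rule_field_derivative[where fx = "\<lambda>s x. h' (x + s *\<^sub>R ?e)"])
    show "(\<lambda>x. h (x + s *\<^sub>R ?e)) integrable_on cbox 0 1" for s
      by (intro integrable_continuous continuous_on_compose2[OF h] continuous_intros) auto
    show "continuous_on ({0..1} \<times> cbox 0 1) (\<lambda>(s, x). h' (x + s *\<^sub>R ?e))"
      unfolding case_prod_beta
      by (intro continuous_on_compose2[OF h'] continuous_intros) auto
  qed (use D in auto)
  moreover have "(?G has_field_derivative 0) (at 0 within {0..1})"
    by (rule has_field_derivative_transform_within[of "\<lambda>s. integral (cbox 0 1) h" _ _ _ 1])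
      (auto simp: periodic_shift_integral[OF h per])
  moreover have "at 0 within {0..1::real} \<noteq> bot"
    by (simp add: trivial_limit_within islimpt_Icc)
  ultimately have "integral (cbox 0 1) (\<lambda>x. h' (x + 0 *\<^sub>R ?e)) = 0"
    unfolding has_real_derivative_iff_has_vector_derivative
    by (metis vector_derivative_unique_within)
  then show ?thesis
    using continuous_cell(2)[OF h'] by simp
qed

section \<open>Trigonometric functions\<close>

lemma phase_minus: "phase (- k) x = - phase k x"
  by (simp add: phase_def sum_negf)

lemma phase_add: "phase (j + k) x = phase j x + phase k x"
  by (simp add: phase_def ring_distribs sum.distrib)

lemma phase_diff: "phase (j - k) x = phase j x - phase k x"
  using phase_add[of j "- k" x] by (simp add: phase_minus)

lemma cosk_minus [simp]: "cosk (- k) = cosk k"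
  by (simp add: cosk_def phase_minus)

lemma sink_minus [simp]: "sink (- k) = (\<lambda>x. - sink k x)"
  by (simp add: sink_def phase_minus)

lemma cosk_0 [simp]: "cosk 0 = (\<lambda>x. 1)"
  by (simp add: cosk_def phase_def)

lemma sink_0 [simp]: "sink 0 = (\<lambda>x. 0)"
  by (simp add: sink_def phase_def)

lemma trig_abs_le: "\<bar>trig m x\<bar> \<le> 1"
  by (simp add: trig_def cosk_def sink_def)

lemma trig_minus: "trig (- k, True) = trig (k, True)" "trig (- k, False) = (\<lambda>x. - trig (k, False) x)"
  by (simp_all add: trig_def)

lemma continuous_on_phase [continuous_intros]: "continuous_on S (phase k)"
  unfolding phase_def by (intro continuous_intros)

lemma continuous_on_cosk [continuous_intros]: "continuous_on S (cosk k)"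
  unfolding cosk_def by (intro continuous_intros)

lemma continuous_on_sink [continuous_intros]: "continuous_on S (sink k)"
  unfolding sink_def by (intro continuous_intros)

lemma continuous_on_trig [continuous_intros]: "continuous_on S (trig m)"
  unfolding trig_def by (auto intro: continuous_intros)

lemma smooth_cosk: "cosk k \<in> smooth_periodic" and smooth_sink: "sink k \<in> smooth_periodic"
  using trig_smooth_periodic[of 1 k 0] trig_smooth_periodic[of 0 k 1] by auto

lemma smooth_trig: "trig m \<in> smooth_periodic"
  by (simp add: trig_def smooth_cosk smooth_sink)

lemma periodic_trig: "periodic (trig m)"
  using smooth_trig[of m] unfolding smooth_periodic_def by blast

lemma cosk_deriv:
  "((\<lambda>s. cosk k (x + s *\<^sub>R axis i 1)) has_real_derivative - 2 * pi * of_int (k $ i) * sink k x) (at 0)"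
  unfolding cosk_def sink_def phase_shift
  by (rule derivative_eq_intros refl | simp)+

lemma sink_deriv:
  "((\<lambda>s. sink k (x + s *\<^sub>R axis i 1)) has_real_derivative 2 * pi * of_int (k $ i) * cosk k x) (at 0)"
  unfolding cosk_def sink_def phase_shift
  by (rule derivative_eq_intros refl | simp)+

lemma integral_cosk: "(LINT x|lebesgue_on cell. cosk k x) = (if k = 0 then 1 else 0)"
proof (cases "k = 0")
  case False
  then obtain i where i: "k $ i \<noteq> 0"
    by (auto simp: vec_eq_iff)
  have "(LINT x|lebesgue_on cell. 2 * pi * of_int (k $ i) * cosk k x) = 0"
    by (rule integral_periodic_derivative[OF _ _ _ sink_deriv])
      (use smooth_sink[of k] in \<open>auto intro!: continuous_intros simp: smooth_periodic_def\<close>)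
  then show ?thesis
    using i False by simp
qed simp

lemma integral_sink: "(LINT x|lebesgue_on cell. sink k x) = 0"
proof (cases "k = 0")
  case False
  then obtain i where i: "k $ i \<noteq> 0"
    by (auto simp: vec_eq_iff)
  have "(LINT x|lebesgue_on cell. - 2 * pi * of_int (k $ i) * sink k x) = 0"
    by (rule integral_periodic_derivative[OF _ _ _ cosk_deriv])
      (use smooth_cosk[of k] in \<open>auto intro!: continuous_intros simp: smooth_periodic_def\<close>)
  then show ?thesis
    using i False by simp
qed simp

lemma integrable_cosk: "integrable (lebesgue_on cell) (cosk k)"
  and integrable_sink: "integrable (lebesgue_on cell) (sink k)"
  by (auto intro!: continuous_cell continuous_intros)

text \<open>Product-to-sum formula. For \<open>j = k = 0\<close> both alternatives hold and add up
  to the norm 1 of the constant, so frequency zero gets no case of its own.\<close>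

lemma ip_cosk_cosk:
  "ip (cosk j) (cosk k) = ((if j = k then 1 else 0) + (if j = - k then 1 else 0)) / 2"
proof -
  have "ip (cosk j) (cosk k) = (LINT x|lebesgue_on cell. (cosk (j - k) x + cosk (j + k) x) / 2)"
    unfolding ip_def cosk_def phase_diff phase_add by (simp add: cos_times_cos)
  also have "\<dots> = ((if j = k then 1 else 0) + (if j = - k then 1 else 0)) / 2"
    by (simp add: integrable_cosk integral_cosk eq_neg_iff_add_eq_0)
  finally show ?thesis .
qed

lemma ip_sink_sink:
  "ip (sink j) (sink k) = ((if j = k then 1 else 0) - (if j = - k then 1 else 0)) / 2"
proof -
  have "ip (sink j) (sink k) = (LINT x|lebesgue_on cell. (cosk (j - k) x - cosk (j + k) x) / 2)"
    unfolding ip_def cosk_def sink_def phase_diff phase_add by (simp add: sin_times_sin)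
  also have "\<dots> = ((if j = k then 1 else 0) - (if j = - k then 1 else 0)) / 2"
    by (simp add: integrable_cosk integral_cosk eq_neg_iff_add_eq_0)
  finally show ?thesis .
qed

lemma ip_sink_cosk: "ip (sink j) (cosk k) = 0"
proof -
  have "ip (sink j) (cosk k) = (LINT x|lebesgue_on cell. (sink (j + k) x + sink (j - k) x) / 2)"
    unfolding ip_def cosk_def sink_def phase_diff phase_add by (simp add: sin_times_cos)
  also have "\<dots> = 0"
    by (simp add: integrable_sink integral_sink)
  finally show ?thesis .
qed

lemma ip_commute: "ip u w = ip w u"
  by (simp add: ip_def mult.commute)

lemma ip_cosk_sink: "ip (cosk j) (sink k) = 0"
  using ip_sink_cosk ip_commute by metis

section \<open>Square integrable functions\<close>

lemma L2p_D:
  assumes "u \<in> L2p"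
  shows "u \<in> borel_measurable lebesgue" "periodic u" "integrable (lebesgue_on cell) (\<lambda>x. (u x)\<^sup>2)"
    "u \<in> borel_measurable (lebesgue_on cell)"
  using assms by (auto simp: L2p_def intro: measurable_restrict_space1)

lemma L2p_mult_integrable:
  assumes "u \<in> L2p" "w \<in> L2p"
  shows "integrable (lebesgue_on cell) (\<lambda>x. u x * w x)"
proof (rule Bochner_Integration.integrable_bound)
  show "integrable (lebesgue_on cell) (\<lambda>x. (u x)\<^sup>2 + (w x)\<^sup>2)"
    using L2p_D(3)[OF assms(1)] L2p_D(3)[OF assms(2)] by (rule Bochner_Integration.integrable_add)
  show "(\<lambda>x. u x * w x) \<in> borel_measurable (lebesgue_on cell)"
    using L2p_D(4)[OF assms(1)] L2p_D(4)[OF assms(2)] by (rule borel_measurable_times)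
  show "AE x in lebesgue_on cell. norm (u x * w x) \<le> norm ((u x)\<^sup>2 + (w x)\<^sup>2)"
    using abs_mult_le_squares by simp
qed

lemma L2p_scale:
  assumes "u \<in> L2p" shows "(\<lambda>x. c * u x) \<in> L2p"
  using L2p_D[OF assms] by (auto simp: L2p_def periodic_def power_mult_distrib)

lemma L2p_add:
  assumes "u \<in> L2p" "w \<in> L2p" shows "(\<lambda>x. u x + w x) \<in> L2p"
proof -
  have "integrable (lebesgue_on cell) (\<lambda>x. (u x)\<^sup>2 + (w x)\<^sup>2 + 2 * (u x * w x))"
    using L2p_D(3)[OF assms(1)] L2p_D(3)[OF assms(2)] L2p_mult_integrable[OF assms]
    by (intro Bochner_Integration.integrable_add integrable_mult_right)
  then show ?thesis
    using L2p_D[OF assms(1)] L2p_D[OF assms(2)]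
    by (auto simp: L2p_def periodic_def power2_sum mult.assoc)
qed

lemma L2p_diff:
  assumes "u \<in> L2p" "w \<in> L2p" shows "(\<lambda>x. u x - w x) \<in> L2p"
  using L2p_add[OF assms(1) L2p_scale[OF assms(2), of "-1"]] by simp

lemma L2p_continuous:
  fixes u :: "'n::finite func"
  assumes "continuous_on UNIV u" "periodic u" shows "u \<in> L2p"
  using assms by (auto simp: L2p_def intro!: continuous_cell continuous_intros)

lemma L2p_const [simp]: "(\<lambda>x. c) \<in> L2p"
  by (auto simp: L2p_def periodic_def)

lemma L2p_trig [simp]: "trig m \<in> L2p"
  by (intro L2p_continuous continuous_intros periodic_trig)

lemma L2p_sum:
  assumes "finite A" "\<And>a. a \<in> A \<Longrightarrow> u a \<in> L2p" shows "(\<lambda>x. \<Sum>a\<in>A. u a x) \<in> L2p"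
  using assms by (induction A) (auto intro: L2p_add)

lemma ip_add_left: "u \<in> L2p \<Longrightarrow> v \<in> L2p \<Longrightarrow> w \<in> L2p \<Longrightarrow> ip (\<lambda>x. u x + v x) w = ip u w + ip v w"
  by (simp add: ip_def ring_distribs L2p_mult_integrable)

lemma ip_diff_left: "u \<in> L2p \<Longrightarrow> v \<in> L2p \<Longrightarrow> w \<in> L2p \<Longrightarrow> ip (\<lambda>x. u x - v x) w = ip u w - ip v w"
  by (simp add: ip_def left_diff_distrib L2p_mult_integrable)

lemma ip_scale_left: "ip (\<lambda>x. c * u x) w = c * ip u w"
  by (simp add: ip_def mult.assoc)

lemma ip_minus_left: "ip (\<lambda>x. - u x) w = - ip u w"
  by (simp add: ip_def)

lemma ip_minus_right: "ip w (\<lambda>x. - u x) = - ip w u"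
  by (simp add: ip_def)

lemma ip_sum_left:
  assumes "finite A" "\<And>a. a \<in> A \<Longrightarrow> u a \<in> L2p" "w \<in> L2p"
  shows "ip (\<lambda>x. \<Sum>a\<in>A. u a x) w = (\<Sum>a\<in>A. ip (u a) w)"
  using assms by (simp add: ip_def sum_distrib_right L2p_mult_integrable Bochner_Integration.integral_sum)

lemma ip_nonneg: "0 \<le> ip u u"
  by (simp add: ip_def)

lemma L2norm_sq: "(L2norm u)\<^sup>2 = ip u u"
  by (simp add: L2norm_def ip_nonneg)

lemma mean_eq: "mean u = ip u (\<lambda>x. 1)"
  by (simp add: mean_def ip_def)

lemma ip_cong_AE:
  assumes "AE x in lebesgue_on cell. u x = u' x" "u \<in> L2p" "u' \<in> L2p" "w \<in> L2p"
  shows "ip u w = ip u' w"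
  unfolding ip_def
  using assms(1) L2p_D(4)[OF assms(2)] L2p_D(4)[OF assms(3)] L2p_D(4)[OF assms(4)]
  by (intro integral_cong_AE) auto

section \<open>Finite trigonometric sums\<close>

lemma finite_box: "finite {k :: int^'n::finite. \<forall>i. \<bar>k $ i\<bar> \<le> int N}"
proof -
  have "{k :: int^'n. \<forall>i. \<bar>k $ i\<bar> \<le> int N} \<subseteq> vec_lambda ` (UNIV \<rightarrow>\<^sub>E {- int N..int N})"
  proof
    fix k :: "int^'n" assume "k \<in> {k. \<forall>i. \<bar>k $ i\<bar> \<le> int N}"
    then have "vec_nth k \<in> UNIV \<rightarrow>\<^sub>E {- int N..int N}"
      by (auto simp: PiE_def abs_le_iff minus_le_iff)
    then show "k \<in> vec_lambda ` (UNIV \<rightarrow>\<^sub>E {- int N..int N})"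
      by (rule rev_image_eqI) simp
  qed
  then show ?thesis
    by (rule finite_subset) (intro finite_imageI finite_PiE, auto)
qed

lemma finite_Modes [simp]: "finite (Modes N :: 'n::finite mode set)"
  unfolding Modes_def by (intro finite_cartesian_product finite_box) simp

lemma Modes_iff: "(k, b) \<in> Modes N \<longleftrightarrow> (\<forall>i. \<bar>k $ i\<bar> \<le> int N)"
  by (simp add: Modes_def)

lemma Modes_mono: "M \<le> N \<Longrightarrow> Modes M \<subseteq> Modes N"
  by (auto simp: Modes_def intro: order_trans)

lemma mode_in_Modes: "\<exists>N0. \<forall>N\<ge>N0. m \<in> (Modes N :: 'n::finite mode set)"
proof -
  obtain k b where m: "m = (k, b)" by force
  have "\<bar>k $ i\<bar> \<le> int N" if "N \<ge> (\<Sum>i\<in>UNIV. nat \<bar>k $ i\<bar>)" for i N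
  proof -
    have "nat \<bar>k $ i\<bar> \<le> (\<Sum>i\<in>UNIV. nat \<bar>k $ i\<bar>)"
      by (rule member_le_sum) auto
    then show ?thesis using that by linarith
  qed
  then show ?thesis unfolding m Modes_iff by blast
qed

lemma finite_subset_Modes:
  assumes "finite (F :: 'n::finite mode set)" shows "\<exists>N0. \<forall>N\<ge>N0. F \<subseteq> Modes N"
  using assms
proof induction
  case (insert m F)
  then obtain N1 N2 where "\<forall>N\<ge>N1. F \<subseteq> Modes N" "\<forall>N\<ge>N2. m \<in> Modes N"
    using mode_in_Modes by metis
  then have "\<forall>N\<ge>max N1 N2. insert m F \<subseteq> Modes N" by auto
  then show ?case ..
qed auto

lemma sum_Modes:
  "(\<Sum>m\<in>Modes N. g m) = (\<Sum>k | \<forall>i. \<bar>k $ i\<bar> \<le> int N. g (k, True) + g (k, False))"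
proof -
  have "(\<Sum>m\<in>Modes N. g m) = (\<Sum>k | \<forall>i. \<bar>k $ i\<bar> \<le> int N. \<Sum>b\<in>UNIV. g (k, b))"
    unfolding Modes_def by (subst sum.cartesian_product) simp
  then show ?thesis by (simp add: UNIV_bool add.commute)
qed

text \<open>The Gram matrix couples a mode only with itself and with its mirror image at
  \<open>- k\<close>, each with weight 1/2, the sine with opposite sign. Under
  \<open>mode_symm\<close> the two halves agree, so the matrix acts as the identity although the
  system is not orthonormal.\<close>

lemma reproducing:
  fixes d :: "'n::finite mode \<Rightarrow> real"
  assumes "mode_symm d"
  shows "(\<Sum>m'\<in>Modes N. d m' * ip (trig m') (trig m)) = (if m \<in> Modes N then d m else 0)"
proof -
  obtain k b where m: "m = (k, b)" by force
  let ?Q = "{k :: int^'n. \<forall>i. \<bar>k $ i\<bar> \<le> int N}"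
  have Q: "- k \<in> ?Q \<longleftrightarrow> k \<in> ?Q" by simp
  have e: "- k = k" if "2 * k = 0"
    using that by (metis mult_2 minus_unique)
  show ?thesis
  proof (cases b)
    case True
    have "(\<Sum>m'\<in>Modes N. d m' * ip (trig m') (trig m)) =
      (\<Sum>j\<in>?Q. (if j = k then d (j, True) / 2 else 0) + (if j = - k then d (j, True) / 2 else 0))"
      unfolding sum_Modes m trig_def by (rule sum.cong) (simp_all add: True ip_cosk_cosk ip_sink_cosk distrib_left add_divide_distrib if_distrib[of "(*) _"] if_distrib[of "\<lambda>x. x / 2"] cong: if_cong)
    also have "\<dots> = (if k \<in> ?Q then d (k, True) / 2 else 0) + (if - k \<in> ?Q then d (- k, True) / 2 else 0)"
      unfolding sum.distrib by (simp only: sum.delta finite_box)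
    also have "\<dots> = (if k \<in> ?Q then d (k, True) else 0)"
      unfolding Q using spec[OF assms[unfolded mode_symm_def], of k]
      by (cases "k \<in> ?Q") (simp_all only: if_True if_False field_sum_of_halves)
    finally show ?thesis using True by (simp add: m Modes_iff)
  next
    case False
    have "(\<Sum>m'\<in>Modes N. d m' * ip (trig m') (trig m)) =
      (\<Sum>j\<in>?Q. (if j = k then d (j, False) / 2 else 0) + (if j = - k then - d (j, False) / 2 else 0))"
      unfolding sum_Modes m trig_def by (rule sum.cong) (auto simp add: False ip_cosk_sink ip_sink_sink right_diff_distrib diff_divide_distrib e)
    also have "\<dots> = (if k \<in> ?Q then d (k, False) / 2 else 0) + (if - k \<in> ?Q then - d (- k, False) / 2 else 0)"
      unfolding sum.distrib by (simp only: sum.delta finite_box)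
    also have "\<dots> = (if k \<in> ?Q then d (k, False) else 0)"
      unfolding Q using spec[OF assms[unfolded mode_symm_def], of k]
      by (cases "k \<in> ?Q") (simp_all only: if_True if_False minus_minus field_sum_of_halves)
    finally show ?thesis using False by (simp add: m Modes_iff)
  qed
qed

lemma mode_symm_coef: "mode_symm (coef u)"
  by (simp add: mode_symm_def coef_def trig_minus ip_minus_right)

lemma continuous_on_tsum [continuous_intros]: "continuous_on S (tsum N d)"
  unfolding tsum_def by (intro continuous_intros)

lemma periodic_tsum: "periodic (tsum N (d :: 'n::finite mode \<Rightarrow> real))"
proof -
  have "trig m (x + axis i 1) = trig m x" for m :: "'n mode" and x i
    using periodic_trig[of m] by (auto simp: periodic_def)
  then show ?thesis
    by (simp add: periodic_def tsum_def)
qed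

lemma L2p_tsum [simp]: "tsum N d \<in> L2p"
  by (intro L2p_continuous continuous_intros periodic_tsum)

lemma ip_tsum: "w \<in> L2p \<Longrightarrow> ip (tsum N d) w = (\<Sum>m\<in>Modes N. d m * coef w m)"
  unfolding tsum_def
  by (subst ip_sum_left) (auto intro: L2p_scale simp: ip_scale_left coef_def ip_commute[of w])

lemma coef_tsum: "mode_symm d \<Longrightarrow> coef (tsum N d) m = (if m \<in> Modes N then d m else 0)"
  unfolding coef_def ip_tsum[OF L2p_trig] ip_commute[of "trig m"] by (rule reproducing)

lemma ip_tsum_self: "mode_symm d \<Longrightarrow> ip (tsum N d) (tsum N d) = (\<Sum>m\<in>Modes N. (d m)\<^sup>2)"
  by (subst ip_tsum) (auto simp: coef_tsum power2_eq_square)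

lemma ip_diff_self:
  assumes "u \<in> L2p" "w \<in> L2p"
  shows "ip (\<lambda>x. u x - w x) (\<lambda>x. u x - w x) = ip u u - 2 * ip u w + ip w w"
  using ip_diff_left[OF assms L2p_diff[OF assms]] ip_diff_left[OF assms assms(1)] ip_diff_left[OF assms assms(2)]
    ip_commute[of u "\<lambda>x. u x - w x"] ip_commute[of w "\<lambda>x. u x - w x"] ip_commute[of w u]
  by linarith

lemma ip_diff_tsum_coef:
  assumes "u \<in> L2p"
  shows "ip (\<lambda>x. u x - tsum N (coef u) x) (\<lambda>x. u x - tsum N (coef u) x) =
    ip u u - (\<Sum>m\<in>Modes N. (coef u m)\<^sup>2)"
  using ip_diff_self[OF assms L2p_tsum[of N "coef u"]] ip_commute[of u "tsum N (coef u)"] ip_tsum[OF assms, of N "coef u"]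
    ip_tsum_self[OF mode_symm_coef[of u], of N]
  by (simp add: power2_eq_square)

lemma Bessel:
  assumes "u \<in> L2p"
  shows "(\<Sum>m\<in>Modes N. (coef u m)\<^sup>2) \<le> ip u u"
  using ip_diff_tsum_coef[OF assms, of N] ip_nonneg[of "\<lambda>x. u x - tsum N (coef u) x"] by linarith

section \<open>Completeness of the trigonometric system\<close>

text \<open>The span of the system, given inductively so that orthogonality passes to it by
  linearity and closure under products follows by a double induction.\<close>

inductive_set trigpoly :: "('n::finite func) set" where
  trig: "trig m \<in> trigpoly"
| add: "f \<in> trigpoly \<Longrightarrow> g \<in> trigpoly \<Longrightarrow> (\<lambda>x. f x + g x) \<in> trigpoly"
| scale: "f \<in> trigpoly \<Longrightarrow> (\<lambda>x. c * f x) \<in> trigpoly"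

lemma trigpoly_const: "(\<lambda>x. c) \<in> trigpoly"
  using trigpoly.scale[OF trigpoly.trig[of "(0, True)"], of c] by (simp add: trig_def)

lemma trigpoly_trig_mult: "(\<lambda>x. trig m x * trig m' x) \<in> trigpoly"
proof -
  obtain j b k b' where m: "m = (j, b)" "m' = (k, b')" by force
  have T: "(\<lambda>x. c * trig n x + c' * trig n' x) \<in> trigpoly" for c c' n n'
    by (intro trigpoly.intros)
  have "\<exists>c c' n n'. (\<lambda>x. trig m x * trig m' x) = (\<lambda>x. c * trig n x + c' * trig n' x)"
  proof (cases b; cases b')
    assume "b" "b'"
    then have "(\<lambda>x. trig m x * trig m' x) = (\<lambda>x. 1/2 * trig (j - k, True) x + 1/2 * trig (j + k, True) x)"
      by (auto simp: m trig_def cosk_def phase_diff phase_add cos_times_cos add_divide_distrib)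
    then show ?thesis by blast
  next
    assume "b" "\<not> b'"
    then have "(\<lambda>x. trig m x * trig m' x) = (\<lambda>x. 1/2 * trig (j + k, False) x + (-1/2) * trig (j - k, False) x)"
      by (auto simp: m trig_def cosk_def sink_def phase_diff phase_add cos_times_sin diff_divide_distrib)
    then show ?thesis by blast
  next
    assume "\<not> b" "b'"
    then have "(\<lambda>x. trig m x * trig m' x) = (\<lambda>x. 1/2 * trig (j + k, False) x + 1/2 * trig (j - k, False) x)"
      by (auto simp: m trig_def cosk_def sink_def phase_diff phase_add sin_times_cos add_divide_distrib)
    then show ?thesis by blast
  next
    assume "\<not> b" "\<not> b'"
    then have "(\<lambda>x. trig m x * trig m' x) = (\<lambda>x. 1/2 * trig (j - k, True) x + (-1/2) * trig (j + k, True) x)"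
      by (auto simp: m trig_def cosk_def sink_def phase_diff phase_add sin_times_sin diff_divide_distrib)
    then show ?thesis by blast
  qed
  then show ?thesis using T by auto
qed

lemma trigpoly_mult:
  assumes "f \<in> trigpoly" "g \<in> trigpoly" shows "(\<lambda>x. f x * g x) \<in> trigpoly"
  using assms(1)
proof induction
  case (trig m)
  show ?case using assms(2)
  proof induction
    case (add f g)
    then show ?case using trigpoly.add by (simp add: distrib_left)
  next
    case (scale f c)
    then show ?case using trigpoly.scale[of _ c] by (simp add: mult.left_commute)
  qed (rule trigpoly_trig_mult)
next
  case (add f h)
  then show ?case using trigpoly.add by (simp add: distrib_right)
next
  case (scale f c)
  then show ?case using trigpoly.scale[of _ c] by (simp add: mult.assoc)
qed

lemma trigpoly_prod:
  assumes "finite A" "\<And>a. a \<in> A \<Longrightarrow> f a \<in> trigpoly" shows "(\<lambda>x. \<Prod>a\<in>A. f a x) \<in> trigpoly"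
  using assms by (induction A) (auto intro: trigpoly_mult trigpoly_const)

lemma trigpoly_compose:
  assumes "real_polynomial_function p" "f \<in> trigpoly" shows "(\<lambda>x. p (f x)) \<in> trigpoly"
  using assms(1)
proof induction
  case (linear p)
  have "p y = p 1 * y" for y
    using linear_scale[OF bounded_linear.linear[OF linear], of y 1] by simp
  then have "(\<lambda>x. p (f x)) = (\<lambda>x. p 1 * f x)" by blast
  then show ?case
    using trigpoly.scale[OF assms(2), of "p 1"] by (simp only:)
qed (auto intro: trigpoly_const trigpoly.add trigpoly_mult)

lemma trigpoly_axis: "(\<lambda>x :: real^'n::finite. cos (2 * pi * x $ i - \<theta>) - c) \<in> trigpoly"
proof -
  have ph: "phase (axis i 1) x = 2 * pi * x $ i" for x :: "real^'n"
  proof -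
    have "(\<Sum>j\<in>UNIV. of_int ((axis i 1 :: int^'n) $ j) * x $ j) = (\<Sum>j\<in>UNIV. if j = i then x $ j else 0)"
      by (rule sum.cong) (auto simp: axis_def)
    then show ?thesis by (simp add: phase_def)
  qed
  have "(\<lambda>x :: real^'n. (cos \<theta> * trig (axis i 1, True) x + sin \<theta> * trig (axis i 1, False) x) + (- c)) \<in> trigpoly"
    by (intro trigpoly.intros trigpoly_const)
  then show ?thesis
    by (simp add: trig_def cosk_def sink_def ph cos_diff mult.commute)
qed

lemma trigpoly_continuous: "f \<in> trigpoly \<Longrightarrow> continuous_on UNIV f \<and> periodic f"
  by (induction rule: trigpoly.induct)
    (auto intro!: continuous_intros simp: periodic_trig, auto simp: periodic_def)

lemma trigpoly_orthogonal:
  assumes "f \<in> trigpoly" "g \<in> L2p" "\<And>m. coef g m = 0"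
  shows "(LINT x|lebesgue_on cell. g x * f x) = 0"
proof -
  have "ip f g = 0"
    using assms(1)
  proof induction
    case (trig m)
    then show ?case using assms(3)[of m] by (simp add: coef_def ip_commute)
  next
    case (add f h)
    then show ?case
      using trigpoly_continuous L2p_continuous assms(2) by (subst ip_add_left) auto
  qed (simp add: ip_scale_left)
  then show ?thesis by (simp add: ip_def mult.commute)
qed

text \<open>
  Positivity of a shifted cosine cuts out a subinterval of the unit interval. Products of
  polynomial approximations of the step function, evaluated at such cosines, are trigonometric
  polynomials that converge boundedly to the indicator of a box.
\<close>

lemma cos_window:
  fixes a b x :: real
  assumes "0 \<le> a" "a < b" "b \<le> 1" "0 < x" "x < 1"
  shows "cos (2 * pi * x - pi * (a + b)) - cos (pi * (b - a)) > 0 \<longleftrightarrow> a < x \<and> x < b"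
proof -
  define t where "t = \<bar>2 * pi * x - pi * (a + b)\<bar>"
  define s where "s = pi * (b - a)"
  have ct: "cos (2 * pi * x - pi * (a + b)) = cos t"
    by (simp add: t_def)
  have s: "0 \<le> s" "s \<le> pi"
    using assms by (auto simp: s_def mult_le_cancel_left1)
  have ts: "t < s \<longleftrightarrow> a < x \<and> x < b"
  proof -
    have "2 * pi * x - pi * (a + b) = pi * (2 * x - (a + b))"
      by (simp add: algebra_simps)
    then have "t = pi * \<bar>2 * x - (a + b)\<bar>"
      by (simp only: t_def abs_mult) simp
    then have "t < s \<longleftrightarrow> \<bar>2 * x - (a + b)\<bar> < b - a"
      by (simp add: s_def)
    then show ?thesis by (auto simp: abs_if)
  qed
  show ?thesis
  proof (cases "t \<le> pi")
    case True
    have "cos s < cos t \<longleftrightarrow> t < s"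
      by (rule cos_mono_less_eq) (use s True in \<open>auto simp: t_def\<close>)
    then show ?thesis using ts ct by (simp add: s_def)
  next
    case False
    \<comment> \<open>Beyond \<open>pi\<close> the cosine rises again. Since \<open>x\<close> and
      the window lie in the unit interval, the reflected angle \<open>2 * pi - t\<close> still
      exceeds the half-width \<open>s\<close>, so no second window appears.\<close>
    have "s \<le> 2 * pi - t"
    proof -
      have 1: "s + (2 * pi * x - pi * (a + b)) \<le> 2 * pi"
      proof -
        have "s + (2 * pi * x - pi * (a + b)) = 2 * pi * (x - a)"
          by (simp add: s_def algebra_simps)
        then show ?thesis using assms by simp
      qed
      have 2: "s + - (2 * pi * x - pi * (a + b)) \<le> 2 * pi"
      proof -
        have "s + - (2 * pi * x - pi * (a + b)) = 2 * pi * (b - x)"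
          by (simp add: s_def algebra_simps)
        then show ?thesis using assms by simp
      qed
      show ?thesis using 1 2 by (auto simp: t_def abs_if)
    qed
    then have "cos (2 * pi - t) \<le> cos s"
      by (intro cos_monotone_0_pi_le) (use False s in auto)
    then have "\<not> cos s < cos t" by simp
    moreover have "\<not> t < s" using False s by auto
    ultimately show ?thesis using ts ct by (simp add: s_def)
  qed
qed

text \<open>Clamped lines of slope \<open>m\<close> tend to the step function, and polynomials
  approximate them uniformly within \<open>1 / (m + 1)\<close>. The interval \<open>[-2, 2]\<close>
  holds every difference of two cosines; the bound 2 is the height 1 of the clamp plus an error of
  at most 1.\<close>

lemma window_approx:
  obtains q :: "nat \<Rightarrow> real \<Rightarrow> real" where
    "\<And>m. real_polynomial_function (q m)"
    "\<And>m y. \<bar>y\<bar> \<le> 2 \<Longrightarrow> \<bar>q m y\<bar> \<le> 2"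
    "\<And>y :: real. \<bar>y\<bar> \<le> 2 \<Longrightarrow> (\<lambda>m. q m y) \<longlonglongrightarrow> (if y > 0 then 1 else 0)"
proof -
  define cl where "cl m y = max 0 (min 1 (real m * y))" for m y
  have "\<exists>p. real_polynomial_function p \<and> (\<forall>y\<in>{-2..2}. \<bar>cl m y - p y\<bar> < 1 / real (Suc m))" for m
  proof (rule Stone_Weierstrass_real_polynomial_function[of "{-2..2::real}" "cl m" "1 / real (Suc m)"])
    show "continuous_on {-2..2} (cl m)"
      unfolding cl_def by (intro continuous_intros)
  qed auto
  then obtain q where q: "\<And>m. real_polynomial_function (q m)"
    "\<And>m y. \<bar>y\<bar> \<le> 2 \<Longrightarrow> \<bar>cl m y - q m y\<bar> < 1 / real (Suc m)"
    by (metis abs_le_iff atLeastAtMost_iff minus_le_iff)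
  have bd: "\<bar>q m y\<bar> \<le> 2" if "\<bar>y\<bar> \<le> 2" for m y
  proof -
    have "0 \<le> cl m y" "cl m y \<le> 1" by (auto simp: cl_def)
    moreover have "1 / real (Suc m) \<le> 1" by simp
    ultimately show ?thesis using q(2)[OF that, of m] by linarith
  qed
  have "(\<lambda>m. q m y) \<longlonglongrightarrow> (if y > 0 then 1 else 0)" if "\<bar>y\<bar> \<le> 2" for y
  proof -
    have "eventually (\<lambda>m. cl m y = (if y > 0 then 1 else 0)) sequentially"
    proof (cases "y > 0")
      case True
      obtain m0 where m0: "1 / y < real m0" using reals_Archimedean2 by blast
      have "cl m y = 1" if "m \<ge> m0" for m
      proof -
        have "1 / y \<le> real m" using m0 that by linarith
        then have "1 \<le> real m * y" using True by (simp add: divide_le_eq)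
        then show ?thesis by (simp add: cl_def)
      qed
      then show ?thesis using True by (auto simp: eventually_sequentially)
    next
      case False
      then have "cl m y = 0" for m
        using mult_nonneg_nonpos[of "real m" y] by (auto simp: cl_def)
      then show ?thesis using False by simp
    qed
    then have 1: "(\<lambda>m. cl m y) \<longlonglongrightarrow> (if y > 0 then 1 else 0)"
      by (rule tendsto_eventually)
    have "(\<lambda>m. cl m y - q m y) \<longlonglongrightarrow> 0"
      by (rule Lim_null_comparison[OF _ LIMSEQ_inverse_real_of_nat])
        (use q(2)[OF that] in \<open>auto intro!: always_eventually less_imp_le simp: inverse_eq_divide\<close>)
    from tendsto_diff[OF 1 this] show ?thesis by simp
  qed
  then show ?thesis using q(1) bd that by blast
qed

lemma orthogonal_box_integral:
  fixes g :: "'n::finite func"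
  assumes g: "g \<in> L2p" and orth: "\<And>m. coef g m = 0" and ab: "\<And>i. 0 \<le> a $ i" "\<And>i. a $ i < b $ i" "\<And>i. b $ i \<le> 1"
  shows "(LINT x|lebesgue_on cell. g x * indicator (box a b) x) = 0"
proof -
  obtain q :: "nat \<Rightarrow> real \<Rightarrow> real" where q: "\<And>m. real_polynomial_function (q m)"
    "\<And>m y. \<bar>y\<bar> \<le> 2 \<Longrightarrow> \<bar>q m y\<bar> \<le> 2"
    "\<And>y. \<bar>y\<bar> \<le> 2 \<Longrightarrow> (\<lambda>m. q m y) \<longlonglongrightarrow> (if y > 0 then 1 else 0)"
    using window_approx by blast
  define Y where "Y i x = cos (2 * pi * x $ i - pi * (a $ i + b $ i)) - cos (pi * (b $ i - a $ i))" for i and x :: "real^'n"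
  have Y2: "\<bar>Y i x\<bar> \<le> 2" for i x
    unfolding Y_def
    by (rule order_trans[OF abs_triangle_ineq4 order_trans[OF add_mono[OF abs_cos_le_one abs_cos_le_one]]]) simp
  define P where "P m x = (\<Prod>i\<in>UNIV. q m (Y i x))" for m x
  have P: "P m \<in> trigpoly" for m
    unfolding P_def Y_def by (rule trigpoly_prod) (rule finite, rule trigpoly_compose[OF q(1) trigpoly_axis])
  have Pint: "(LINT x|lebesgue_on cell. g x * P m x) = 0" for m
    by (rule trigpoly_orthogonal[OF P g orth])
  have lim: "(\<lambda>m. P m x) \<longlonglongrightarrow> indicator (box a b) x" if x: "x \<in> cell" for x
  proof -
    have "(\<lambda>m. P m x) \<longlonglongrightarrow> (\<Prod>i\<in>UNIV. if Y i x > 0 then 1 else 0)"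
      unfolding P_def by (intro tendsto_prod q(3) Y2)
    moreover have "Y i x > 0 \<longleftrightarrow> a $ i < x $ i \<and> x $ i < b $ i" for i
      unfolding Y_def using cos_window[of "a $ i" "b $ i" "x $ i"] ab x by (simp add: cell_iff)
    moreover have "(\<Prod>i\<in>UNIV. if a $ i < x $ i \<and> x $ i < b $ i then 1 else 0) = (indicator (box a b) x :: real)"
    proof (cases "x \<in> box a b")
      case False
      then obtain i where "\<not> (a $ i < x $ i \<and> x $ i < b $ i)" by (auto simp: mem_box_cart)
      then have "(\<Prod>i\<in>UNIV. if a $ i < x $ i \<and> x $ i < b $ i then 1 else 0) = (0::real)"
        by (intro prod_zero) auto
      then show ?thesis using False by simp
    qed (auto simp: mem_box_cart)
    ultimately show ?thesis by simp
  qed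
  have gi: "integrable (lebesgue_on cell) g"
    using L2p_mult_integrable[OF g L2p_const[of 1]] by simp
  have gm: "g \<in> borel_measurable (lebesgue_on cell)"
    using L2p_D(4)[OF g] .
  have "(\<lambda>m. LINT x|lebesgue_on cell. g x * P m x) \<longlonglongrightarrow> (LINT x|lebesgue_on cell. g x * indicator (box a b) x)"
  \<comment> \<open>The dominating function comes from \<open>CARD('n)\<close> factors, each at most
    2 in modulus.\<close>
  proof (rule integral_dominated_convergence[where w = "\<lambda>x. 2 ^ CARD('n) * \<bar>g x\<bar>"])
    show "(\<lambda>x. g x * P m x) \<in> borel_measurable (lebesgue_on cell)" for m
      using gm L2p_D(4)[OF L2p_continuous[of "P m"]] trigpoly_continuous[OF P[of m]]
      by (intro borel_measurable_times) auto
    have "box a b \<in> sets lebesgue" by simp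
    then have "indicator (box a b) \<in> borel_measurable lebesgue"
      by (rule borel_measurable_indicator)
    then show "(\<lambda>x. g x * indicator (box a b) x) \<in> borel_measurable (lebesgue_on cell)"
      by (intro borel_measurable_times gm measurable_restrict_space1)
    show "integrable (lebesgue_on cell) (\<lambda>x. 2 ^ CARD('n) * \<bar>g x\<bar>)"
      using gi by (intro integrable_mult_right integrable_abs)
    show "AE x in lebesgue_on cell. (\<lambda>m. g x * P m x) \<longlonglongrightarrow> g x * indicator (box a b) x"
      by (rule AE_I2) (auto intro!: tendsto_mult_left lim)
    have "\<bar>P m x\<bar> \<le> 2 ^ CARD('n)" for m x
    proof -
      have "(\<Prod>i\<in>UNIV. \<bar>q m (Y i x)\<bar>) \<le> (\<Prod>i\<in>(UNIV :: 'n set). 2)"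
        by (intro prod_mono) (auto intro: q(2) Y2)
      then show ?thesis by (simp add: P_def abs_prod)
    qed
    then have "norm (g x * P m x) \<le> 2 ^ CARD('n) * \<bar>g x\<bar>" for m x
      using mult_left_mono[of "\<bar>P m x\<bar>" "2 ^ CARD('n)" "\<bar>g x\<bar>"] by (simp add: abs_mult mult.commute)
    then show "AE x in lebesgue_on cell. norm (g x * P m x) \<le> 2 ^ CARD('n) * \<bar>g x\<bar>" for m
      by simp
  qed
  then show ?thesis
    unfolding Pint using LIMSEQ_unique tendsto_const by metis
qed

lemma Int_stable_box: "Int_stable (range (\<lambda>(a, b). box a b :: ('a::euclidean_space) set))"
  by (auto simp: Int_stable_def box_Int_box)

text \<open>Boxes generate the Borel sets and are stable under intersection, so the vanishing of the
  integrals spreads to all Borel sets by a Dynkin argument. The whole space is not a box; its own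
  hypothesis serves the complement step.\<close>

lemma AE_zero_if_boxes:
  fixes g :: "real^'n::finite \<Rightarrow> real"
  assumes g: "integrable lborel g" and box: "\<And>a b. (LINT x|lborel. indicator (box a b) x * g x) = 0"
    and all: "(LINT x|lborel. g x) = 0"
  shows "AE x in lborel. g x = 0"
proof (rule density_unique_real)
  show "integrable lborel g" by fact
  fix A :: "(real^'n) set" assume "A \<in> sets lborel"
  then have A: "A \<in> sigma_sets UNIV (range (\<lambda>(a, b). box a b))"
    by (simp add: borel_eq_box)
  have "range (\<lambda>(a, b). box a b :: (real^'n) set) \<subseteq> Pow UNIV" by simp
  from Int_stable_box[where 'a = "real^'n"] this A
  show "(LINT x:A|lborel. g x) = (LINT x:A|lborel. 0)"
  proof (induction rule: sigma_sets_induct_disjoint)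
    case (basic A)
    then show ?case by (auto simp: set_lebesgue_integral_def box)
  next
    case (compl A)
    have A: "A \<in> sets lborel" using compl by (simp add: borel_eq_box)
    have "(LINT x:UNIV - A|lborel. g x) = (LINT x|lborel. g x - indicator A x *\<^sub>R g x)"
      unfolding set_lebesgue_integral_def
      by (rule Bochner_Integration.integral_cong) (auto simp: indicator_def)
    also have "\<dots> = (LINT x|lborel. g x) - (LINT x:A|lborel. g x)"
      unfolding set_lebesgue_integral_def
      by (intro Bochner_Integration.integral_diff g integrable_mult_indicator A)
    finally show ?case using compl all by (simp add: set_lebesgue_integral_def)
  next
    case (union A)
    have "(LINT x:(\<Union>i. A i)|lborel. g x) = (\<Sum>i. (LINT x:(A i)|lborel. g x))"
    proof (rule lebesgue_integral_countable_add)
      show "A i \<in> sets lborel" for i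
        using union(2) by (auto simp: borel_eq_box subset_eq)
      then have "(\<Union>i. A i) \<in> sets lborel" by (intro sets.countable_UN) auto
      then show "set_integrable lborel (\<Union>i. A i) g"
        unfolding set_integrable_def by (intro integrable_mult_indicator g)
      show "i \<noteq> j \<Longrightarrow> A i \<inter> A j = {}" for i j
        using union(1) by (auto simp: disjoint_family_on_def)
    qed
    then show ?case using union by (simp add: set_lebesgue_integral_def)
  qed (simp_all add: set_lebesgue_integral_def)
qed simp

text \<open>The Dynkin argument runs on Borel sets, while \<open>g\<close> is Lebesgue measurable
  and matters only on the cell. Hence \<open>g\<close> is cut off to zero outside the cell and then
  replaced by a Borel function equal to it almost everywhere.\<close>

theorem trig_complete:
  fixes g :: "'n::finite func"
  assumes g: "g \<in> L2p" and orth: "\<And>m. coef g m = 0"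
  shows "AE x in lebesgue_on cell. g x = 0"
proof -
  have cell_sets: "cell \<in> sets (lebesgue :: (real^'n) measure)" by (simp add: fmeasurableD)
  have gi: "integrable (lebesgue_on cell) g"
    using L2p_mult_integrable[OF g L2p_const[of 1]] by simp
  define h where "h x = indicator cell x * g x" for x
  have hi: "integrable lebesgue h"
    using gi by (subst (asm) integrable_restrict_space) (auto simp: cell_sets h_def[abs_def])
  have hint: "(LINT x|lebesgue. h x * f x) = (LINT x|lebesgue_on cell. g x * f x)" for f
    by (subst integral_restrict_space) (auto simp: cell_sets h_def mult.assoc)
  obtain h' where h': "h' \<in> borel_measurable lborel" "AE x in lborel. h x = h' x"
    using completion_ex_borel_measurable_real[of h lborel] hi by auto
  have hh': "AE x in lebesgue. h x = h' x"
    using h'(2) by (rule AE_completion)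
  have h'm: "h' \<in> borel_measurable lebesgue"
    using h'(1) by (rule measurable_completion)
  have h'leb: "integrable lebesgue h'"
    using hi hh' h'm by (subst integrable_cong_AE[where g = h]) auto
  have h'i: "integrable lborel h'"
    using h'leb h'(1) integrable_completion by blast
  have int_h': "(LINT x|lborel. f x * h' x) = (LINT x|lebesgue_on cell. g x * f x)"
    if f: "f \<in> borel_measurable lborel" for f
  proof -
    have "(LINT x|lborel. f x * h' x) = (LINT x|lebesgue. f x * h' x)"
      by (subst integral_completion) (use f h' in auto)
    also have "\<dots> = (LINT x|lebesgue. h x * f x)"
      using measurable_completion[OF f] h'm hi hh' by (intro integral_cong_AE) auto
    finally show ?thesis unfolding hint .
  qed
  have "AE x in lborel. h' x = 0"
  proof (rule AE_zero_if_boxes[OF h'i])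
    show "(LINT x|lborel. h' x) = 0"
    proof -
      have "(LINT x|lborel. 1 * h' x) = (LINT x|lebesgue_on cell. g x * 1)"
        by (rule int_h') simp
      also have "\<dots> = ip g (trig (0, True))"
        by (simp add: ip_def trig_def)
      finally show ?thesis using orth by (simp add: coef_def)
    qed
    fix a b :: "real^'n"
    \<comment> \<open>Only the part of the box inside the cell matters. Clipping either brings the
      box into the range of \<open>orthogonal_box_integral\<close> or makes it empty.\<close>
    define a' b' where "a' = (\<chi> i. max 0 (a $ i))" and "b' = (\<chi> i. min 1 (b $ i))"
    have eq: "x \<in> box a b \<longleftrightarrow> x \<in> box a' b'" if "x \<in> cell" for x
      using that by (auto simp: mem_box_cart a'_def b'_def cell_iff)
    have "(LINT x|lborel. indicator (box a b) x * h' x) = (LINT x|lebesgue_on cell. g x * indicator (box a b) x)"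
      by (rule int_h') simp
    also have "\<dots> = (LINT x|lebesgue_on cell. g x * indicator (box a' b') x)"
      by (rule Bochner_Integration.integral_cong) (auto simp: eq indicator_def)
    also have "\<dots> = 0"
    proof (cases "\<forall>i. a' $ i < b' $ i")
      case True
      then show ?thesis
        by (intro orthogonal_box_integral[OF g orth]) (auto simp: a'_def b'_def)
    next
      case False
      then obtain i where "\<not> a' $ i < b' $ i" by blast
      then have "box a' b' = {}"
        by (auto simp: set_eq_iff mem_box_cart intro: less_trans)
      then show ?thesis by simp
    qed
    finally show "(LINT x|lborel. indicator (box a b) x * h' x) = 0" .
  qed
  then have "AE x in lebesgue. h' x = 0" by (rule AE_completion)
  with hh' have "AE x in lebesgue. h x = 0" by auto
  then have "AE x in lebesgue. x \<in> cell \<longrightarrow> g x = 0"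
    by (auto simp: h_def)
  then show ?thesis
    by (subst AE_restrict_space_iff) (auto simp: cell_sets)
qed

section \<open>Completeness of the space and Parseval's identity\<close>

text \<open>Young's inequality \<open>2 * \<bar>u\<bar> \<le> t * u\<^sup>2 + 1 / t\<close> on a
  cell of measure one. With \<open>t = 2 ^ j\<close> it turns fast convergence in the mean into a
  summable series of integrals.\<close>

lemma L2p_L1_bound:
  assumes u: "u \<in> L2p" and t: "t > 0" and le: "ip u u \<le> 1 / t\<^sup>2"
  shows "(\<integral>\<^sup>+x. ennreal \<bar>u x\<bar> \<partial>lebesgue_on cell) \<le> ennreal (1 / t)"
proof -
  have i: "integrable (lebesgue_on cell) (\<lambda>x. (t * (u x)\<^sup>2 + 1 / t) / 2)"
    using L2p_D(3)[OF u] by auto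
  have "(\<integral>\<^sup>+x. ennreal \<bar>u x\<bar> \<partial>lebesgue_on cell) \<le> (\<integral>\<^sup>+x. ennreal ((t * (u x)\<^sup>2 + 1 / t) / 2) \<partial>lebesgue_on cell)"
  proof (intro nn_integral_mono ennreal_leI)
    fix x
    have "0 \<le> (t * \<bar>u x\<bar> - 1)\<^sup>2 / t" using t by simp
    also have "\<dots> = t * (u x)\<^sup>2 + 1 / t - 2 * \<bar>u x\<bar>"
      using t by (simp add: power2_diff field_simps power2_eq_square)
    finally show "\<bar>u x\<bar> \<le> (t * (u x)\<^sup>2 + 1 / t) / 2" by simp
  qed
  also have "\<dots> = ennreal (LINT x|lebesgue_on cell. (t * (u x)\<^sup>2 + 1 / t) / 2)"
    using t by (intro nn_integral_eq_integral i) auto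
  also have "(LINT x|lebesgue_on cell. (t * (u x)\<^sup>2 + 1 / t) / 2) = (t * ip u u + 1 / t) / 2"
    using L2p_D(3)[OF u] by (simp add: ip_def power2_eq_square)
  also have "\<dots> \<le> 1 / t"
  proof -
    have "t * ip u u \<le> t * (1 / t\<^sup>2)" using le t by (intro mult_left_mono) auto
    also have "\<dots> = 1 / t" by (simp add: power2_eq_square)
    finally show ?thesis by simp
  qed
  finally show ?thesis by (simp add: ennreal_leI)
qed

text \<open>Along a fast subsequence the telescoping series converges absolutely almost everywhere;
  Fatou's lemma then upgrades the pointwise limit to a limit in the mean of the whole
  sequence.\<close>

lemma L2p_complete:
  fixes f :: "nat \<Rightarrow> 'n::finite func"
  assumes f: "\<And>n. f n \<in> L2p"
    and Cauchy: "\<And>e. e > 0 \<Longrightarrow> \<exists>N. \<forall>m\<ge>N. \<forall>n\<ge>N. ip (\<lambda>x. f m x - f n x) (\<lambda>x. f m x - f n x) \<le> e"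
  obtains u where "u \<in> L2p" "(\<lambda>n. ip (\<lambda>x. u x - f n x) (\<lambda>x. u x - f n x)) \<longlonglongrightarrow> 0"
proof -
  have "\<exists>N. \<forall>m\<ge>N. \<forall>n\<ge>N. ip (\<lambda>x. f m x - f n x) (\<lambda>x. f m x - f n x) \<le> 1 / (2 ^ j)\<^sup>2" for j :: nat
    by (rule Cauchy) simp
  then obtain M where M: "\<And>j m n. m \<ge> M j \<Longrightarrow> n \<ge> M j \<Longrightarrow> ip (\<lambda>x. f m x - f n x) (\<lambda>x. f m x - f n x) \<le> 1 / (2 ^ j)\<^sup>2"
    by metis
  define r where "r j = (\<Sum>i\<le>j. M i) + j" for j
  have rM: "M j \<le> r j" "r j \<le> r (Suc j)" "j \<le> r j" for j
    unfolding r_def by (auto intro: member_le_sum trans_le_add1)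
  have r_mono: "i \<le> j \<Longrightarrow> r i \<le> r j" for i j
    using rM(2) lift_Suc_mono_le by blast
  define D where "D j x = f (r (Suc j)) x - f (r j) x" for j x
  have D: "D j \<in> L2p" for j unfolding D_def by (intro L2p_diff f)
  have Dle: "(\<integral>\<^sup>+x. ennreal \<bar>D j x\<bar> \<partial>lebesgue_on cell) \<le> ennreal (1 / 2 ^ j)" for j
    by (rule L2p_L1_bound[OF D]) (use M[of j "r (Suc j)" "r j"] rM(1)[of j] rM(2)[of j] in \<open>auto simp: D_def[abs_def]\<close>)
  have meas: "(\<lambda>x. ennreal \<bar>D j x\<bar>) \<in> borel_measurable (lebesgue_on cell)" for j
    using L2p_D(4)[OF D[of j]] by simp
  have "(\<integral>\<^sup>+x. (\<Sum>j. ennreal \<bar>D j x\<bar>) \<partial>lebesgue_on cell) = (\<Sum>j. \<integral>\<^sup>+x. ennreal \<bar>D j x\<bar> \<partial>lebesgue_on cell)"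
    by (rule nn_integral_suminf[OF meas])
  also have "\<dots> \<le> (\<Sum>j. ennreal (1 / 2 ^ j))"
    by (intro suminf_le Dle) auto
  also have "\<dots> = ennreal (\<Sum>j. 1 / 2 ^ j)"
    by (rule suminf_ennreal2) (auto simp: power_one_over[symmetric])
  also have "\<dots> < \<infinity>" by simp
  finally have "AE x in lebesgue_on cell. (\<Sum>j. ennreal \<bar>D j x\<bar>) \<noteq> \<infinity>"
    using borel_measurable_suminf_order[OF meas] by (intro nn_integral_noteq_infinite) auto
  then have conv: "AE x in lebesgue_on cell. convergent (\<lambda>j. f (r j) x)"
  proof eventually_elim
    case (elim x)
    then have "summable (\<lambda>j. \<bar>D j x\<bar>)"
      by (intro summable_suminf_not_top) auto
    then have "summable (\<lambda>j. D j x)" by (rule summable_rabs_cancel)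
    then have "convergent (\<lambda>n. \<Sum>j<n. D j x)" by (simp add: summable_iff_convergent)
    then have "convergent (\<lambda>n. f (r n) x - f (r 0) x)"
      unfolding D_def sum_lessThan_telescope[of "\<lambda>n. f (r n) x"] .
    then have "convergent (\<lambda>n. (f (r n) x - f (r 0) x) + f (r 0) x)"
      by (intro convergent_add convergent_const)
    then show ?case by simp
  qed
  \<comment> \<open>Where the sequence diverges, \<open>lim\<close> still returns a value determined
    by the sequence. The sequences at \<open>x\<close> and at its translates by periods coincide, so
    \<open>u\<close> is periodic at every point, as \<open>L2p\<close> demands.\<close>
  define u where "u x = lim (\<lambda>j. f (r j) x)" for x
  have lim: "AE x in lebesgue_on cell. (\<lambda>j. f (r j) x) \<longlonglongrightarrow> u x"
    using conv by eventually_elim (simp add: u_def convergent_LIMSEQ_iff)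
  have um: "u \<in> borel_measurable lebesgue"
    unfolding u_def by (intro borel_measurable_lim_metric L2p_D(1) f)
  have um': "u \<in> borel_measurable (lebesgue_on cell)"
    by (intro measurable_restrict_space1 um)
  have up: "periodic u"
    using L2p_D(2)[OF f] by (simp add: u_def periodic_def)
  have fatou: "(\<integral>\<^sup>+x. ennreal ((u x - f n x)\<^sup>2) \<partial>lebesgue_on cell) \<le> ennreal e"
    if e: "\<And>m. m \<ge> N \<Longrightarrow> ip (\<lambda>x. f m x - f n x) (\<lambda>x. f m x - f n x) \<le> e" for n e N
  proof -
    have fn: "f n \<in> borel_measurable (lebesgue_on cell)" for n by (rule L2p_D(4)[OF f])
    have "(\<integral>\<^sup>+x. ennreal ((u x - f n x)\<^sup>2) \<partial>lebesgue_on cell) =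
      (\<integral>\<^sup>+x. liminf (\<lambda>j. ennreal ((f (r j) x - f n x)\<^sup>2)) \<partial>lebesgue_on cell)"
    proof (rule nn_integral_cong_AE)
      show "AE x in lebesgue_on cell. ennreal ((u x - f n x)\<^sup>2) = liminf (\<lambda>j. ennreal ((f (r j) x - f n x)\<^sup>2))"
        using lim
      proof eventually_elim
        case (elim x)
        then have "(\<lambda>j. ennreal ((f (r j) x - f n x)\<^sup>2)) \<longlonglongrightarrow> ennreal ((u x - f n x)\<^sup>2)"
          by (intro tendsto_ennrealI tendsto_intros)
        from lim_imp_Liminf[OF sequentially_bot this] show ?case by (rule sym)
      qed
    qed
    also have "\<dots> \<le> liminf (\<lambda>j. \<integral>\<^sup>+x. ennreal ((f (r j) x - f n x)\<^sup>2) \<partial>lebesgue_on cell)"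
      using fn by (intro nn_integral_liminf) auto
    also have "\<dots> \<le> ennreal e"
    proof -
      have "(\<integral>\<^sup>+x. ennreal ((f (r j) x - f n x)\<^sup>2) \<partial>lebesgue_on cell) \<le> ennreal e" if "j \<ge> N" for j
      proof -
        have "(\<integral>\<^sup>+x. ennreal ((f (r j) x - f n x)\<^sup>2) \<partial>lebesgue_on cell) =
          ennreal (LINT x|lebesgue_on cell. (f (r j) x - f n x)\<^sup>2)"
          by (intro nn_integral_eq_integral L2p_D(3) L2p_diff f) auto
        also have "\<dots> \<le> ennreal e"
          using e[of "r j"] that rM(3)[of j] by (intro ennreal_leI) (simp add: ip_def power2_eq_square)
        finally show ?thesis .
      qed
      then have "eventually (\<lambda>j. (\<integral>\<^sup>+x. ennreal ((f (r j) x - f n x)\<^sup>2) \<partial>lebesgue_on cell) \<le> ennreal e) sequentially"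
        by (auto simp: eventually_sequentially)
      then show ?thesis
        using Liminf_mono[of "\<lambda>j. \<integral>\<^sup>+x. ennreal ((f (r j) x - f n x)\<^sup>2) \<partial>lebesgue_on cell" "\<lambda>_. ennreal e" sequentially]
        by (simp add: Liminf_const)
    qed
    finally show ?thesis .
  qed
  have diff_int: "integrable (lebesgue_on cell) (\<lambda>x. (u x - f n x)\<^sup>2)"
    and diff_le: "e \<ge> 0 \<Longrightarrow> (\<And>m. m \<ge> N \<Longrightarrow> ip (\<lambda>x. f m x - f n x) (\<lambda>x. f m x - f n x) \<le> e) \<Longrightarrow>
      (LINT x|lebesgue_on cell. (u x - f n x)\<^sup>2) \<le> e"
    if ex: "n \<ge> M 0" for n e N
  proof -
    have fn: "f n \<in> borel_measurable (lebesgue_on cell)" for n by (rule L2p_D(4)[OF f])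
    have "(\<integral>\<^sup>+x. ennreal ((u x - f n x)\<^sup>2) \<partial>lebesgue_on cell) \<le> ennreal (1 / (2 ^ 0)\<^sup>2)"
      by (rule fatou[of "M 0"]) (rule M, use ex in auto)
    also have "\<dots> < \<infinity>" by simp
    finally show I: "integrable (lebesgue_on cell) (\<lambda>x. (u x - f n x)\<^sup>2)"
      using um' fn by (intro integrableI_bounded) auto
    assume e: "e \<ge> 0" "\<And>m. m \<ge> N \<Longrightarrow> ip (\<lambda>x. f m x - f n x) (\<lambda>x. f m x - f n x) \<le> e"
    have "ennreal (LINT x|lebesgue_on cell. (u x - f n x)\<^sup>2) \<le> ennreal e"
      using fatou[OF e(2)] nn_integral_eq_integral[OF I] by simp
    then show "(LINT x|lebesgue_on cell. (u x - f n x)\<^sup>2) \<le> e"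
      using e(1) by (simp add: ennreal_le_iff)
  qed
  have "(\<lambda>x. u x - f (M 0) x) \<in> L2p"
    using um up L2p_D(1,2)[OF f[of "M 0"]] diff_int[of "M 0"] by (auto simp: L2p_def periodic_def)
  from L2p_add[OF this f[of "M 0"]] have u: "u \<in> L2p" by simp
  have "(\<lambda>n. ip (\<lambda>x. u x - f n x) (\<lambda>x. u x - f n x)) \<longlonglongrightarrow> 0"
  proof (rule LIMSEQ_I)
    fix e :: real assume "e > 0"
    then obtain N where N: "\<And>m n. m \<ge> N \<Longrightarrow> n \<ge> N \<Longrightarrow> ip (\<lambda>x. f m x - f n x) (\<lambda>x. f m x - f n x) \<le> e / 2"
      using Cauchy[of "e / 2"] by auto
    have "norm (ip (\<lambda>x. u x - f n x) (\<lambda>x. u x - f n x) - 0) < e" if "n \<ge> max N (M 0)" for n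
    proof -
      have "ip (\<lambda>x. u x - f n x) (\<lambda>x. u x - f n x) \<le> e / 2"
        using diff_le[of n "e / 2" N] N that \<open>e > 0\<close> by (simp add: ip_def power2_eq_square)
      then show ?thesis using ip_nonneg[of "\<lambda>x. u x - f n x"] \<open>e > 0\<close> by simp
    qed
    then show "\<exists>no. \<forall>n\<ge>no. norm (ip (\<lambda>x. u x - f n x) (\<lambda>x. u x - f n x) - 0) < e" by blast
  qed
  then show ?thesis using that u by blast
qed

lemma Cauchy_Schwarz_ip:
  assumes u: "u \<in> L2p" and w: "w \<in> L2p"
  shows "(ip u w)\<^sup>2 \<le> ip u u * ip w w"
proof -
  have quad: "0 \<le> ip u u - 2 * (t * ip u w) + t\<^sup>2 * ip w w" for t
  proof -
    have "ip (\<lambda>x. t * w x) (\<lambda>x. t * w x) = t\<^sup>2 * ip w w"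
      by (simp add: ip_def power2_eq_square algebra_simps)
    moreover have "ip u (\<lambda>x. t * w x) = t * ip u w"
      using ip_scale_left[of t w u] ip_commute by metis
    ultimately show ?thesis
      using ip_diff_self[OF u L2p_scale[OF w, of t]] ip_nonneg[of "\<lambda>x. u x - t * w x"] by simp
  qed
  show ?thesis
  proof (cases "ip w w = 0")
    case True
    have "ip u w = 0"
    proof (rule ccontr)
      assume nz: "ip u w \<noteq> 0"
      have "ip u u - 2 * ((ip u u + 1) / (2 * ip u w) * ip u w) \<ge> 0"
        using quad[of "(ip u u + 1) / (2 * ip u w)"] True by simp
      then show False using nz by (simp add: field_simps)
    qed
    then show ?thesis using True by simp
  next
    case False
    then have pos: "ip w w > 0" using ip_nonneg[of w] by simp
    have "0 \<le> ip u u - 2 * (ip u w / ip w w * ip u w) + (ip u w / ip w w)\<^sup>2 * ip w w"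
      by (rule quad)
    also have "\<dots> = ip u u - (ip u w)\<^sup>2 / ip w w"
      using pos by (simp add: power2_eq_square field_simps)
    finally show ?thesis using pos by (simp add: field_simps)
  qed
qed

lemma ip_tendsto:
  assumes f: "\<And>n. f n \<in> L2p" and u: "u \<in> L2p" and w: "w \<in> L2p"
    and lim: "(\<lambda>n. ip (\<lambda>x. u x - f n x) (\<lambda>x. u x - f n x)) \<longlonglongrightarrow> 0"
  shows "(\<lambda>n. ip (f n) w) \<longlonglongrightarrow> ip u w"
proof -
  let ?e = "\<lambda>n. ip (\<lambda>x. u x - f n x) (\<lambda>x. u x - f n x)"
  have "(\<lambda>n. sqrt (?e n * ip w w)) \<longlonglongrightarrow> sqrt (0 * ip w w)"
    by (intro tendsto_real_sqrt tendsto_mult lim tendsto_const)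
  then have 0: "(\<lambda>n. sqrt (?e n * ip w w)) \<longlonglongrightarrow> 0" by simp
  have "norm (ip u w - ip (f n) w) \<le> sqrt (?e n * ip w w)" for n
  proof -
    have "(ip u w - ip (f n) w)\<^sup>2 \<le> ?e n * ip w w"
      using Cauchy_Schwarz_ip[OF L2p_diff[OF u f] w, of n] ip_diff_left[OF u f w, of n] by simp
    then show ?thesis by (simp add: real_le_rsqrt)
  qed
  then have "(\<lambda>n. ip u w - ip (f n) w) \<longlonglongrightarrow> 0"
    by (intro Lim_null_comparison[OF always_eventually 0] allI)
  then have "(\<lambda>n. ip u w - (ip u w - ip (f n) w)) \<longlonglongrightarrow> ip u w - 0"
    by (intro tendsto_diff tendsto_const)
  then show ?thesis by simp
qed

lemma sum_Modes_mono:
  assumes "M \<le> N" "\<And>m. 0 \<le> g m" shows "(\<Sum>m\<in>Modes M. g m) \<le> (\<Sum>m\<in>Modes N. g (m :: 'n::finite mode) :: real)"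
  using assms by (intro sum_mono2 Modes_mono) auto

text \<open>For a family with \<open>mode_symm\<close> the squared distance of two partial sums is
  the difference of the sums of squares, which increase and are bounded; so the partial sums form a
  Cauchy sequence.\<close>

theorem Riesz_Fischer:
  fixes d :: "'n::finite mode \<Rightarrow> real"
  assumes d: "mode_symm d" and bd: "\<And>N. (\<Sum>m\<in>Modes N. (d m)\<^sup>2) \<le> C"
  obtains u where "u \<in> L2p" "\<And>m. coef u m = d m"
    "(\<lambda>N. ip (\<lambda>x. u x - tsum N d x) (\<lambda>x. u x - tsum N d x)) \<longlonglongrightarrow> 0"
proof -
  define S where "S N = (\<Sum>m\<in>Modes N. (d m)\<^sup>2)" for N
  have inc: "incseq S"
    by (auto simp: S_def incseq_def intro: sum_Modes_mono)
  obtain L where "S \<longlonglongrightarrow> L"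
    by (rule incseq_convergent[OF inc, of C]) (use bd in \<open>auto simp: S_def\<close>)
  then have conv: "convergent S"
    by (rule convergentI)
  have diff: "ip (\<lambda>x. tsum m d x - tsum n d x) (\<lambda>x. tsum m d x - tsum n d x) = S m - S n" if "n \<le> m" for m n
  proof -
    have "ip (tsum m d) (tsum n d) = (\<Sum>k\<in>Modes m. if k \<in> Modes n then (d k)\<^sup>2 else 0)"
      by (subst ip_tsum) (auto simp: coef_tsum[OF d] power2_eq_square intro: sum.cong)
    also have "\<dots> = (\<Sum>k\<in>Modes m \<inter> Modes n. (d k)\<^sup>2)"
      by (rule sum.inter_restrict[symmetric]) simp
    also have "Modes m \<inter> Modes n = (Modes n :: 'n mode set)"
      using Modes_mono[OF that] by blast
    finally show ?thesis
      by (simp add: ip_diff_self ip_tsum_self[OF d] S_def)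
  qed
  have sym: "ip (\<lambda>x. f x - g x) (\<lambda>x. f x - g x) = ip (\<lambda>x. g x - f x) (\<lambda>x. g x - f x)" for f g :: "'n func"
    unfolding ip_def by (rule Bochner_Integration.integral_cong) (auto simp: algebra_simps)
  obtain u where u: "u \<in> L2p" "(\<lambda>N. ip (\<lambda>x. u x - tsum N d x) (\<lambda>x. u x - tsum N d x)) \<longlonglongrightarrow> 0"
  proof (rule L2p_complete[of "\<lambda>N. tsum N d"])
    fix e :: real assume "e > 0"
    then obtain N where N: "\<And>m n. m \<ge> N \<Longrightarrow> n \<ge> N \<Longrightarrow> \<bar>S m - S n\<bar> < e"
      using metric_CauchyD[OF convergent_Cauchy[OF conv], of e] unfolding dist_real_def by blast
    have "ip (\<lambda>x. tsum m d x - tsum n d x) (\<lambda>x. tsum m d x - tsum n d x) \<le> e" if "m \<ge> N" "n \<ge> N" for m n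
      using N[OF that] diff[of n m] diff[of m n] sym[of "tsum m d" "tsum n d"] by (cases "n \<le> m") auto
    then show "\<exists>N. \<forall>m\<ge>N. \<forall>n\<ge>N. ip (\<lambda>x. tsum m d x - tsum n d x) (\<lambda>x. tsum m d x - tsum n d x) \<le> e"
      by blast
  qed auto
  have "coef u m = d m" for m
  proof -
    obtain N0 where N0: "\<And>N. N \<ge> N0 \<Longrightarrow> m \<in> Modes N" using mode_in_Modes[of m] by blast
    have "(\<lambda>N. coef (tsum N d) m) \<longlonglongrightarrow> coef u m"
      unfolding coef_def by (rule ip_tendsto[OF L2p_tsum u(1) L2p_trig u(2)])
    moreover have "eventually (\<lambda>N. coef (tsum N d) m = d m) sequentially"
      using N0 by (auto simp: coef_tsum[OF d] eventually_sequentially)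
    then have "(\<lambda>N. coef (tsum N d) m) \<longlonglongrightarrow> d m"
      by (rule tendsto_eventually)
    ultimately show ?thesis by (rule LIMSEQ_unique)
  qed
  then show ?thesis using that u by blast
qed

lemma AE_eq_if_coef_eq:
  assumes "u \<in> L2p" "w \<in> L2p" "\<And>m. coef u m = coef w m"
  shows "AE x in lebesgue_on cell. u x = w x"
proof -
  have "AE x in lebesgue_on cell. u x - w x = 0"
    by (rule trig_complete) (use assms in \<open>auto simp: coef_def ip_diff_left intro: L2p_diff\<close>)
  then show ?thesis by simp
qed

lemma ip_cong_AE2:
  assumes "AE x in lebesgue_on cell. u x = u' x" "u \<in> L2p" "u' \<in> L2p"
  shows "ip u u = ip u' u'"
  using ip_cong_AE[OF assms assms(2)] ip_cong_AE[OF assms assms(3)] ip_commute by metis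

text \<open>By Bessel's inequality the Fourier sums have some limit, which has the coefficients of
  \<open>u\<close>; completeness of the system identifies the two.\<close>

lemma tsum_tendsto:
  assumes u: "u \<in> L2p"
  shows "(\<lambda>N. ip (\<lambda>x. u x - tsum N (coef u) x) (\<lambda>x. u x - tsum N (coef u) x)) \<longlonglongrightarrow> 0"
proof -
  obtain h where h: "h \<in> L2p" "\<And>m. coef h m = coef u m"
    "(\<lambda>N. ip (\<lambda>x. h x - tsum N (coef u) x) (\<lambda>x. h x - tsum N (coef u) x)) \<longlonglongrightarrow> 0"
    using Riesz_Fischer[OF mode_symm_coef Bessel[OF u]] by blast
  have "AE x in lebesgue_on cell. h x = u x"
    by (rule AE_eq_if_coef_eq) (use h u in auto)
  then have "AE x in lebesgue_on cell. h x - tsum N (coef u) x = u x - tsum N (coef u) x" for N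
    by eventually_elim simp
  from ip_cong_AE2[OF this] h(1,3) u show ?thesis
    by (simp add: L2p_diff)
qed

theorem Parseval:
  assumes "u \<in> L2p"
  shows "(\<lambda>N. \<Sum>m\<in>Modes N. (coef u m)\<^sup>2) \<longlonglongrightarrow> ip u u"
proof -
  have "(\<lambda>N. ip u u - (ip u u - (\<Sum>m\<in>Modes N. (coef u m)\<^sup>2))) \<longlonglongrightarrow> ip u u - 0"
    using tsum_tendsto[OF assms] unfolding ip_diff_tsum_coef[OF assms] by (intro tendsto_diff tendsto_const)
  then show ?thesis by simp
qed

lemma Parseval_ip:
  assumes "u \<in> L2p" "w \<in> L2p"
  shows "(\<lambda>N. \<Sum>m\<in>Modes N. coef u m * coef w m) \<longlonglongrightarrow> ip u w"
  using ip_tendsto[OF L2p_tsum assms tsum_tendsto[OF assms(1)]] by (simp add: ip_tsum assms)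

section \<open>Weak derivatives\<close>

lemma smooth_differentiable: "\<psi> \<in> smooth_periodic \<Longrightarrow> \<psi> differentiable (at x)"
  unfolding smooth_periodic_def using spec[of "\<lambda>js. \<forall>x. pderivs js \<psi> differentiable (at x)" "[]"]
  by (auto simp: pderivs_def)

lemma smooth_continuous: "\<psi> \<in> smooth_periodic \<Longrightarrow> continuous_on UNIV \<psi>"
  by (intro continuous_at_imp_continuous_on ballI differentiable_imp_continuous_within smooth_differentiable)

lemma smooth_L2p: "\<psi> \<in> smooth_periodic \<Longrightarrow> \<psi> \<in> L2p"
  by (intro L2p_continuous smooth_continuous) (auto simp: smooth_periodic_def)

lemma smooth_pderiv_dir:
  assumes "\<psi> \<in> smooth_periodic" shows "pderiv_dir i \<psi> \<in> smooth_periodic"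
proof -
  have "pderivs js (pderiv_dir i \<psi>) = pderivs (js @ [i]) \<psi>" for js
    by (simp add: pderivs_def)
  moreover have "periodic (pderiv_dir i \<psi>)"
    using assms unfolding smooth_periodic_def periodic_def pderiv_dir_def
    by (simp add: add.assoc add.commute[of "axis _ _"]) (simp add: add.assoc[symmetric])
  ultimately show ?thesis using assms by (simp add: smooth_periodic_def)
qed

lemma smooth_pderivs: "\<psi> \<in> smooth_periodic \<Longrightarrow> pderivs js \<psi> \<in> smooth_periodic"
  by (induction js) (auto simp: pderivs_def intro: smooth_pderiv_dir)

lemma pderiv_dir_has_derivative:
  assumes "\<psi> \<in> smooth_periodic"
  shows "((\<lambda>s. \<psi> (x + s *\<^sub>R axis i 1)) has_real_derivative pderiv_dir i \<psi> x) (at 0)"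
proof -
  have "(\<lambda>s. \<psi> (x + s *\<^sub>R axis i 1)) differentiable (at 0)"
    using differentiable_chain_at[of "\<lambda>s. x + s *\<^sub>R axis i 1" 0 \<psi>] smooth_differentiable[OF assms, of x]
    by (auto simp: o_def intro!: derivative_intros)
  then show ?thesis
    unfolding pderiv_dir_def using DERIV_deriv_iff_real_differentiable by blast
qed

lemma integration_by_parts:
  assumes "\<psi> \<in> smooth_periodic" "\<theta> \<in> smooth_periodic"
  shows "ip \<psi> (pderiv_dir i \<theta>) = - ip (pderiv_dir i \<psi>) \<theta>"
proof -
  note c = smooth_continuous[OF assms(1)] smooth_continuous[OF assms(2)]
    smooth_continuous[OF smooth_pderiv_dir[OF assms(1)]] smooth_continuous[OF smooth_pderiv_dir[OF assms(2)]]
  have "(LINT x|lebesgue_on cell. pderiv_dir i \<psi> x * \<theta> x + \<psi> x * pderiv_dir i \<theta> x) = 0"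
  proof (rule integral_periodic_derivative[of "\<lambda>x. \<psi> x * \<theta> x"])
    show "periodic (\<lambda>x. \<psi> x * \<theta> x)"
      using assms by (auto simp: smooth_periodic_def periodic_def)
    show "((\<lambda>s. \<psi> (x + s *\<^sub>R axis i 1) * \<theta> (x + s *\<^sub>R axis i 1)) has_real_derivative
      pderiv_dir i \<psi> x * \<theta> x + \<psi> x * pderiv_dir i \<theta> x) (at 0)" for x
      using DERIV_mult[OF pderiv_dir_has_derivative[OF assms(1), of x i] pderiv_dir_has_derivative[OF assms(2), of x i]]
      by (simp add: algebra_simps)
  qed (intro continuous_intros c)+
  then show ?thesis
    using assms by (simp add: ip_def L2p_mult_integrable smooth_L2p smooth_pderiv_dir)
qed

text \<open>\<open>pderivs\<close> applies the head of the list last, so integration by parts strips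
  the head. The induction hypothesis is then used for the derivative, again a combination of the
  same two functions; hence \<open>a\<close> and \<open>b\<close> are arbitrary.\<close>

lemma has_weak_deriv_trig:
  "\<exists>a' b'. has_weak_deriv js (\<lambda>x. a * cosk k x + b * sink k x) (\<lambda>x. a' * cosk k x + b' * sink k x)"
proof (induction js arbitrary: a b)
  case Nil
  then show ?case by (auto simp: has_weak_deriv_def pderivs_def)
next
  case (Cons i js)
  let ?e = "\<lambda>x. a * cosk k x + b * sink k x"
  obtain a1 b1 where 1: "pderiv_dir i ?e = (\<lambda>x. a1 * cosk k x + b1 * sink k x)"
    using pderiv_dir_trig[of i a k b] by blast
  obtain a2 b2 where 2: "has_weak_deriv js (pderiv_dir i ?e) (\<lambda>x. a2 * cosk k x + b2 * sink k x)"
    using Cons[of a1 b1] unfolding 1 by blast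
  have "has_weak_deriv (i # js) ?e (\<lambda>x. a2 * cosk k x + b2 * sink k x)"
    unfolding has_weak_deriv_def
  proof
    fix \<psi> :: "'a func" assume \<psi>: "\<psi> \<in> smooth_periodic"
    have "ip ?e (pderivs (i # js) \<psi>) = ip ?e (pderiv_dir i (pderivs js \<psi>))"
      by (simp add: pderivs_def)
    also have "\<dots> = - ip (pderiv_dir i ?e) (pderivs js \<psi>)"
      by (intro integration_by_parts trig_smooth_periodic smooth_pderivs \<psi>)
    also have "\<dots> = - ((- 1) ^ length js * ip (\<lambda>x. a2 * cosk k x + b2 * sink k x) \<psi>)"
      using 2 \<psi> by (simp add: has_weak_deriv_def)
    finally show "ip ?e (pderivs (i # js) \<psi>) = (- 1) ^ length (i # js) * ip (\<lambda>x. a2 * cosk k x + b2 * sink k x) \<psi>"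
      by simp
  qed
  then show ?case by blast
qed

lemma Hp_L2p: "u \<in> Hp m \<Longrightarrow> u \<in> L2p"
  by (simp add: Hp_def)

lemma Hp_wderiv:
  assumes "u \<in> Hp m" "length js \<le> m"
  shows "wderiv js u \<in> L2p" "has_weak_deriv js u (wderiv js u)"
proof -
  have "\<exists>g. g \<in> L2p \<and> has_weak_deriv js u g"
    using assms by (auto simp: Hp_def Bex_def)
  then have "wderiv js u \<in> L2p \<and> has_weak_deriv js u (wderiv js u)"
    unfolding wderiv_def by (rule someI_ex)
  then show "wderiv js u \<in> L2p" "has_weak_deriv js u (wderiv js u)" by auto
qed

lemma Hp_trig [simp]: "trig m \<in> Hp N"
proof -
  have "\<exists>g\<in>L2p. has_weak_deriv js (trig m) g" for js
  proof -
    have "\<exists>a' b'. has_weak_deriv js (trig m) (\<lambda>x. a' * cosk (fst m) x + b' * sink (fst m) x)"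
      using has_weak_deriv_trig[of js 1 "fst m" 0] has_weak_deriv_trig[of js 0 "fst m" 1]
      by (simp add: trig_def)
    moreover have "(\<lambda>x. a' * cosk (fst m) x + b' * sink (fst m) x) \<in> L2p" for a' b'
      by (intro smooth_L2p trig_smooth_periodic)
    ultimately show ?thesis by blast
  qed
  then show ?thesis by (simp add: Hp_def)
qed

lemma Hp_lincomb:
  assumes u: "u \<in> Hp N" and w: "w \<in> Hp N"
  shows "(\<lambda>x. a * u x + b * w x) \<in> Hp N"
proof -
  have L: "u \<in> L2p" "w \<in> L2p" using u w by (auto intro: Hp_L2p)
  have "\<exists>g\<in>L2p. has_weak_deriv js (\<lambda>x. a * u x + b * w x) g" if js: "length js \<le> N" for js
  proof
    note U = Hp_wderiv[OF u js] and W = Hp_wderiv[OF w js]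
    show "(\<lambda>x. a * wderiv js u x + b * wderiv js w x) \<in> L2p"
      by (intro L2p_add L2p_scale U W)
    have lin: "ip (\<lambda>x. a * f x + b * g x) h = a * ip f h + b * ip g h"
      if "f \<in> L2p" "g \<in> L2p" "h \<in> L2p" for f g h :: "'a func"
      using that by (simp add: ip_add_left L2p_scale ip_scale_left)
    show "has_weak_deriv js (\<lambda>x. a * u x + b * w x) (\<lambda>x. a * wderiv js u x + b * wderiv js w x)"
      using U W by (auto simp: has_weak_deriv_def lin L smooth_L2p smooth_pderivs distrib_left)
  qed
  moreover have "(\<lambda>x. a * u x + b * w x) \<in> L2p" by (intro L2p_add L2p_scale L)
  ultimately show ?thesis by (simp add: Hp_def)
qed

lemma Hp_diff: "u \<in> Hp N \<Longrightarrow> w \<in> Hp N \<Longrightarrow> u - w \<in> Hp N"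
  using Hp_lincomb[of u N w 1 "-1"] by (simp add: fun_diff_def)

lemma Hp_zero: "(\<lambda>x. 0) \<in> Hp N"
  using Hp_lincomb[of "trig (0, True)" N "trig (0, True)" 0 0] by simp

lemma Hp_sum:
  assumes "finite A" "\<And>a. a \<in> A \<Longrightarrow> u a \<in> Hp N" shows "(\<lambda>x. \<Sum>a\<in>A. c a * u a x) \<in> Hp N"
  using assms
proof (induction A)
  case (insert a A)
  then show ?case using Hp_lincomb[of "u a" N "\<lambda>x. \<Sum>a\<in>A. c a * u a x" "c a" 1] by simp
qed (simp add: Hp_zero)

lemma Hp_tsum [simp]: "tsum M d \<in> Hp N"
  unfolding tsum_def by (intro Hp_sum) auto

text \<open>The Fourier symbol of the derivative along \<open>js\<close>, up to a power of the
  imaginary unit.\<close>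

definition wave :: "'n::finite list \<Rightarrow> int^'n \<Rightarrow> real" where
  "wave js k = (\<Prod>j\<leftarrow>js. 2 * pi * of_int (k $ j))"

text \<open>Each derivative scales the pair \<open>cosk k\<close>, \<open>sink k\<close> by
  \<open>2 * pi * k $ i\<close> and turns it by a quarter turn. Recording only
  \<open>a\<^sup>2 + b\<^sup>2\<close> avoids counting the turns.\<close>

lemma pderivs_trig:
  "\<exists>a b. pderivs js (cosk k) = (\<lambda>x. a * cosk k x + b * sink k x) \<and>
    pderivs js (sink k) = (\<lambda>x. (- b) * cosk k x + a * sink k x) \<and> a\<^sup>2 + b\<^sup>2 = (wave js k)\<^sup>2"
proof (induction js)
  case Nil
  show ?case by (rule exI[of _ 1], rule exI[of _ 0]) (simp add: pderivs_def wave_def)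
next
  case (Cons i js)
  then obtain a b where ab: "pderivs js (cosk k) = (\<lambda>x. a * cosk k x + b * sink k x)"
    "pderivs js (sink k) = (\<lambda>x. (- b) * cosk k x + a * sink k x)" "a\<^sup>2 + b\<^sup>2 = (wave js k)\<^sup>2"
    by blast
  let ?\<kappa> = "2 * pi * of_int (k $ i)"
  have p: "pderivs (i # js) f = pderiv_dir i (pderivs js f)" for f
    by (simp add: pderivs_def)
  have "pderivs (i # js) (cosk k) = (\<lambda>x. (?\<kappa> * b) * cosk k x + (- ?\<kappa> * a) * sink k x)"
    unfolding p ab pderiv_dir_trig by simp
  moreover have "pderivs (i # js) (sink k) = (\<lambda>x. (- (- ?\<kappa> * a)) * cosk k x + (?\<kappa> * b) * sink k x)"
    unfolding p ab pderiv_dir_trig by simp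
  moreover have "(?\<kappa> * b)\<^sup>2 + (- ?\<kappa> * a)\<^sup>2 = ?\<kappa>\<^sup>2 * (a\<^sup>2 + b\<^sup>2)"
    by (simp add: power2_eq_square algebra_simps)
  ultimately show ?case
    by (intro exI[of _ "?\<kappa> * b"] exI[of _ "- ?\<kappa> * a"]) (simp add: ab(3) wave_def power_mult_distrib)
qed

text \<open>A derivative of odd order exchanges the cosine and the sine coefficient of a frequency,
  so a multiplier law holds for the sum of their squares and not for each of them.\<close>

definition coef_sq :: "'n::finite func \<Rightarrow> int^'n \<Rightarrow> real" where
  "coef_sq u k = (coef u (k, True))\<^sup>2 + (coef u (k, False))\<^sup>2"

lemma coef_sq_weak_deriv:
  assumes "has_weak_deriv js u g" "u \<in> L2p" "g \<in> L2p"
  shows "coef_sq g k = (wave js k)\<^sup>2 * coef_sq u k"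
proof -
  obtain a b where ab: "pderivs js (cosk k) = (\<lambda>x. a * cosk k x + b * sink k x)"
    "pderivs js (sink k) = (\<lambda>x. (- b) * cosk k x + a * sink k x)" "a\<^sup>2 + b\<^sup>2 = (wave js k)\<^sup>2"
    using pderivs_trig[of js k] by blast
  let ?s = "(- 1) ^ length js :: real"
  have s2: "?s * ?s = 1" by (simp add: power_mult_distrib[symmetric])
  have lin: "ip u (\<lambda>x. a * cosk k x + b * sink k x) = a * ip u (cosk k) + b * ip u (sink k)" for a b
    using assms(2)
    by (subst ip_commute) (simp add: ip_add_left L2p_scale ip_scale_left smooth_L2p smooth_cosk smooth_sink ip_commute[of u])
  have e1: "?s * ip g (cosk k) = a * ip u (cosk k) + b * ip u (sink k)"
    using assms(1) smooth_cosk[of k] unfolding has_weak_deriv_def ab(1)[symmetric] lin[symmetric] by simp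
  have e2: "?s * ip g (sink k) = (- b) * ip u (cosk k) + a * ip u (sink k)"
    using assms(1) smooth_sink[of k] unfolding has_weak_deriv_def ab(2)[symmetric] lin[symmetric] by simp
  have "(?s * ip g (cosk k))\<^sup>2 + (?s * ip g (sink k))\<^sup>2 = (a\<^sup>2 + b\<^sup>2) * ((ip u (cosk k))\<^sup>2 + (ip u (sink k))\<^sup>2)"
    unfolding e1 e2 by (simp add: power2_eq_square algebra_simps)
  then show ?thesis
    by (simp add: coef_sq_def coef_def trig_def ab(3) power_mult_distrib s2 power2_eq_square[of ?s])
qed

lemma sum_Modes_sq:
  "(\<Sum>m\<in>Modes N. g (fst m) * (coef u m)\<^sup>2) = (\<Sum>k | \<forall>i. \<bar>k $ i\<bar> \<le> int N. g k * coef_sq u k)"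
  unfolding sum_Modes coef_sq_def by (simp add: distrib_left)

lemma eigval_nonneg: "0 \<le> eigval k"
  by (simp add: eigval_def sum_nonneg)

lemma lam_nonneg: "0 \<le> lam m"
  by (simp add: lam_def eigval_nonneg)

lemma wave_sq_le: "(wave js k)\<^sup>2 \<le> eigval k ^ length js"
proof (induction js)
  case (Cons i js)
  have "(2 * pi * of_int (k $ i))\<^sup>2 \<le> eigval k"
    using member_le_sum[of i UNIV "\<lambda>i. (of_int (k $ i) :: real)\<^sup>2"]
    by (simp add: eigval_def power_mult_distrib)
  then have "(2 * pi * of_int (k $ i))\<^sup>2 * (wave js k)\<^sup>2 \<le> eigval k * eigval k ^ length js"
    using Cons by (intro mult_mono) (auto simp: eigval_nonneg)
  then show ?case by (simp add: wave_def power_mult_distrib)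
qed (simp add: wave_def)

lemma power_le_one_plus: "0 \<le> x \<Longrightarrow> l \<le> m \<Longrightarrow> x ^ l \<le> 1 + (x :: real) ^ m"
  by (cases "x \<le> 1") (auto intro: order_trans[OF power_le_one] order_trans[OF power_increasing] add_increasing)

lemma Hnorm_sq: "(Hnorm m u)\<^sup>2 = (\<Sum>js | length js \<le> m. ip (wderiv js u) (wderiv js u))"
  unfolding Hnorm_def by (simp add: L2norm_sq sum_nonneg ip_nonneg)

lemma finite_lists_le: "finite {js :: 'n::finite list. length js \<le> m}"
  using finite_lists_length_le[of "UNIV :: 'n set" m] by simp

text \<open>By Parseval the derivative along \<open>js\<close> is measured with the multiplier
  \<open>(wave js k)\<^sup>2\<close>, which is at most \<open>eigval k ^ length js\<close> and hence
  at most \<open>1 + eigval k ^ m\<close>. The factor counts the lists that enter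
  \<open>Hnorm\<close>.\<close>

lemma Hnorm_le:
  fixes u :: "'n::finite func" and C :: real
  assumes u: "u \<in> Hp m" and C: "\<And>N. (\<Sum>n\<in>Modes N. (1 + lam n ^ m) * (coef u n)\<^sup>2) \<le> C"
  shows "(Hnorm m u)\<^sup>2 \<le> card {js :: 'n list. length js \<le> m} * C"
proof -
  have "ip (wderiv js u) (wderiv js u) \<le> C" if js: "length js \<le> m" for js
  proof (rule LIMSEQ_le_const2[OF Parseval])
    show W: "wderiv js u \<in> L2p" by (rule Hp_wderiv[OF u js])
    have "(\<Sum>n\<in>Modes N. (coef (wderiv js u) n)\<^sup>2) \<le> C" for N
    proof -
      have "(\<Sum>n\<in>Modes N. (coef (wderiv js u) n)\<^sup>2) = (\<Sum>k | \<forall>i. \<bar>k $ i\<bar> \<le> int N. (wave js k)\<^sup>2 * coef_sq u k)"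
        using sum_Modes_sq[of "\<lambda>_. 1" "wderiv js u" N]
        by (simp add: coef_sq_weak_deriv[OF Hp_wderiv(2)[OF u js] Hp_L2p[OF u] W])
      also have "\<dots> = (\<Sum>n\<in>Modes N. (wave js (fst n))\<^sup>2 * (coef u n)\<^sup>2)"
        by (rule sum_Modes_sq[symmetric])
      also have "\<dots> \<le> (\<Sum>n\<in>Modes N. (1 + lam n ^ m) * (coef u n)\<^sup>2)"
        unfolding lam_def
        by (intro sum_mono mult_right_mono order_trans[OF wave_sq_le power_le_one_plus[OF eigval_nonneg js]]) auto
      finally show ?thesis using C[of N] by simp
    qed
    then show "\<exists>N0. \<forall>N\<ge>N0. (\<Sum>n\<in>Modes N. (coef (wderiv js u) n)\<^sup>2) \<le> C" by blast
  qed
  then have "(Hnorm m u)\<^sup>2 \<le> of_nat (card {js :: 'n list. length js \<le> m}) * C"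
    unfolding Hnorm_sq by (intro sum_bounded_above) auto
  then show ?thesis by simp
qed

text \<open>The eigenvalue is the sum of the symbols \<open>wave [i, i]\<close>. Its square costs
  one factor \<open>CARD('n)\<close> by Cauchy-Schwarz, and the sum of \<open>CARD('n)\<close>
  second derivatives, each bounded by \<open>Hnorm\<close>, costs the other. The 1 comes from the
  empty list.\<close>

lemma Hnorm_2_ge:
  fixes u :: "'n::finite func"
  assumes u: "u \<in> Hp 2"
  shows "(\<Sum>n\<in>Modes N. (1 + (lam n)\<^sup>2) * (coef u n)\<^sup>2) \<le> (1 + real CARD('n) * real CARD('n)) * (Hnorm 2 u)\<^sup>2"
proof -
  let ?W = "\<lambda>js. ip (wderiv js u) (wderiv js u)"
  have W: "?W js \<le> (Hnorm 2 u)\<^sup>2" if "length js \<le> 2" for js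
    unfolding Hnorm_sq using that finite_lists_le by (intro member_le_sum) (auto simp: ip_nonneg)
  have B: "(\<Sum>n\<in>Modes N. (wave js (fst n))\<^sup>2 * (coef u n)\<^sup>2) \<le> (Hnorm 2 u)\<^sup>2" if js: "length js \<le> 2" for js
  proof -
    have "(\<Sum>n\<in>Modes N. (wave js (fst n))\<^sup>2 * (coef u n)\<^sup>2) = (\<Sum>k | \<forall>i. \<bar>k $ i\<bar> \<le> int N. (wave js k)\<^sup>2 * coef_sq u k)"
      by (rule sum_Modes_sq)
    also have "\<dots> = (\<Sum>n\<in>Modes N. (coef (wderiv js u) n)\<^sup>2)"
      using sum_Modes_sq[of "\<lambda>_. 1" "wderiv js u" N]
      by (simp add: coef_sq_weak_deriv[OF Hp_wderiv(2)[OF u js] Hp_L2p[OF u] Hp_wderiv(1)[OF u js]])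
    also have "\<dots> \<le> ?W js" by (rule Bessel[OF Hp_wderiv(1)[OF u js]])
    finally show ?thesis using W[OF js] by simp
  qed
  have lam2: "(lam n)\<^sup>2 \<le> CARD('n) * (\<Sum>i\<in>UNIV. (wave [i, i] (fst n))\<^sup>2)" for n :: "'n mode"
  proof -
    have "lam n = (\<Sum>i\<in>UNIV. wave [i, i] (fst n))"
      by (simp add: lam_def eigval_def wave_def sum_distrib_left power2_eq_square algebra_simps)
    then show ?thesis
      using sum_squared_le_sum_of_squares[of "\<lambda>i. wave [i, i] (fst n)" "UNIV :: 'n set"] by (simp add: mult.commute)
  qed
  have "(\<Sum>n\<in>Modes N. (1 + (lam n)\<^sup>2) * (coef u n)\<^sup>2) \<le>
    (\<Sum>n\<in>Modes N. (wave [] (fst n))\<^sup>2 * (coef u n)\<^sup>2 + CARD('n) * (\<Sum>i\<in>UNIV. (wave [i, i] (fst n))\<^sup>2 * (coef u n)\<^sup>2))"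
  proof (rule sum_mono)
    fix n :: "'n mode"
    have "(lam n)\<^sup>2 * (coef u n)\<^sup>2 \<le> (CARD('n) * (\<Sum>i\<in>UNIV. (wave [i, i] (fst n))\<^sup>2)) * (coef u n)\<^sup>2"
      by (intro mult_right_mono lam2) simp
    then show "(1 + (lam n)\<^sup>2) * (coef u n)\<^sup>2 \<le> (wave [] (fst n))\<^sup>2 * (coef u n)\<^sup>2 + CARD('n) * (\<Sum>i\<in>UNIV. (wave [i, i] (fst n))\<^sup>2 * (coef u n)\<^sup>2)"
      by (simp add: wave_def distrib_right sum_distrib_right mult.assoc)
  qed
  also have "\<dots> = (\<Sum>n\<in>Modes N. (wave [] (fst n))\<^sup>2 * (coef u n)\<^sup>2) +
      CARD('n) * (\<Sum>i\<in>UNIV. \<Sum>n\<in>Modes N. (wave [i, i] (fst n))\<^sup>2 * (coef u n)\<^sup>2)"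
    by (simp add: sum.distrib sum_distrib_left[symmetric] sum.swap[of _ UNIV])
  also have "\<dots> \<le> (Hnorm 2 u)\<^sup>2 + CARD('n) * (CARD('n) * (Hnorm 2 u)\<^sup>2)"
    by (intro add_mono mult_left_mono B sum_bounded_above) auto
  finally show ?thesis by (simp add: distrib_right mult.assoc)
qed

section \<open>The dual spaces\<close>

lemma eigval_ge_1:
  assumes "k \<noteq> 0" shows "1 \<le> eigval k"
proof -
  obtain i where i: "k $ i \<noteq> 0" using assms by (auto simp: vec_eq_iff)
  have "1 \<le> (k $ i)\<^sup>2"
    using i by (metis int_one_le_iff_zero_less zero_less_power2)
  then have "1 \<le> (of_int (k $ i) :: real)\<^sup>2"
    by (metis of_int_1 of_int_le_iff of_int_power)
  also have "\<dots> \<le> (\<Sum>i\<in>UNIV. (of_int (k $ i))\<^sup>2)"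
    by (rule member_le_sum) auto
  finally have 1: "1 \<le> (\<Sum>i\<in>UNIV. (of_int (k $ i) :: real)\<^sup>2)" .
  from mult_mono[OF one_le_four_pi_sq 1] show ?thesis by (simp add: eigval_def)
qed

lemma lam_ge_1: "fst m \<noteq> 0 \<Longrightarrow> 1 \<le> lam m"
  by (simp add: lam_def eigval_ge_1)

lemma eigval_minus [simp]: "eigval (- k) = eigval k"
  by (simp add: eigval_def)

lemma eigval_0 [simp]: "eigval 0 = 0"
  by (simp add: eigval_def)

lemma Hdual_lin:
  assumes "v \<in> Hdual m" "u \<in> Hp m" "w \<in> Hp m"
  shows "v (\<lambda>x. a * u x + b * w x) = a * v u + b * v w"
  using assms by (auto simp: Hdual_def)

lemma Hdual_minus_arg: "v \<in> Hdual m \<Longrightarrow> u \<in> Hp m \<Longrightarrow> v (\<lambda>x. - u x) = - v u"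
  using Hdual_lin[of v m u u "-1" 0] by simp

lemma Hdual_zero_arg: "v \<in> Hdual m \<Longrightarrow> v (\<lambda>x. 0) = 0"
  using Hdual_lin[OF _ Hp_zero Hp_zero, of v m 0 0] by simp

lemma Hdual_mode_symm: "v \<in> Hdual m \<Longrightarrow> mode_symm (\<lambda>n. v (trig n))"
  by (auto simp: mode_symm_def trig_minus Hdual_minus_arg)

lemma Hdual_sum:
  assumes "v \<in> Hdual m" "finite A" "\<And>a. a \<in> A \<Longrightarrow> u a \<in> Hp m"
  shows "v (\<lambda>x. \<Sum>a\<in>A. c a * u a x) = (\<Sum>a\<in>A. c a * v (u a))"
  using assms(2,3)
proof (induction A)
  case (insert a A)
  then have "v (\<lambda>x. c a * u a x + 1 * (\<Sum>a\<in>A. c a * u a x)) = c a * v (u a) + 1 * v (\<lambda>x. \<Sum>a\<in>A. c a * u a x)"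
    by (intro Hdual_lin[OF assms(1)] Hp_sum) auto
  then show ?case using insert by simp
qed (simp add: Hdual_zero_arg[OF assms(1)])

lemma Hdual_tsum: "v \<in> Hdual m \<Longrightarrow> v (tsum N d) = (\<Sum>n\<in>Modes N. d n * v (trig n))"
  unfolding tsum_def by (rule Hdual_sum) auto

text \<open>The Fourier coefficients of \<open>A\<^sub>0\<^sup>-\<^sup>1\<^sup>/\<^sup>2\<close> applied to the zero-mean part of \<open>v\<close>.\<close>

definition hm1_coef :: "'n::finite functional \<Rightarrow> 'n mode \<Rightarrow> real" where
  "hm1_coef v n = (if fst n = 0 then 0 else v (trig n) / sqrt (lam n))"

lemma hm1_coef_sq: "(hm1_coef v n)\<^sup>2 = (if fst n = 0 then 0 else (v (trig n))\<^sup>2 / lam n)"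
  by (simp add: hm1_coef_def power_divide lam_nonneg)

lemma hm1_coef_mode_symm: "v \<in> Hdual m \<Longrightarrow> mode_symm (hm1_coef v)"
  using Hdual_mode_symm[of v m] by (auto simp: mode_symm_def hm1_coef_def lam_def)

text \<open>A duality argument. On the sum with coefficients \<open>v (trig n) / lam n\<close> the
  functional takes the value \<open>X\<close>, the quantity to be bounded, while the squared H^1
  norm of that sum is at most \<open>2 * K * X\<close>. Boundedness of \<open>v\<close> gives
  \<open>X\<^sup>2 \<le> 2 * C\<^sup>2 * K * X\<close>, and \<open>X\<close> cancels.\<close>

lemma Hdual_1_bound:
  fixes v :: "'n::finite functional"
  assumes v: "v \<in> Hdual 1"
  shows "\<exists>C. \<forall>N. (\<Sum>n\<in>Modes N. (hm1_coef v n)\<^sup>2) \<le> C"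
proof -
  obtain C where C: "\<And>u. u \<in> Hp 1 \<Longrightarrow> \<bar>v u\<bar> \<le> C * Hnorm 1 u"
    using v unfolding Hdual_def by blast
  define K where "K = real (card {js :: 'n list. length js \<le> 1})"
  define d where "d n = (if fst n = 0 then 0 else v (trig n) / lam n)" for n
  have d: "mode_symm d"
    using Hdual_mode_symm[OF v] by (auto simp: mode_symm_def d_def lam_def)
  have "(\<Sum>n\<in>Modes N. (hm1_coef v n)\<^sup>2) \<le> 2 * C\<^sup>2 * K" for N
  proof -
    define X where "X = (\<Sum>n\<in>Modes N. (hm1_coef v n)\<^sup>2)"
    have X0: "X \<ge> 0" by (simp add: X_def sum_nonneg)
    have "v (tsum N d) = X"
      unfolding X_def Hdual_tsum[OF v] hm1_coef_sq d_def by (rule sum.cong) (auto simp: power2_eq_square)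
    have "(Hnorm 1 (tsum N d))\<^sup>2 \<le> K * (2 * X)"
      unfolding K_def
    proof (rule Hnorm_le)
      fix N'
      have "(\<Sum>n\<in>Modes N'. (1 + lam n ^ 1) * (coef (tsum N d) n)\<^sup>2) =
          (\<Sum>n\<in>Modes N'. if n \<in> Modes N then (1 + lam n) * (d n)\<^sup>2 else 0)"
        by (rule sum.cong) (auto simp: coef_tsum[OF d])
      also have "\<dots> = (\<Sum>n\<in>Modes N' \<inter> Modes N. (1 + lam n) * (d n)\<^sup>2)"
        by (rule sum.inter_restrict[symmetric]) simp
      also have "\<dots> \<le> (\<Sum>n\<in>Modes N. (1 + lam n) * (d n)\<^sup>2)"
        by (intro sum_mono2) (auto simp: lam_nonneg)
      also have "\<dots> \<le> (\<Sum>n\<in>Modes N. 2 * (hm1_coef v n)\<^sup>2)"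
      proof (rule sum_mono)
        fix n
        show "(1 + lam n) * (d n)\<^sup>2 \<le> 2 * (hm1_coef v n)\<^sup>2"
        proof (cases "fst n = 0")
          case False
          then have l: "1 \<le> lam n" by (rule lam_ge_1)
          have "(1 + lam n) * (d n)\<^sup>2 = (1 + lam n) / lam n * (hm1_coef v n)\<^sup>2"
            using l False by (simp add: hm1_coef_sq d_def power_divide) (simp add: power2_eq_square)
          also have "\<dots> \<le> 2 * (hm1_coef v n)\<^sup>2"
            using l by (intro mult_right_mono) (auto simp: field_simps)
          finally show ?thesis .
        qed (simp add: d_def)
      qed
      also have "\<dots> = 2 * X" by (simp add: X_def sum_distrib_left)
      finally show "(\<Sum>n\<in>Modes N'. (1 + lam n ^ 1) * (coef (tsum N d) n)\<^sup>2) \<le> 2 * X" .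
    qed simp
    then have "C\<^sup>2 * (Hnorm 1 (tsum N d))\<^sup>2 \<le> C\<^sup>2 * (K * (2 * X))"
      by (intro mult_left_mono) auto
    moreover have "X\<^sup>2 \<le> (C * Hnorm 1 (tsum N d))\<^sup>2"
      using C[of "tsum N d"] \<open>v (tsum N d) = X\<close> X0 by (intro power_mono) auto
    ultimately have "X * X \<le> (2 * C\<^sup>2 * K) * X"
      by (simp add: power2_eq_square algebra_simps)
    then have "X \<le> 2 * C\<^sup>2 * K"
    proof (cases "X = 0")
      case True
      then show ?thesis by (simp add: K_def)
    next
      case False
      then show ?thesis using X0 \<open>X * X \<le> (2 * C\<^sup>2 * K) * X\<close> by (meson mult_le_cancel_right less_le not_le)
    qed
    then show ?thesis by (simp add: X_def)
  qed
  then show ?thesis by blast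
qed

abbreviation box_modes :: "nat \<Rightarrow> (int^'n::finite) set" where
  "box_modes N \<equiv> {k. \<forall>i. \<bar>k $ i\<bar> \<le> int N}"

text \<open>Bounded sums over boxes give absolute summability because every finite set lies in a
  box; for the same reason the boxes are cofinal and compute the unordered sum.
  \<open>T 0 = 0\<close> allows boxes that contain the origin.\<close>

lemma infsum_box_limit:
  fixes T :: "int^'n::finite \<Rightarrow> real"
  assumes bd: "\<And>N. (\<Sum>k\<in>box_modes N. \<bar>T k\<bar>) \<le> C" and T0: "T 0 = 0"
  shows "(\<lambda>N. \<Sum>k\<in>box_modes N. T k) \<longlonglongrightarrow> (\<Sum>\<^sub>\<infinity>k\<in>- {0}. T k)"
proof -
  have sub: "\<exists>N0. \<forall>N\<ge>N0. F \<subseteq> box_modes N" if "finite F" for F :: "(int^'n) set"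
  proof -
    have "finite (F \<times> {True})" using that by simp
    from finite_subset_Modes[OF this] show ?thesis
      by (auto simp: Modes_def subset_eq)
  qed
  have "(\<lambda>k. \<bar>T k\<bar>) summable_on (- {0})"
  proof (rule nonneg_bdd_above_summable_on)
    show "bdd_above (sum (\<lambda>k. \<bar>T k\<bar>) ` {F. F \<subseteq> - {0} \<and> finite F})"
    proof (rule bdd_aboveI2)
      fix F :: "(int^'n) set" assume "F \<in> {F. F \<subseteq> - {0} \<and> finite F}"
      then obtain N where "F \<subseteq> box_modes N" using sub[of F] by blast
      then have "(\<Sum>k\<in>F. \<bar>T k\<bar>) \<le> (\<Sum>k\<in>box_modes N. \<bar>T k\<bar>)"
        by (intro sum_mono2 finite_box) auto
      then show "(\<Sum>k\<in>F. \<bar>T k\<bar>) \<le> C" using bd[of N] by simp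
    qed
  qed auto
  then have "T summable_on (- {0})"
    using abs_summable_summable[of T "- {0}"] by simp
  then have lim: "(sum T \<longlongrightarrow> (\<Sum>\<^sub>\<infinity>k\<in>- {0}. T k)) (finite_subsets_at_top (- {0}))"
    using has_sum_infsum[of T "- {0}"] by (simp add: has_sum_def)
  have "filterlim (\<lambda>N. box_modes N \<inter> - {0} :: (int^'n) set) (finite_subsets_at_top (- {0})) sequentially"
    unfolding filterlim_finite_subsets_at_top
  proof (intro allI impI)
    fix F :: "(int^'n) set" assume "finite F \<and> F \<subseteq> - {0}"
    then obtain N0 where "\<forall>N\<ge>N0. F \<subseteq> box_modes N" using sub[of F] by blast
    then show "\<forall>\<^sub>F N in sequentially. finite (box_modes N \<inter> - {0}) \<and> F \<subseteq> box_modes N \<inter> - {0} \<and> box_modes N \<inter> - {0} \<subseteq> - {0}"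
      unfolding eventually_sequentially using \<open>finite F \<and> F \<subseteq> - {0}\<close>
      by (intro exI[of _ N0]) (auto simp: finite_box)
  qed
  from filterlim_compose[OF lim this]
  have "(\<lambda>N. sum T (box_modes N \<inter> - {0})) \<longlonglongrightarrow> (\<Sum>\<^sub>\<infinity>k\<in>- {0}. T k)" .
  moreover have "sum T (box_modes N \<inter> - {0}) = sum T (box_modes N)" for N
    using T0 by (intro sum.mono_neutral_left finite_box) auto
  ultimately show ?thesis by simp
qed

lemma mean_cosk: "k \<noteq> 0 \<Longrightarrow> mean (cosk k) = 0" and mean_sink: "mean (sink k) = 0"
  by (auto simp: mean_def integral_cosk integral_sink)

text \<open>The unordered sum converges absolutely by
  \<open>\<bar>x * y\<bar> \<le> x\<^sup>2 + y\<^sup>2\<close>, so it is the limit over boxes.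
  \<open>dbar v\<close> and \<open>v\<close> agree on all modes of nonzero frequency, whose mean
  vanishes.\<close>

lemma A0_pow_half:
  fixes v :: "'n::finite functional"
  assumes v: "v \<in> Hdual 1" and w: "w \<in> L2p"
  shows "(\<lambda>N. \<Sum>n\<in>Modes N. hm1_coef v n * coef w n) \<longlonglongrightarrow> A0_pow (- 1 / 2) (dbar v) w"
proof -
  let ?T = "\<lambda>k. hm1_coef v (k, True) * coef w (k, True) + hm1_coef v (k, False) * coef w (k, False)"
  obtain C where C: "\<And>N. (\<Sum>n\<in>Modes N. (hm1_coef v n)\<^sup>2) \<le> C"
    using Hdual_1_bound[OF v] by blast
  have "(\<lambda>N. \<Sum>k\<in>box_modes N. ?T k) \<longlonglongrightarrow> (\<Sum>\<^sub>\<infinity>k\<in>- {0}. ?T k)"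
  proof (rule infsum_box_limit)
    fix N
    have "(\<Sum>k\<in>box_modes N. \<bar>?T k\<bar>) \<le> (\<Sum>k\<in>box_modes N. ((hm1_coef v (k, True))\<^sup>2 + (coef w (k, True))\<^sup>2) + ((hm1_coef v (k, False))\<^sup>2 + (coef w (k, False))\<^sup>2))"
      by (intro sum_mono order_trans[OF abs_triangle_ineq] add_mono abs_mult_le_squares)
    also have "\<dots> = (\<Sum>n\<in>Modes N. (hm1_coef v n)\<^sup>2 + (coef w n)\<^sup>2)"
      unfolding sum_Modes by simp
    also have "\<dots> \<le> C + ip w w"
      unfolding sum.distrib by (intro add_mono C Bessel w)
    finally show "(\<Sum>k\<in>box_modes N. \<bar>?T k\<bar>) \<le> C + ip w w" .
  qed (simp add: hm1_coef_def)
  moreover have "(\<Sum>\<^sub>\<infinity>k\<in>- {0}. ?T k) = A0_pow (- 1 / 2) (dbar v) w"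
    unfolding A0_pow_def
  proof (rule infsum_cong)
    fix k :: "int^'n" assume "k \<in> - {0}"
    then have k: "k \<noteq> 0" by simp
    have "eigval k powr (- 1 / 2) = 1 / sqrt (eigval k)"
      using eigval_ge_1[OF k] powr_minus[of "eigval k" "1 / 2"] by (simp add: powr_half_sqrt inverse_eq_divide)
    then show "?T k = eigval k powr (- 1 / 2) * (dbar v (cosk k) * ip w (cosk k) + dbar v (sink k) * ip w (sink k))"
      using k by (simp add: hm1_coef_def lam_def coef_def trig_def dbar_def mean_cosk mean_sink add_divide_distrib)
  qed
  ultimately show ?thesis unfolding sum_Modes by simp
qed

text \<open>\<open>L2_rep\<close> is a choice, which is legitimate only once a representing function
  exists; Riesz-Fischer supplies one. Any representing function has the coefficients
  \<open>hm1_coef v\<close>, so Parseval evaluates the norm whatever was chosen.\<close>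

lemma Hm1norm_tendsto:
  fixes v :: "'n::finite functional"
  assumes v: "v \<in> Hdual 1"
  shows "(\<lambda>N. (dmean v)\<^sup>2 + (\<Sum>n\<in>Modes N. (hm1_coef v n)\<^sup>2)) \<longlonglongrightarrow> (Hm1norm v)\<^sup>2"
proof -
  let ?A = "A0_pow (- 1 / 2) (dbar v)"
  obtain C where C: "\<And>N. (\<Sum>n\<in>Modes N. (hm1_coef v n)\<^sup>2) \<le> C"
    using Hdual_1_bound[OF v] by blast
  obtain u where u: "u \<in> L2p" "\<And>n. coef u n = hm1_coef v n"
    using Riesz_Fischer[OF hm1_coef_mode_symm[OF v] C] by blast
  have A: "?A w = ip u w" if w: "w \<in> L2p" for w
    using LIMSEQ_unique[OF A0_pow_half[OF v w]] Parseval_ip[OF u(1) w] by (simp add: u(2))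
  define u' where "u' = L2_rep ?A"
  have u': "u' \<in> L2p" "\<And>w. w \<in> L2p \<Longrightarrow> ?A w = ip u' w"
  proof -
    have "\<exists>u. u \<in> L2p \<and> (\<forall>w \<in> L2p. ?A w = ip u w)" using A u by blast
    from someI_ex[OF this] show "u' \<in> L2p" "\<And>w. w \<in> L2p \<Longrightarrow> ?A w = ip u' w"
      by (auto simp: u'_def L2_rep_def)
  qed
  have "coef u' n = hm1_coef v n" for n
    using A[OF L2p_trig[of n]] u'(2)[OF L2p_trig[of n]] u(2)[of n] by (simp add: coef_def)
  then have "(\<lambda>N. (\<Sum>n\<in>Modes N. (hm1_coef v n)\<^sup>2)) \<longlonglongrightarrow> (L2norm u')\<^sup>2"
    using Parseval[OF u'(1)] by (simp add: L2norm_sq)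
  then have "(\<lambda>N. (dmean v)\<^sup>2 + (\<Sum>n\<in>Modes N. (hm1_coef v n)\<^sup>2)) \<longlonglongrightarrow> (dmean v)\<^sup>2 + (L2norm u')\<^sup>2"
    by (intro tendsto_add tendsto_const)
  then show ?thesis by (simp add: Hm1norm_def u'_def add.commute)
qed

lemma Hm1norm_ge:
  assumes v: "v \<in> Hdual 1"
  shows "(dmean v)\<^sup>2 + (\<Sum>n\<in>Modes N. (hm1_coef v n)\<^sup>2) \<le> (Hm1norm v)\<^sup>2"
  by (rule incseq_le[OF _ Hm1norm_tendsto[OF v]]) (auto simp: incseq_def intro: sum_Modes_mono)

lemma Hm1norm_le:
  assumes v: "v \<in> Hdual 1" and "\<And>N. (dmean v)\<^sup>2 + (\<Sum>n\<in>Modes N. (hm1_coef v n)\<^sup>2) \<le> C"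
  shows "(Hm1norm v)\<^sup>2 \<le> C"
  by (rule LIMSEQ_le_const2[OF Hm1norm_tendsto[OF v]]) (use assms in auto)

text \<open>Only the frequencies \<open>k\<close> and \<open>- k\<close> contribute;
  \<open>eigval\<close> has the same value there and can be pulled out, and what remains is
  \<open>reproducing\<close>. Symmetry of the mode values is the form that suits a combination of
  functionals from different dual spaces.\<close>

lemma A0_pow_minus_1_trig:
  fixes v :: "'n::finite functional"
  assumes v: "mode_symm (\<lambda>n. v (trig n))" and n: "fst n \<noteq> 0"
  shows "A0_pow (- 1) v (trig n) = v (trig n) / lam n"
proof -
  obtain k b where nkb: "n = (k, b)" by force
  have k: "k \<noteq> 0" using n nkb by simp
  let ?T = "\<lambda>k. eigval k powr (- 1) * (v (cosk k) * ip (trig n) (cosk k) + v (sink k) * ip (trig n) (sink k))"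
  obtain N where N: "n \<in> Modes N" using mode_in_Modes[of n] by blast
  then have kN: "k \<in> box_modes N" by (simp add: nkb Modes_iff)
  have z: "?T j = 0" if "j \<noteq> k" "j \<noteq> - k" for j :: "int^'n"
    using that by (cases b) (auto simp: nkb trig_def ip_cosk_cosk ip_sink_sink ip_sink_cosk ip_cosk_sink minus_equation_iff)
  have "A0_pow (- 1) v (trig n) = (\<Sum>\<^sub>\<infinity>j\<in>box_modes N - {0}. ?T j)"
    unfolding A0_pow_def
  proof (rule infsum_cong_neutral)
    fix j :: "int^'n" assume "j \<in> - {0} - (box_modes N - {0})"
    then have "j \<notin> box_modes N" by auto
    then show "?T j = 0" using kN by (intro z) auto
  qed auto
  also have "\<dots> = (\<Sum>j\<in>box_modes N - {0}. ?T j)"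
    by (rule infsum_finite) (simp add: finite_box)
  also have "\<dots> = (\<Sum>j\<in>box_modes N - {0}. (1 / eigval k) * (v (cosk j) * ip (cosk j) (trig n) + v (sink j) * ip (sink j) (trig n)))"
  proof (rule sum.cong[OF refl])
    fix j :: "int^'n" assume j: "j \<in> box_modes N - {0}"
    show "?T j = (1 / eigval k) * (v (cosk j) * ip (cosk j) (trig n) + v (sink j) * ip (sink j) (trig n))"
    proof (cases "j = k \<or> j = - k")
      case True
      then have "eigval j = eigval k" by auto
      moreover have "eigval k \<ge> 1" using eigval_ge_1[OF k] .
      ultimately show ?thesis by (simp add: ip_commute[of "trig n"] powr_minus inverse_eq_divide)
    next
      case False
      then have "v (cosk j) * ip (trig n) (cosk j) + v (sink j) * ip (trig n) (sink j) = 0"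
        by (cases b) (auto simp: nkb trig_def ip_cosk_cosk ip_sink_sink ip_sink_cosk ip_cosk_sink minus_equation_iff)
      then show ?thesis by (simp add: ip_commute[of "trig n"])
    qed
  qed
  also have "\<dots> = (\<Sum>j\<in>box_modes N. (1 / eigval k) * (v (cosk j) * ip (cosk j) (trig n) + v (sink j) * ip (sink j) (trig n)))"
  proof (rule sum.mono_neutral_left)
    show "\<forall>j\<in>box_modes N - (box_modes N - {0}). (1 / eigval k) * (v (cosk j) * ip (cosk j) (trig n) + v (sink j) * ip (sink j) (trig n)) = 0"
    proof
      fix j :: "int^'n" assume "j \<in> box_modes N - (box_modes N - {0})"
      then have j: "j = 0" by auto
      have "ip (cosk 0) (trig n) = 0" "ip (sink 0) (trig n) = 0"
        using k mean_cosk[OF k] mean_sink[of k] by (auto simp: ip_def nkb trig_def mean_def)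
      then show "(1 / eigval k) * (v (cosk j) * ip (cosk j) (trig n) + v (sink j) * ip (sink j) (trig n)) = 0"
        unfolding j by simp
    qed
  qed (auto simp: finite_box)
  also have "\<dots> = (1 / eigval k) * (\<Sum>m\<in>Modes N. v (trig m) * ip (trig m) (trig n))"
    unfolding sum_Modes by (simp add: sum_distrib_left trig_def)
  also have "\<dots> = v (trig n) / lam n"
    unfolding reproducing[OF v] using N by (simp add: nkb lam_def)
  finally show ?thesis .
qed

section \<open>The embedding into continuous functions\<close>

text \<open>The terms are at most \<open>j powr (- 4 / 3)\<close>. The integers are covered by two
  copies of the naturals; zero is counted twice, which only enlarges the bound.\<close>

lemma weight_1d_bound: "\<exists>G\<ge>0. \<forall>N. (\<Sum>m\<in>{- int N..int N}. (1 + (of_int m)\<^sup>2) powr (- 2 / 3)) \<le> (G :: real)"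
proof -
  let ?g = "\<lambda>j::nat. (1 + (real j)\<^sup>2) powr (- 2 / 3)"
  have "summable ?g"
  proof (rule summable_comparison_test)
    show "summable (\<lambda>j. real j powr (- 4 / 3))"
      by (simp add: summable_real_powr_iff)
    have "norm (?g j) \<le> real j powr (- 4 / 3)" if "j \<ge> 1" for j
    proof -
      have "?g j \<le> ((real j)\<^sup>2) powr (- 2 / 3)"
        using that by (intro powr_mono2') auto
      also have "\<dots> = real j powr (- 4 / 3)"
        using that by (simp add: powr_powr powr_numeral[symmetric] del: powr_numeral)
      finally show ?thesis by simp
    qed
    then show "\<exists>N. \<forall>j\<ge>N. norm (?g j) \<le> real j powr (- 4 / 3)" by blast
  qed
  then have S: "(\<Sum>j\<le>N. ?g j) \<le> suminf ?g" for N
    by (intro sum_le_suminf) auto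
  have "(\<Sum>m\<in>{- int N..int N}. (1 + (of_int m)\<^sup>2) powr (- 2 / 3)) \<le> 2 * suminf ?g" for N
  proof -
    have "{- int N..int N} = int ` {..N} \<union> (\<lambda>j. - int j) ` {..N}"
    proof (intro set_eqI iffI)
      fix m assume "m \<in> {- int N..int N}"
      then show "m \<in> int ` {..N} \<union> (\<lambda>j. - int j) ` {..N}"
        by (cases "0 \<le> m") (auto simp: image_iff intro!: bexI[of _ "nat \<bar>m\<bar>"])
    qed auto
    moreover have "sum h (A \<union> B) \<le> sum h A + sum h B" if "finite A" "finite B" "\<And>m. 0 \<le> h m"
      for A B :: "int set" and h :: "int \<Rightarrow> real"
      using sum.union_inter[of A B h] sum_nonneg[of "A \<inter> B" h] that by simp
    ultimately have "(\<Sum>m\<in>{- int N..int N}. (1 + (of_int m)\<^sup>2) powr (- 2 / 3)) \<le>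
      (\<Sum>m\<in>int ` {..N}. (1 + (of_int m)\<^sup>2) powr (- 2 / 3)) + (\<Sum>m\<in>(\<lambda>j. - int j) ` {..N}. (1 + (of_int m)\<^sup>2) powr (- 2 / 3 :: real))"
      by (simp del: minus_divide_left)
    also have "\<dots> = (\<Sum>j\<le>N. ?g j) + (\<Sum>j\<le>N. ?g j)"
      by (subst (1 2) sum.reindex) (auto simp: inj_on_def)
    finally show ?thesis using S[of N] by simp
  qed
  moreover have "suminf ?g \<ge> 0" using S[of 0] by (simp add: order_trans[rotated])
  ultimately show ?thesis by (intro exI[of _ "2 * suminf ?g"]) auto
qed

text \<open>
  Here the dimension enters: \<open>(1 + \<bar>k\<bar>\<^sup>2)\<^sup>2\<close> dominates the product of the \<open>(1 + k\<^sub>i\<^sup>2) powr (2 / 3)\<close>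
  only for at most three factors, and \<open>4 / 3 > 1\<close> makes the one-dimensional sums converge.
\<close>

lemma weight_bound:
  assumes n3: "CARD('n::finite) \<le> 3"
  shows "\<exists>K>0. \<forall>F. finite F \<longrightarrow> (\<Sum>n\<in>(F :: 'n mode set). 1 / (1 + (lam n)\<^sup>2)) \<le> K"
proof -
  obtain G where G: "G \<ge> 0" "\<And>N. (\<Sum>m\<in>{- int N..int N}. (1 + (of_int m)\<^sup>2) powr (- 2 / 3)) \<le> (G :: real)"
    using weight_1d_bound by blast
  have pt: "1 / (1 + (eigval k)\<^sup>2) \<le> 2 * (\<Prod>i\<in>UNIV. (1 + (of_int (k $ i))\<^sup>2) powr (- 2 / 3))" for k :: "int^'n"
  proof -
    define s where "s = (\<Sum>i\<in>UNIV. (of_int (k $ i) :: real)\<^sup>2)"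
    have s0: "s \<ge> 0" by (simp add: s_def sum_nonneg)
    have si: "(of_int (k $ i))\<^sup>2 \<le> s" for i
      unfolding s_def by (rule member_le_sum) auto
    have "s \<le> 4 * pi\<^sup>2 * s"
      using mult_right_mono[OF one_le_four_pi_sq s0] by simp
    then have "s \<le> eigval k"
      unfolding eigval_def s_def[symmetric] .
    then have "s\<^sup>2 \<le> (eigval k)\<^sup>2" using s0 by (intro power_mono) auto
    then have "(1 + s)\<^sup>2 \<le> 2 * (1 + (eigval k)\<^sup>2)"
      using sum_squares_bound[of 1 s] by (simp add: power2_sum)
    then have 1: "1 / (1 + (eigval k)\<^sup>2) \<le> 2 / (1 + s)\<^sup>2"
      using s0 by (simp add: field_simps add_pos_nonneg)
    have "1 / (1 + s)\<^sup>2 = (1 + s) powr (- 2)"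
      using s0 by (simp add: powr_minus powr_numeral inverse_eq_divide)
    also have "\<dots> \<le> (1 + s) powr (real CARD('n) * (- 2 / 3))"
      using s0 n3 by (intro powr_mono) auto
    also have "\<dots> = (\<Prod>i\<in>(UNIV :: 'n set). (1 + s) powr (- 2 / 3))"
      using powr_power[of "1 + s" "- 2 / 3" "CARD('n)"] s0 by (simp add: mult.commute)
    also have "\<dots> \<le> (\<Prod>i\<in>UNIV. (1 + (of_int (k $ i))\<^sup>2) powr (- 2 / 3))"
      using si by (intro prod_mono conjI powr_mono2') (auto simp: add_pos_nonneg)
    finally show ?thesis using 1 by simp
  qed
  have box: "(\<Sum>k\<in>box_modes N. \<Prod>i\<in>UNIV. (1 + (of_int ((k :: int^'n) $ i))\<^sup>2) powr (- 2 / 3)) \<le> G ^ CARD('n)" for N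
  proof -
    have "(\<Prod>i\<in>(UNIV :: 'n set). \<Sum>m\<in>{- int N..int N}. (1 + (of_int m)\<^sup>2) powr (- 2 / 3 :: real)) =
      (\<Sum>g\<in>PiE UNIV (\<lambda>_. {- int N..int N}). \<Prod>i\<in>(UNIV :: 'n set). (1 + (of_int (g i))\<^sup>2) powr (- 2 / 3))"
      by (rule prod_sum_PiE) auto
    also have "\<dots> = (\<Sum>k\<in>box_modes N. \<Prod>i\<in>UNIV. (1 + (of_int ((k :: int^'n) $ i))\<^sup>2) powr (- 2 / 3))"
      by (rule sum.reindex_bij_witness[of _ vec_nth vec_lambda])
        (auto simp: PiE_def abs_le_iff minus_le_iff Pi_def)
    finally show ?thesis
      using prod_mono[of "UNIV :: 'n set" "\<lambda>_. \<Sum>m\<in>{- int N..int N}. (1 + (of_int m)\<^sup>2) powr (- 2 / 3 :: real)" "\<lambda>_. G"] G(2)[of N]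
      by (simp add: sum_nonneg)
  qed
  \<comment> \<open>The 4 is the factor 2 of \<open>pt\<close> times the two modes of each
    frequency; the added 1 makes the constant positive.\<close>
  have "(\<Sum>n\<in>F. 1 / (1 + (lam n)\<^sup>2)) \<le> 4 * G ^ CARD('n) + 1" if F: "finite F" for F :: "'n mode set"
  proof -
    obtain N where N: "F \<subseteq> Modes N" using finite_subset_Modes[OF F] by blast
    have "(\<Sum>n\<in>F. 1 / (1 + (lam n)\<^sup>2)) \<le> (\<Sum>n\<in>(Modes N :: 'n mode set). 1 / (1 + (lam n)\<^sup>2))"
      using N by (intro sum_mono2) (auto intro: add_nonneg_nonneg)
    also have "\<dots> = (\<Sum>k\<in>box_modes N. 2 * (1 / (1 + (eigval (k :: int^'n))\<^sup>2)))"
      unfolding sum_Modes by (simp add: lam_def)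
    also have "\<dots> \<le> (\<Sum>k\<in>box_modes N. 2 * (2 * (\<Prod>i\<in>UNIV. (1 + (of_int ((k :: int^'n) $ i))\<^sup>2) powr (- 2 / 3))))"
      by (intro sum_mono mult_left_mono pt) auto
    also have "\<dots> \<le> 4 * G ^ CARD('n)"
      using box[of N] by (simp add: sum_distrib_left[symmetric])
    finally show ?thesis by simp
  qed
  then show ?thesis using G(1) by (intro exI[of _ "4 * G ^ CARD('n) + 1"]) (auto intro: add_nonneg_pos)
qed

section \<open>Uniform convergence of the Fourier sums of H^2 functions\<close>

definition h2_upto :: "nat \<Rightarrow> 'n::finite func \<Rightarrow> real" where
  "h2_upto N u = (\<Sum>n\<in>Modes N. (1 + (lam n)\<^sup>2) * (coef u n)\<^sup>2)"

text \<open>A quantity comparable with the squared H^2 norm, meaningful when the partial sums are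
  bounded, as they are on \<open>Hp 2\<close>. Its tails \<open>h2_total u - h2_upto N u\<close>
  measure every truncation error below.\<close>

definition h2_total :: "'n::finite func \<Rightarrow> real" where
  "h2_total u = (SUP N. h2_upto N u)"

text \<open>It depends on \<open>u\<close> only through the coefficients, so all representatives
  share it. It supplies the values at single points that the bounds for the nonlinearity
  require.\<close>

definition cont_rep :: "'n::finite func \<Rightarrow> 'n func" where
  "cont_rep u = (\<lambda>x. lim (\<lambda>N. tsum N (coef u) x))"

lemma h2_upto_mono: "M \<le> N \<Longrightarrow> h2_upto M u \<le> h2_upto N u"
  unfolding h2_upto_def by (intro sum_Modes_mono) auto

lemma h2_upto_nonneg: "0 \<le> h2_upto N u"
  unfolding h2_upto_def by (intro sum_nonneg) auto

lemma h2_upto_bdd: "u \<in> Hp 2 \<Longrightarrow> bdd_above (range (\<lambda>N. h2_upto N u))"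
  unfolding h2_upto_def by (rule bdd_aboveI2) (rule Hnorm_2_ge)

lemma h2_upto_le_total: "u \<in> Hp 2 \<Longrightarrow> h2_upto N u \<le> h2_total u"
  unfolding h2_total_def by (rule cSUP_upper[OF UNIV_I h2_upto_bdd])

lemma h2_upto_tendsto: "u \<in> Hp 2 \<Longrightarrow> (\<lambda>N. h2_upto N u) \<longlonglongrightarrow> h2_total u"
  unfolding h2_total_def by (rule LIMSEQ_incseq_SUP[OF h2_upto_bdd]) (auto simp: incseq_def h2_upto_mono)

lemma h2_total_le_Hnorm: "u \<in> Hp 2 \<Longrightarrow> h2_total u \<le> (1 + real CARD('n::finite) * real CARD('n)) * (Hnorm 2 (u :: 'n func))\<^sup>2"
  unfolding h2_total_def h2_upto_def by (intro cSUP_least Hnorm_2_ge) auto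

lemma h2_total_nonneg: "u \<in> Hp 2 \<Longrightarrow> 0 \<le> h2_total u"
  using h2_upto_nonneg h2_upto_le_total order_trans by blast

lemma sum_tail_le:
  assumes u: "u \<in> Hp 2" and F: "finite F" "F \<inter> Modes N = {}"
  shows "(\<Sum>n\<in>F. (1 + (lam n)\<^sup>2) * (coef u n)\<^sup>2) \<le> h2_total u - h2_upto N u"
proof -
  obtain N0 where N0: "\<forall>M\<ge>N0. F \<subseteq> Modes M" using finite_subset_Modes[OF F(1)] by blast
  define M where "M = max N0 N"
  have "F \<union> Modes N \<subseteq> Modes M"
    using N0 Modes_mono[of N M] by (auto simp: M_def)
  then have "(\<Sum>n\<in>F \<union> Modes N. (1 + (lam n)\<^sup>2) * (coef u n)\<^sup>2) \<le> h2_upto M u"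
    unfolding h2_upto_def by (intro sum_mono2) auto
  also have "\<dots> \<le> h2_total u" by (rule h2_upto_le_total[OF u])
  also have "(\<Sum>n\<in>F \<union> Modes N. (1 + (lam n)\<^sup>2) * (coef u n)\<^sup>2) =
    (\<Sum>n\<in>F. (1 + (lam n)\<^sup>2) * (coef u n)\<^sup>2) + h2_upto N u"
    unfolding h2_upto_def using F by (intro sum.union_disjoint) auto
  finally show ?thesis by simp
qed

lemma cont_rep_periodic: "periodic (cont_rep u)"
proof -
  have "tsum N (coef u) (x + axis i 1) = tsum N (coef u) x" for N x i
    using periodic_tsum[of N "coef u"] by (auto simp: periodic_def)
  then show ?thesis by (simp add: cont_rep_def periodic_def)
qed

lemma bounded_diff_ip:
  fixes u w :: "'n::finite func"
  assumes "u \<in> L2p" "w \<in> L2p" "\<And>x. \<bar>u x - w x\<bar> \<le> B" "\<And>x. \<bar>g x\<bar> \<le> 1" "g \<in> L2p"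
  shows "\<bar>ip u g - ip w g\<bar> \<le> B"
proof -
  have i: "integrable (lebesgue_on cell) (\<lambda>x. (u x - w x) * g x)"
    by (intro L2p_mult_integrable L2p_diff assms)
  have "\<bar>LINT x|lebesgue_on cell. (u x - w x) * g x\<bar> \<le> (LINT x|lebesgue_on cell. \<bar>(u x - w x) * g x\<bar>)"
    by (rule integral_abs_bound)
  also have "\<dots> \<le> (LINT x|lebesgue_on (cell :: (real^'n) set). B)"
    using assms(3,4) i
    by (intro integral_mono integrable_abs) (auto simp: abs_mult intro: order_trans[OF mult_right_le_one_le])
  finally show ?thesis
    using ip_diff_left[OF assms(1,2,5)] by (simp add: ip_def)
qed

context
  fixes K :: real
  assumes K0: "K > 0"
    and K: "\<forall>F. finite F \<longrightarrow> (\<Sum>n\<in>(F :: 'n::finite mode set). 1 / (1 + (lam n)\<^sup>2)) \<le> K"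
begin

text \<open>Cauchy-Schwarz after splitting off the weight \<open>sqrt (1 + (lam n)\<^sup>2)\<close>:
  this is the Sobolev embedding into bounded functions, \<open>K\<close> being the bound for the sum
  of the inverse weights.\<close>

lemma sum_abs_le_weighted:
  assumes F: "finite (F :: 'n mode set)" and C: "(\<Sum>n\<in>F. (1 + (lam n)\<^sup>2) * (c n)\<^sup>2) \<le> C"
  shows "(\<Sum>n\<in>F. \<bar>c n\<bar>) \<le> sqrt (K * C)"
proof (rule real_le_rsqrt)
  have p: "1 + (lam n)\<^sup>2 > 0" for n :: "'n mode" by (simp add: add_pos_nonneg)
  have "(\<Sum>n\<in>F. \<bar>c n\<bar>) = (\<Sum>n\<in>F. (1 / sqrt (1 + (lam n)\<^sup>2)) * (sqrt (1 + (lam n)\<^sup>2) * \<bar>c n\<bar>))"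
  proof (rule sum.cong[OF refl])
    fix n :: "'n mode"
    have "sqrt (1 + (lam n)\<^sup>2) \<noteq> 0" using p[of n] by simp
    then show "\<bar>c n\<bar> = (1 / sqrt (1 + (lam n)\<^sup>2)) * (sqrt (1 + (lam n)\<^sup>2) * \<bar>c n\<bar>)" by simp
  qed
  then have "(\<Sum>n\<in>F. \<bar>c n\<bar>)\<^sup>2 \<le> (\<Sum>n\<in>F. (1 / sqrt (1 + (lam n)\<^sup>2))\<^sup>2) * (\<Sum>n\<in>F. (sqrt (1 + (lam n)\<^sup>2) * \<bar>c n\<bar>)\<^sup>2)"
    by (simp only: Cauchy_Schwarz_ineq_sum)
  also have "\<dots> = (\<Sum>n\<in>F. 1 / (1 + (lam n)\<^sup>2)) * (\<Sum>n\<in>F. (1 + (lam n)\<^sup>2) * (c n)\<^sup>2)"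
    using p by (simp add: power_divide power_mult_distrib less_imp_le)
  also have "\<dots> \<le> K * C"
    using K0 K F by (intro mult_mono C sum_nonneg) (auto simp: less_imp_le[OF p])
  finally show "(\<Sum>n\<in>F. \<bar>c n\<bar>)\<^sup>2 \<le> K * C" .
qed

lemma tsum_diff_le:
  assumes u: "u \<in> Hp 2" and MN: "N \<le> M"
  shows "\<bar>tsum M (coef u) x - tsum N (coef u) x\<bar> \<le> sqrt (K * (h2_total u - h2_upto N (u :: 'n func)))"
proof -
  have "tsum M (coef u) x - tsum N (coef u) x = (\<Sum>n\<in>Modes M - Modes N. coef u n * trig n x)"
    unfolding tsum_def using Modes_mono[OF MN] by (subst sum_diff) auto
  also have "\<bar>\<dots>\<bar> \<le> (\<Sum>n\<in>Modes M - Modes N. \<bar>coef u n\<bar>)"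
    by (rule order_trans[OF sum_abs sum_mono]) (simp add: abs_mult trig_abs_le mult_left_le)
  also have "\<dots> \<le> sqrt (K * (h2_total u - h2_upto N u))"
    by (intro sum_abs_le_weighted sum_tail_le[OF u]) auto
  finally show ?thesis .
qed

lemma tail_tendsto_0:
  assumes u: "u \<in> Hp 2" shows "(\<lambda>N. sqrt (K * (h2_total u - h2_upto N (u :: 'n func)))) \<longlonglongrightarrow> 0"
proof -
  have "(\<lambda>N. sqrt (K * (h2_total u - h2_upto N u))) \<longlonglongrightarrow> sqrt (K * (h2_total u - h2_total u))"
    by (intro tendsto_intros h2_upto_tendsto u)
  then show ?thesis by simp
qed

lemma tsum_tendsto_cont_rep:
  assumes u: "u \<in> Hp 2" shows "(\<lambda>N. tsum N (coef u) x) \<longlonglongrightarrow> cont_rep (u :: 'n func) x"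
proof -
  have "Cauchy (\<lambda>N. tsum N (coef u) x)"
  proof (rule metric_CauchyI)
    fix e :: real assume "e > 0"
    then have "eventually (\<lambda>N. sqrt (K * (h2_total u - h2_upto N u)) < e / 2) sequentially"
      by (intro order_tendstoD(2)[OF tail_tendsto_0[OF u]]) simp
    then obtain N where N: "sqrt (K * (h2_total u - h2_upto N u)) < e / 2"
      by (auto simp: eventually_sequentially)
    have "dist (tsum m (coef u) x) (tsum n (coef u) x) < e" if "m \<ge> N" "n \<ge> N" for m n
      using tsum_diff_le[OF u that(1), of x] tsum_diff_le[OF u that(2), of x] N
      unfolding dist_real_def by linarith
    then show "\<exists>M. \<forall>m\<ge>M. \<forall>n\<ge>M. dist (tsum m (coef u) x) (tsum n (coef u) x) < e" by blast
  qed
  then show ?thesis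
    unfolding cont_rep_def by (simp add: Cauchy_convergent convergent_LIMSEQ_iff[symmetric])
qed

lemma cont_rep_tsum_le:
  assumes u: "u \<in> Hp 2"
  shows "\<bar>cont_rep u x - tsum N (coef u) x\<bar> \<le> sqrt (K * (h2_total u - h2_upto N (u :: 'n func)))"
proof (rule LIMSEQ_le_const2)
  show "(\<lambda>M. \<bar>tsum M (coef u) x - tsum N (coef u) x\<bar>) \<longlonglongrightarrow> \<bar>cont_rep u x - tsum N (coef u) x\<bar>"
    by (intro tendsto_intros tsum_tendsto_cont_rep u)
qed (use tsum_diff_le[OF u] in blast)

lemma tsum_abs_le:
  assumes u: "u \<in> Hp 2"
  shows "\<bar>tsum N (coef u) x\<bar> \<le> sqrt (K * h2_total (u :: 'n func))"
proof -
  have "\<bar>tsum N (coef u) x\<bar> \<le> (\<Sum>n\<in>Modes N. \<bar>coef u n\<bar>)"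
    unfolding tsum_def by (rule order_trans[OF sum_abs sum_mono]) (simp add: abs_mult trig_abs_le mult_left_le)
  also have "\<dots> \<le> sqrt (K * h2_total u)"
    by (intro sum_abs_le_weighted) (use h2_upto_le_total[OF u, of N] in \<open>auto simp: h2_upto_def\<close>)
  finally show ?thesis .
qed

lemma cont_rep_abs_le:
  assumes u: "u \<in> Hp 2"
  shows "\<bar>cont_rep u x\<bar> \<le> sqrt (K * h2_total (u :: 'n func))"
proof (rule LIMSEQ_le_const2)
  show "(\<lambda>M. \<bar>tsum M (coef u) x\<bar>) \<longlonglongrightarrow> \<bar>cont_rep u x\<bar>"
    by (intro tendsto_intros tsum_tendsto_cont_rep u)
qed (use tsum_abs_le[OF u] in blast)

lemma cont_rep_continuous:
  assumes u: "u \<in> Hp 2" shows "continuous_on UNIV (cont_rep (u :: 'n func))"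
proof (rule uniform_limit_theorem)
  show "uniform_limit UNIV (\<lambda>N. tsum N (coef u)) (cont_rep u) sequentially"
  proof (rule uniform_limitI)
    fix e :: real assume "e > 0"
    then have "eventually (\<lambda>N. sqrt (K * (h2_total u - h2_upto N u)) < e) sequentially"
      by (intro order_tendstoD(2)[OF tail_tendsto_0[OF u]])
    then show "\<forall>\<^sub>F N in sequentially. \<forall>x\<in>UNIV. dist (tsum N (coef u) x) (cont_rep u x) < e"
    proof eventually_elim
      case (elim N)
      then show ?case
        using cont_rep_tsum_le[OF u, of _ N] by (auto simp: dist_real_def abs_minus_commute intro: le_less_trans)
    qed
  qed
qed (auto intro!: always_eventually continuous_on_tsum)

lemma cont_rep_L2p: "u \<in> Hp 2 \<Longrightarrow> cont_rep (u :: 'n func) \<in> L2p"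
  by (intro L2p_continuous cont_rep_continuous cont_rep_periodic)

text \<open>Uniform convergence preserves Fourier coefficients, and completeness of the system turns
  equality of coefficients into equality almost everywhere.\<close>

lemma cont_rep_AE_eq:
  assumes u: "u \<in> Hp 2" shows "AE x in lebesgue_on cell. u x = cont_rep (u :: 'n func) x"
proof (rule AE_eq_if_coef_eq)
  show "u \<in> L2p" "cont_rep u \<in> L2p" using u by (auto intro: Hp_L2p cont_rep_L2p)
  fix m
  have "(\<lambda>N. coef (tsum N (coef u)) m) \<longlonglongrightarrow> coef (cont_rep u) m"
  proof (rule Lim_transform2[OF tendsto_const])
    show "(\<lambda>N. coef (cont_rep u) m - coef (tsum N (coef u)) m) \<longlonglongrightarrow> 0"
      by (rule Lim_null_comparison[OF always_eventually tail_tendsto_0[OF u]])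
        (auto simp: coef_def intro!: bounded_diff_ip cont_rep_L2p u cont_rep_tsum_le trig_abs_le)
  qed
  moreover obtain N0 where "\<forall>N\<ge>N0. m \<in> Modes N" using mode_in_Modes by blast
  then have "eventually (\<lambda>N. coef (tsum N (coef u)) m = coef u m) sequentially"
    by (auto simp: coef_tsum[OF mode_symm_coef] eventually_sequentially)
  then have "(\<lambda>N. coef (tsum N (coef u)) m) \<longlonglongrightarrow> coef u m" by (rule tendsto_eventually)
  ultimately show "coef u m = coef (cont_rep u) m" using LIMSEQ_unique by blast
qed

text \<open>Linearity is used on the finite sums, where it is immediate, and the bound then passes
  to the limit. It will transport continuity of the trajectory in H^2 to the supremum norm.\<close>

lemma cont_rep_diff_le:
  assumes u: "u \<in> Hp 2" and w: "w \<in> Hp 2"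
  shows "\<bar>cont_rep u x - cont_rep w x\<bar> \<le> sqrt (K * h2_total (u - w :: 'n func))"
proof (rule LIMSEQ_le_const2)
  show "(\<lambda>M. \<bar>tsum M (coef u) x - tsum M (coef w) x\<bar>) \<longlonglongrightarrow> \<bar>cont_rep u x - cont_rep w x\<bar>"
    by (intro tendsto_intros tsum_tendsto_cont_rep u w)
  have "coef (u - w) n = coef u n - coef w n" for n
    using ip_diff_left[OF Hp_L2p[OF u] Hp_L2p[OF w], of "trig n"] by (simp add: coef_def fun_diff_def)
  then have "tsum M (coef u) x - tsum M (coef w) x = tsum M (coef (u - w)) x" for M
    by (simp add: tsum_def left_diff_distrib sum_subtractf)
  then show "\<exists>N. \<forall>M\<ge>N. \<bar>tsum M (coef u) x - tsum M (coef w) x\<bar> \<le> sqrt (K * h2_total (u - w))"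
    using tsum_abs_le[OF Hp_diff[OF u w]] by simp
qed

end

section \<open>Bump functions and weak time derivatives\<close>

text \<open>The flat function \<open>exp (- 1 / x)\<close> with a polynomial factor in
  \<open>1 / x\<close>: with this factor the family is closed under differentiation, which settles
  smoothness at the origin once and for all.\<close>

definition expinv :: "real poly \<Rightarrow> real \<Rightarrow> real" where
  "expinv p x = (if x > 0 then poly p (1 / x) * exp (- (1 / x)) else 0)"

lemma poly_exp_tendsto_0: "((\<lambda>y. poly p y * exp (- y)) \<longlongrightarrow> 0) (at_top :: real filter)"
proof -
  have "((\<lambda>y. \<Sum>i\<le>degree p. coeff p i * (y ^ i / exp y)) \<longlongrightarrow> (\<Sum>i\<le>degree p. coeff p i * 0)) (at_top :: real filter)"
    by (intro tendsto_intros tendsto_power_div_exp_0)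
  moreover have "(\<lambda>y. \<Sum>i\<le>degree p. coeff p i * (y ^ i / exp y)) = (\<lambda>y. poly p y * exp (- y))"
    by (rule ext) (simp add: poly_altdef sum_distrib_right exp_minus divide_inverse mult.assoc)
  ultimately show ?thesis by simp
qed

text \<open>With \<open>y = 1 / x\<close> the derivative in \<open>x\<close> is
  \<open>- y\<^sup>2\<close> times the derivative in \<open>y\<close>, and that of
  \<open>p * exp (- y)\<close> is \<open>(pderiv p - p) * exp (- y)\<close>; hence the polynomial
  \<open>y\<^sup>2 * (p - pderiv p)\<close>. At the origin the exponential beats every
  power.\<close>

lemma expinv_has_derivative:
  "(expinv p has_real_derivative expinv ([:0, 0, 1:] * (p - pderiv p)) x) (at x)"
proof -
  let ?q = "[:0, 0, 1:] * (p - pderiv p)"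
  consider "x > 0" | "x < 0" | "x = 0" by linarith
  then show ?thesis
  proof cases
    case 1
    have "((\<lambda>x. poly p (1 / x) * exp (- (1 / x))) has_real_derivative expinv ?q x) (at x)"
      using 1 by (auto intro!: derivative_eq_intros simp: expinv_def power2_eq_square algebra_simps)
    then show ?thesis
      by (rule has_field_derivative_transform_within[of _ _ _ _ x]) (use 1 in \<open>auto simp: expinv_def dist_real_def abs_if split: if_splits\<close>)
  next
    case 2
    have "((\<lambda>x. 0) has_real_derivative expinv ?q x) (at x)"
      using 2 by (auto simp: expinv_def)
    then show ?thesis
      by (rule has_field_derivative_transform_within[of _ _ _ _ "- x"]) (use 2 in \<open>auto simp: expinv_def dist_real_def abs_if split: if_splits\<close>)
  next
    case 3
    have "((\<lambda>y. (expinv p y - expinv p 0) / (y - 0)) \<longlongrightarrow> 0) (at_right 0)"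
    proof -
      have "((\<lambda>y. poly ([:0, 1:] * p) (inverse y) * exp (- inverse y)) \<longlongrightarrow> 0) (at_right (0::real))"
        by (rule filterlim_compose[OF poly_exp_tendsto_0 filterlim_inverse_at_top_right])
      then show ?thesis
        by (rule Lim_transform_eventually)
          (auto simp: eventually_at_right_field expinv_def inverse_eq_divide intro!: exI[of _ 1])
    qed
    moreover have "((\<lambda>y. (expinv p y - expinv p 0) / (y - 0)) \<longlongrightarrow> 0) (at_left 0)"
      by (rule Lim_transform_eventually[OF tendsto_const])
        (auto simp: eventually_at_left_field expinv_def intro!: exI[of _ "-1"])
    ultimately have "((\<lambda>y. (expinv p y - expinv p 0) / (y - 0)) \<longlongrightarrow> 0) (at 0)"
      by (simp add: filterlim_split_at)
    then show ?thesis
      unfolding 3 has_field_derivative_iff by (simp add: expinv_def)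
  qed
qed

text \<open>Closed under sums and multiples to accommodate the product rule, so that each member has
  its derivative in the set again and is infinitely differentiable.\<close>

inductive_set bumps :: "(real \<Rightarrow> real) set" where
  base: "(\<lambda>x. expinv p (x - a) * expinv q (b - x)) \<in> bumps"
| add: "f \<in> bumps \<Longrightarrow> g \<in> bumps \<Longrightarrow> (\<lambda>x. f x + g x) \<in> bumps"
| scale: "f \<in> bumps \<Longrightarrow> (\<lambda>x. c * f x) \<in> bumps"

lemma bumps_derivative:
  assumes "f \<in> bumps"
  shows "\<exists>f'\<in>bumps. \<forall>x. (f has_real_derivative f' x) (at x)"
  using assms
proof induction
  case (base p a q b)
  let ?D = "\<lambda>p. [:0, 0, 1:] * (p - pderiv p)"
  have 1: "((\<lambda>x. expinv p (x - a)) has_real_derivative expinv (?D p) (x - a)) (at x)" for x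
  proof -
    have "((\<lambda>x. x - a) has_real_derivative 1) (at x)" by (auto intro!: derivative_eq_intros)
    from DERIV_chain2[where g = "\<lambda>x. x - a", OF expinv_has_derivative this] show ?thesis by simp
  qed
  have 2: "((\<lambda>x. expinv q (b - x)) has_real_derivative - expinv (?D q) (b - x)) (at x)" for x
  proof -
    have "((\<lambda>x. b - x) has_real_derivative - 1) (at x)" by (auto intro!: derivative_eq_intros)
    from DERIV_chain2[where g = "\<lambda>x. b - x", OF expinv_has_derivative this] show ?thesis by simp
  qed
  have D: "((\<lambda>x. expinv p (x - a) * expinv q (b - x)) has_real_derivative
    expinv (?D p) (x - a) * expinv q (b - x) + (-1) * (expinv p (x - a) * expinv (?D q) (b - x))) (at x)" for x
    using DERIV_mult[OF 1 2, of x] by (simp add: algebra_simps)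
  have "(\<lambda>x. expinv (?D p) (x - a) * expinv q (b - x) + (-1) * (expinv p (x - a) * expinv (?D q) (b - x))) \<in> bumps"
    by (intro bumps.intros)
  with D show ?case by (intro bexI[rotated]) auto
next
  case (add f g)
  then obtain f' g' where "f' \<in> bumps" "g' \<in> bumps" "\<forall>x. (f has_real_derivative f' x) (at x)"
    "\<forall>x. (g has_real_derivative g' x) (at x)" by blast
  then show ?case
    by (intro bexI[of _ "\<lambda>x. f' x + g' x"]) (auto intro: bumps.intros derivative_intros)
next
  case (scale f c)
  then obtain f' where "f' \<in> bumps" "\<forall>x. (f has_real_derivative f' x) (at x)" by blast
  then show ?case
    by (intro bexI[of _ "\<lambda>x. c * f' x"]) (auto intro: bumps.intros DERIV_cmult)
qed

lemma bumps_deriv: "f \<in> bumps \<Longrightarrow> deriv f \<in> bumps"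
proof -
  assume "f \<in> bumps"
  then obtain f' where f': "f' \<in> bumps" "\<forall>x. (f has_real_derivative f' x) (at x)"
    using bumps_derivative by blast
  then have "deriv f = f'" by (auto intro: DERIV_imp_deriv)
  then show ?thesis using f' by simp
qed

lemma bumps_deriv_iter: "f \<in> bumps \<Longrightarrow> (deriv ^^ k) f \<in> bumps"
  by (induction k) (auto intro: bumps_deriv)

lemma bumps_differentiable: "f \<in> bumps \<Longrightarrow> f differentiable (at x)"
  using bumps_derivative real_differentiable_def by blast

lemma bumps_continuous: "f \<in> bumps \<Longrightarrow> continuous_on S f"
  by (intro continuous_at_imp_continuous_on ballI differentiable_imp_continuous_within bumps_differentiable)

definition bump :: "real \<Rightarrow> real \<Rightarrow> real \<Rightarrow> real" where
  "bump d s x = expinv 1 (x - (s - d)) * expinv 1 ((s + d) - x)"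

lemma bump_in_bumps: "bump d s \<in> bumps"
  unfolding bump_def[abs_def] by (rule bumps.base)

lemma bump_pos: "\<bar>x - s\<bar> < d \<Longrightarrow> bump d s x > 0"
  by (auto simp: bump_def expinv_def abs_if split: if_splits)

lemma bump_zero: "d \<le> \<bar>x - s\<bar> \<Longrightarrow> bump d s x = 0"
  by (auto simp: bump_def expinv_def abs_if split: if_splits)

lemma bump_nonneg: "bump d s x \<ge> 0"
  by (auto simp: bump_def expinv_def)

lemma bump_shift: "bump d s x = bump d 0 (x - s)"
  by (simp add: bump_def algebra_simps)

text \<open>To the right of the bump the primitive keeps the mass \<open>c\<close>. Translates share
  this value, so the difference of two of them has compact support; this is how a test function with
  prescribed derivative is made.\<close>

lemma bump_antiderivative:
  assumes d: "d > 0"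
  obtains G c where "\<And>x. (G has_real_derivative bump d 0 x) (at x)" "\<And>x. x \<le> - d \<Longrightarrow> G x = 0" "\<And>x. d \<le> x \<Longrightarrow> G x = c"
proof -
  define L where "L = - d - 1"
  define G where "G x = integral {L..x} (bump d 0)" for x
  have z: "G x = 0" if "x \<le> - d" for x
  proof -
    have "G x = integral {L..x} (\<lambda>_. 0)"
      unfolding G_def by (rule Henstock_Kurzweil_Integration.integral_cong) (use that d in \<open>auto intro!: bump_zero\<close>)
    then show ?thesis by simp
  qed
  have D: "(G has_real_derivative bump d 0 x) (at x)" for x
  proof (cases "x > L")
    case True
    have "((\<lambda>u. integral {L..u} (bump d 0)) has_real_derivative bump d 0 x) (at x within {L..x + 1})"
      by (rule integral_has_real_derivative) (use True in \<open>auto intro: bumps_continuous bump_in_bumps\<close>)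
    then have "(G has_real_derivative bump d 0 x) (at x within {L..x + 1})"
      by (simp add: G_def[abs_def])
    moreover have "at x within {L..x + 1} = at x"
      by (rule at_within_interior) (use True in simp)
    ultimately show ?thesis by simp
  next
    case False
    then have x: "x < - d" by (simp add: L_def)
    have "((\<lambda>x. 0) has_real_derivative bump d 0 x) (at x)"
      using x d by (simp add: bump_zero)
    then show ?thesis
      by (rule has_field_derivative_transform_within[of _ _ _ _ "- d - x"])
        (use x in \<open>auto simp: z dist_real_def abs_if split: if_splits\<close>)
  qed
  have "G x = G d" if "d \<le> x" for x
  proof (cases "x = d")
    case False
    then have "d < x" using that by simp
    then obtain y where y: "d < y" "y < x" "G x - G d = (x - d) * bump d 0 y"
      using MVT2[of d x G "bump d 0"] D by blast
    then show ?thesis using d by (simp add: bump_zero)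
  qed simp
  then show ?thesis using that[of G "G d"] D z by blast
qed

text \<open>If \<open>A s < A t\<close>, the difference of two translated bumps at \<open>t\<close> and \<open>s\<close> is an admissible
  \<open>\<eta>'\<close> that contradicts the weak formulation.\<close>

lemma weak_constant:
  fixes A :: "real \<Rightarrow> real"
  assumes lo: "0 < lo" "lo < hi" and A: "continuous_on {lo..hi} A"
    and weak: "\<And>\<eta> \<eta>'. \<eta> \<in> test_fun {0<..} \<Longrightarrow> (\<And>x. (\<eta> has_real_derivative \<eta>' x) (at x)) \<Longrightarrow>
      (\<And>x. x \<notin> {lo..hi} \<Longrightarrow> \<eta> x = 0) \<Longrightarrow> \<eta> lo = 0 \<Longrightarrow> \<eta> hi = 0 \<Longrightarrow> continuous_on UNIV \<eta>' \<Longrightarrow>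
      (\<And>x. x \<notin> {lo..hi} \<Longrightarrow> \<eta>' x = 0) \<Longrightarrow> integral {lo..hi} (\<lambda>x. \<eta>' x * A x) = 0"
    and st: "s \<in> {lo<..<hi}" "t \<in> {lo<..<hi}"
  shows "\<not> A s < A t"
proof
  assume lt: "A s < A t"
  define c where "c = (A s + A t) / 2"
  have c: "A s < c" "c < A t" using lt by (auto simp: c_def)
  have Ac: "isCont A s" "isCont A t"
    using A st by (auto intro!: continuous_on_interior)
  have es: "eventually (\<lambda>x. A x < c) (at s)" and et: "eventually (\<lambda>x. c < A x) (at t)"
    using Ac c order_tendstoD unfolding isCont_def by blast+
  obtain d1 where d1: "d1 > 0" "\<And>x. x \<noteq> s \<Longrightarrow> \<bar>x - s\<bar> < d1 \<Longrightarrow> A x < c"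
    using es unfolding eventually_at dist_real_def by blast
  obtain d2 where d2: "d2 > 0" "\<And>x. x \<noteq> t \<Longrightarrow> \<bar>x - t\<bar> < d2 \<Longrightarrow> c < A x"
    using et unfolding eventually_at dist_real_def by blast
  note d = d1 d2
  \<comment> \<open>Small enough that \<open>A\<close> stays on its side of \<open>c\<close> near
    \<open>s\<close> and near \<open>t\<close>, and that both bumps live in
    \<open>[lo + d, hi - d]\<close>; the halves leave that margin at the ends.\<close>
  define d where "d = Min {d1, d2, (s - lo) / 2, (t - lo) / 2, (hi - s) / 2, (hi - t) / 2}"
  have dp: "d > 0" "d \<le> d1" "d \<le> d2" "d \<le> (s - lo) / 2" "d \<le> (t - lo) / 2" "d \<le> (hi - s) / 2" "d \<le> (hi - t) / 2"
  proof -
    show "d > 0" unfolding d_def using d(1,3) st by simp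
  qed (unfold d_def, (rule Min.coboundedI, simp, simp)+)
  obtain G k where G: "\<And>x. (G has_real_derivative bump d 0 x) (at x)" "\<And>x. x \<le> - d \<Longrightarrow> G x = 0" "\<And>x. d \<le> x \<Longrightarrow> G x = k"
    using bump_antiderivative[OF dp(1)] by blast
  define \<eta> where "\<eta> x = G (x - t) - G (x - s)" for x
  define \<rho> where "\<rho> x = bump d t x + (-1) * bump d s x" for x
  have \<rho>b: "\<rho> \<in> bumps"
    unfolding \<rho>_def[abs_def] by (intro bumps.add bumps.scale bump_in_bumps)
  have D: "(\<eta> has_real_derivative \<rho> x) (at x)" for x
  proof -
    have "((\<lambda>x. G (x - c)) has_real_derivative bump d c x) (at x)" for c
    proof -
      have "((\<lambda>x. x - c) has_real_derivative 1) (at x)" by (auto intro!: derivative_eq_intros)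
      from DERIV_chain2[where g = "\<lambda>x. x - c", OF G(1) this] show ?thesis
        by (simp add: bump_shift[of d c x])
    qed
    from DERIV_diff[OF this[of t] this[of s]] show ?thesis
      by (simp add: \<eta>_def[abs_def] \<rho>_def)
  qed
  have out: "\<eta> x = 0" "\<rho> x = 0" if "x \<notin> {lo + d..hi - d}" for x
  proof -
    have "x < lo + d \<or> hi - d < x" using that by auto
    then show "\<eta> x = 0" "\<rho> x = 0"
      using dp by (auto simp: \<eta>_def \<rho>_def G(2,3) bump_zero)
  qed
  have "(deriv ^^ j) \<eta> differentiable (at x)" for j x
  proof (cases j)
    case 0
    then show ?thesis using D real_differentiable_def by auto
  next
    case (Suc i)
    have "deriv \<eta> = \<rho>" using D by (auto intro: DERIV_imp_deriv)
    then show ?thesis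
      unfolding Suc funpow_Suc_right o_apply using bumps_differentiable[OF bumps_deriv_iter[OF \<rho>b]] by simp
  qed
  then have test: "\<eta> \<in> test_fun {0<..}"
    using out(1) lo dp(1) unfolding test_fun_def
    by (auto intro!: exI[of _ "{lo + d..hi - d}"])
  have I0: "integral {lo..hi} (\<lambda>x. \<rho> x * A x) = 0"
    by (rule weak[OF test D]) (use out dp(1) in \<open>auto intro: bumps_continuous \<rho>b\<close>)
  have \<rho>0: "(\<rho> has_integral \<eta> hi - \<eta> lo) {lo..hi}"
    by (rule fundamental_theorem_of_calculus)
      (use lo D in \<open>auto simp: has_real_derivative_iff_has_vector_derivative[symmetric] intro: has_field_derivative_at_within\<close>)
  have \<eta>0: "\<eta> hi = 0" "\<eta> lo = 0" using out(1) dp(1) by auto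
  have cont: "continuous_on {lo..hi} (\<lambda>x. \<rho> x * (A x - c))"
    by (intro continuous_on_mult continuous_on_diff continuous_on_const A bumps_continuous[OF \<rho>b])
  \<comment> \<open>Subtracting \<open>c\<close> is free because \<open>\<rho>\<close> has integral
    \<open>\<eta> hi - \<eta> lo = 0\<close>. Each bump sits where \<open>A - c\<close> has the sign
    of its coefficient, so the integrand is nonnegative; with integral zero it must vanish at
    \<open>s\<close>, where it does not.\<close>
  have "integral {lo..hi} (\<lambda>x. \<rho> x * (A x - c)) = integral {lo..hi} (\<lambda>x. \<rho> x * A x) - integral {lo..hi} (\<lambda>x. c * \<rho> x)"
  proof (subst Henstock_Kurzweil_Integration.integral_diff[symmetric])
    show "(\<lambda>x. \<rho> x * A x) integrable_on {lo..hi}" "(\<lambda>x. c * \<rho> x) integrable_on {lo..hi}"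
      by (intro integrable_continuous_real continuous_on_mult continuous_on_const A bumps_continuous[OF \<rho>b])+
  qed (simp add: algebra_simps)
  also have "\<dots> = 0"
    using I0 \<rho>0 \<eta>0 by (simp add: integral_unique)
  finally have zero: "integral {lo..hi} (\<lambda>x. \<rho> x * (A x - c)) = 0" .
  have nonneg: "\<rho> x * (A x - c) \<ge> 0" for x
  proof -
    have "bump d t x * (A x - c) \<ge> 0"
    proof (cases "\<bar>x - t\<bar> < d")
      case True
      then have "c < A x" using d(4)[of x] c dp(3) by (cases "x = t") auto
      then show ?thesis by (simp add: bump_nonneg)
    qed (simp add: bump_zero)
    moreover have "bump d s x * (A x - c) \<le> 0"
    proof (cases "\<bar>x - s\<bar> < d")
      case True
      then have "A x < c" using d(2)[of x] c dp(2) by (cases "x = s") auto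
      then show ?thesis by (simp add: bump_nonneg mult_nonneg_nonpos)
    qed (simp add: bump_zero)
    ultimately show ?thesis by (simp add: \<rho>_def algebra_simps)
  qed
  have "\<rho> s * (A s - c) = 0"
    using zero integral_eq_0_iff[OF cont lo(2)] nonneg st by auto
  moreover have "\<rho> s < 0"
  proof -
    have "bump d t s = 0"
    proof (rule bump_zero, rule ccontr)
      assume "\<not> d \<le> \<bar>s - t\<bar>"
      then have "c < A s" using d(4)[of s] dp(3) lt by (cases "s = t") auto
      then show False using c by simp
    qed
    moreover have "bump d s s > 0" using dp(1) by (simp add: bump_pos)
    ultimately show ?thesis by (simp add: \<rho>_def)
  qed
  ultimately show False using c by simp
qed

lemma LINT_support:
  fixes f :: "real \<Rightarrow> real"
  assumes "0 < lo" "continuous_on {lo..hi} f" "\<And>x. x \<notin> {lo..hi} \<Longrightarrow> f x = 0"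
  shows "(LINT t|lebesgue_on {0<..}. f t) = integral {lo..hi} f"
proof -
  have f: "f absolutely_integrable_on {lo..hi}"
    using absolutely_integrable_continuous_real[OF assms(2)] .
  have "(LINT t|lebesgue_on {0<..}. f t) = (LINT t|lebesgue. indicator {0<..} t *\<^sub>R f t)"
    by (subst integral_restrict_space) auto
  also have "\<dots> = (LINT t|lebesgue. indicator {lo..hi} t *\<^sub>R f t)"
    by (rule Bochner_Integration.integral_cong) (use assms(1,3) in \<open>auto simp: indicator_def\<close>)
  also have "\<dots> = integral {lo..hi} f"
    using set_lebesgue_integral_eq_integral(2)[OF f] by (simp add: set_lebesgue_integral_def)
  finally show ?thesis .
qed

text \<open>On a compact interval around \<open>t\<close> the function \<open>a\<close> minus a
  primitive of \<open>b\<close> has vanishing weak derivative, hence is constant by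
  \<open>weak_constant\<close>. The interval \<open>[t / 2, t + 1]\<close> keeps away from the time
  0, where nothing is assumed.\<close>

theorem du_Bois_Reymond:
  fixes a b :: "real \<Rightarrow> real"
  assumes a: "continuous_on {0<..} a" and b: "continuous_on {0<..} b"
    and weak: "\<And>\<eta>. \<eta> \<in> test_fun {0<..} \<Longrightarrow>
      (LINT t|lebesgue_on {0<..}. deriv \<eta> t * a t) = - (LINT t|lebesgue_on {0<..}. \<eta> t * b t)"
    and t: "t > 0"
  shows "(a has_real_derivative b t) (at t)"
proof -
  define lo hi where "lo = t / 2" and "hi = t + 1"
  have lh: "0 < lo" "lo < hi" "t \<in> {lo<..<hi}" using t by (auto simp: lo_def hi_def)
  have ab: "continuous_on {lo..hi} a" "continuous_on {lo..hi} b"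
    using a b lh by (auto elim!: continuous_on_subset)
  define B where "B x = integral {lo..x} b" for x
  have B: "(B has_real_derivative b x) (at x within {lo..hi})" if "x \<in> {lo..hi}" for x
    unfolding B_def[abs_def] by (rule integral_has_real_derivative[OF ab(2) that])
  then have Bc: "continuous_on {lo..hi} B"
    by (meson DERIV_continuous_on)
  define A where "A x = a x - B x" for x
  have Ac: "continuous_on {lo..hi} A"
    unfolding A_def by (intro continuous_intros ab Bc)
  have weakA: "integral {lo..hi} (\<lambda>x. \<eta>' x * A x) = 0"
    if "\<eta> \<in> test_fun {0<..}" "\<And>x. (\<eta> has_real_derivative \<eta>' x) (at x)"
      "\<And>x. x \<notin> {lo..hi} \<Longrightarrow> \<eta> x = 0" "\<eta> lo = 0" "\<eta> hi = 0" "continuous_on UNIV \<eta>'"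
      "\<And>x. x \<notin> {lo..hi} \<Longrightarrow> \<eta>' x = 0" for \<eta> \<eta>'
  proof -
    have \<eta>': "continuous_on {lo..hi} \<eta>'" using that(6) continuous_on_subset by blast
    have \<eta>c: "continuous_on {lo..hi} \<eta>"
      by (rule DERIV_continuous_on) (use that(2) in \<open>auto intro: has_field_derivative_at_within\<close>)
    have "deriv \<eta> = \<eta>'" using that(2) by (auto intro: DERIV_imp_deriv)
    moreover have "(LINT t|lebesgue_on {0<..}. \<eta>' t * a t) = integral {lo..hi} (\<lambda>x. \<eta>' x * a x)"
      by (rule LINT_support[OF lh(1)]) (use that(7) in \<open>auto intro!: continuous_intros \<eta>' ab\<close>)
    moreover have "(LINT t|lebesgue_on {0<..}. \<eta> t * b t) = integral {lo..hi} (\<lambda>x. \<eta> x * b x)"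
      by (rule LINT_support[OF lh(1)]) (use that(3) in \<open>auto intro!: continuous_intros \<eta>c ab\<close>)
    ultimately have "integral {lo..hi} (\<lambda>x. \<eta>' x * a x) = - integral {lo..hi} (\<lambda>x. \<eta> x * b x)"
      using weak[OF that(1)] by simp
    moreover have "((\<lambda>x. \<eta>' x * B x + \<eta> x * b x) has_integral \<eta> hi * B hi - \<eta> lo * B lo) {lo..hi}"
    proof (rule fundamental_theorem_of_calculus)
      fix x assume x: "x \<in> {lo..hi}"
      show "((\<lambda>x. \<eta> x * B x) has_vector_derivative \<eta>' x * B x + \<eta> x * b x) (at x within {lo..hi})"
        using DERIV_mult[OF has_field_derivative_at_within[OF that(2)[of x]] B[OF x]]
        by (simp add: has_real_derivative_iff_has_vector_derivative[symmetric] algebra_simps)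
    qed (use lh in simp)
    then have "integral {lo..hi} (\<lambda>x. \<eta>' x * B x + \<eta> x * b x) = 0"
      using that(4,5) by (simp add: integral_unique)
    then have "integral {lo..hi} (\<lambda>x. \<eta>' x * B x) + integral {lo..hi} (\<lambda>x. \<eta> x * b x) = 0"
      by (subst (asm) Henstock_Kurzweil_Integration.integral_add)
        (auto intro!: integrable_continuous_real continuous_intros ab \<eta>' \<eta>c Bc)
    moreover have "integral {lo..hi} (\<lambda>x. \<eta>' x * A x) = integral {lo..hi} (\<lambda>x. \<eta>' x * a x) - integral {lo..hi} (\<lambda>x. \<eta>' x * B x)"
      unfolding A_def right_diff_distrib
      by (rule Henstock_Kurzweil_Integration.integral_diff)
        (auto intro!: integrable_continuous_real continuous_intros ab \<eta>' Bc)
    ultimately show ?thesis by simp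
  qed
  have nlt: "\<not> A x < A y" if "x \<in> {lo<..<hi}" "y \<in> {lo<..<hi}" for x y
  proof (rule weak_constant[OF lh(1,2) Ac _ that], goal_cases)
    case (1 \<eta> \<eta>')
    then show ?case by (rule weakA)
  qed
  have const: "A s = A t" if "s \<in> {lo<..<hi}" for s
    using nlt[OF that lh(3)] nlt[OF lh(3) that] by simp
  have "((\<lambda>x. A t + B x) has_real_derivative 0 + b t) (at t within {lo..hi})"
    by (intro DERIV_add DERIV_const B) (use lh in auto)
  moreover have "at t within {lo..hi} = at t"
    by (rule at_within_interior) (use lh(3) in simp)
  ultimately have "((\<lambda>x. A t + B x) has_real_derivative b t) (at t)"
    by simp
  moreover have "eventually (\<lambda>x. x \<in> {lo<..<hi}) (nhds t)"
    using lh(3) by (intro eventually_nhds_in_open) auto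
  then have "eventually (\<lambda>x. A t + B x = a x) (nhds t)"
    by eventually_elim (simp add: const[symmetric], simp add: A_def)
  ultimately show ?thesis
    using DERIV_cong_ev[of t t "\<lambda>x. A t + B x" a "b t" "b t"] by simp
qed

section \<open>The equation in Fourier modes\<close>

lemma trig_lincomb: "\<exists>a b. trig n = (\<lambda>x. a * cosk (fst n) x + b * sink (fst n) x)"
  by (cases "snd n") (rule exI[of _ 1], rule exI[of _ 0], simp add: trig_def, rule exI[of _ 0], rule exI[of _ 1], simp add: trig_def)

lemma lap_L2p: "u \<in> Hp 2 \<Longrightarrow> lap u \<in> L2p"
  unfolding lap_def by (intro L2p_sum Hp_wderiv) auto

lemma coef_lap: "u \<in> Hp 2 \<Longrightarrow> coef (lap u) n = - lam n * coef u n"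
  using lap_trig[of u _ "fst n"] trig_lincomb[of n] by (auto simp: coef_def lam_def)

lemma ip_trig_zero: "fst n \<noteq> fst m \<Longrightarrow> fst n \<noteq> - fst m \<Longrightarrow> ip (trig n) (trig m) = 0"
  by (simp add: trig_def ip_cosk_cosk ip_sink_sink ip_cosk_sink ip_sink_cosk)

text \<open>\<open>lap\<close> is built from chosen weak derivatives and is determined only almost
  everywhere, so it is identified through its coefficients. Two modes that are not orthogonal have
  the same eigenvalue.\<close>

lemma lap_trig_AE: "AE x in lebesgue_on cell. lap (trig n) x = - lam n * trig n x"
proof (rule AE_eq_if_coef_eq)
  show "lap (trig n) \<in> L2p" "(\<lambda>x. - lam n * trig n x) \<in> L2p"
    by (intro lap_L2p Hp_trig, rule L2p_scale[OF L2p_trig])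
  fix m
  have "lam m * ip (trig n) (trig m) = lam n * ip (trig n) (trig m)"
  proof (cases "fst n = fst m \<or> fst n = - fst m")
    case True
    then have "lam m = lam n" by (auto simp: lam_def)
    then show ?thesis by simp
  qed (simp add: ip_trig_zero)
  moreover have "coef (\<lambda>x. - lam n * trig n x) m = - lam n * ip (trig n) (trig m)"
    unfolding coef_def by (rule ip_scale_left)
  ultimately show "coef (lap (trig n)) m = coef (\<lambda>x. - lam n * trig n x) m"
    by (simp add: coef_lap) (simp add: coef_def)
qed

lemma f_nl_Lipschitz:
  assumes "\<bar>x\<bar> \<le> B" "\<bar>y\<bar> \<le> B"
  shows "\<bar>f_nl \<epsilon> x - f_nl \<epsilon> y\<bar> \<le> (3 * B\<^sup>2 + \<bar>1 - \<epsilon>\<bar>) * \<bar>x - y\<bar>"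
proof -
  have "f_nl \<epsilon> x - f_nl \<epsilon> y = (x\<^sup>2 + x * y + y\<^sup>2 + (1 - \<epsilon>)) * (x - y)"
    by (simp add: f_nl_def algebra_simps power2_eq_square power3_eq_cube)
  then have "\<bar>f_nl \<epsilon> x - f_nl \<epsilon> y\<bar> = \<bar>x\<^sup>2 + x * y + y\<^sup>2 + (1 - \<epsilon>)\<bar> * \<bar>x - y\<bar>"
    by (simp add: abs_mult)
  also have "\<dots> \<le> (3 * B\<^sup>2 + \<bar>1 - \<epsilon>\<bar>) * \<bar>x - y\<bar>"
  proof (rule mult_right_mono)
    have "\<bar>x\<bar>\<^sup>2 \<le> B\<^sup>2" "\<bar>y\<bar>\<^sup>2 \<le> B\<^sup>2" using assms by (intro power_mono; simp)+
    moreover have "\<bar>x\<bar> * \<bar>y\<bar> \<le> B * B" using assms by (intro mult_mono) auto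
    moreover have "\<bar>x * y\<bar> = \<bar>x\<bar> * \<bar>y\<bar>" by (rule abs_mult)
    ultimately have "x\<^sup>2 \<le> B\<^sup>2" "y\<^sup>2 \<le> B\<^sup>2" "\<bar>x * y\<bar> \<le> B\<^sup>2"
      unfolding power2_abs power2_eq_square[of B] by auto
    then show "\<bar>x\<^sup>2 + x * y + y\<^sup>2 + (1 - \<epsilon>)\<bar> \<le> 3 * B\<^sup>2 + \<bar>1 - \<epsilon>\<bar>"
      by (smt (verit) zero_le_power2)
  qed simp
  finally show ?thesis .
qed

lemma continuous_on_f_nl [continuous_intros]: "continuous_on S g \<Longrightarrow> continuous_on S (\<lambda>x. f_nl \<epsilon> (g x))"
  unfolding f_nl_def by (intro continuous_intros)

lemma continuous_on_F_nl [continuous_intros]: "continuous_on S g \<Longrightarrow> continuous_on S (\<lambda>x. F_nl \<epsilon> (g x))"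
  unfolding F_nl_def by (intro continuous_intros)

context
  fixes K :: real
  assumes K0: "K > 0"
    and K: "\<forall>F. finite F \<longrightarrow> (\<Sum>n\<in>(F :: 'n::finite mode set). 1 / (1 + (lam n)\<^sup>2)) \<le> K"
begin

lemma f_nl_cont_rep_L2p: "u \<in> Hp 2 \<Longrightarrow> (\<lambda>x. f_nl \<epsilon> (cont_rep (u :: 'n func) x)) \<in> L2p"
  using cont_rep_periodic[of u]
  by (intro L2p_continuous continuous_intros cont_rep_continuous[OF K0 K]) (auto simp: periodic_def)

text \<open>Square integrability of the cubic term is inherited from the continuous
  representative.\<close>

lemma f_nl_comp:
  fixes u :: "'n func"
  assumes u: "u \<in> Hp 2"
  shows "(\<lambda>x. f_nl \<epsilon> (u x)) \<in> L2p"
    and "AE x in lebesgue_on cell. f_nl \<epsilon> (u x) = f_nl \<epsilon> (cont_rep u x)"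
proof -
  show AE: "AE x in lebesgue_on cell. f_nl \<epsilon> (u x) = f_nl \<epsilon> (cont_rep u x)"
    using cont_rep_AE_eq[OF K0 K u] by eventually_elim simp
  have um: "u \<in> borel_measurable lebesgue" "periodic u"
    using L2p_D(1,2)[OF Hp_L2p[OF u]] by auto
  have fm: "(\<lambda>x. f_nl \<epsilon> (u x)) \<in> borel_measurable lebesgue"
    unfolding f_nl_def using um(1) by measurable
  then have "(\<lambda>x. f_nl \<epsilon> (u x)) \<in> borel_measurable (lebesgue_on cell)"
    by (rule measurable_restrict_space1)
  then have "integrable (lebesgue_on cell) (\<lambda>x. (f_nl \<epsilon> (u x))\<^sup>2) \<longleftrightarrow> integrable (lebesgue_on cell) (\<lambda>x. (f_nl \<epsilon> (cont_rep u x))\<^sup>2)"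
    using L2p_D(4)[OF f_nl_cont_rep_L2p[OF u, of \<epsilon>]] AE by (intro integrable_cong_AE) auto
  then show "(\<lambda>x. f_nl \<epsilon> (u x)) \<in> L2p"
    using L2p_D(3)[OF f_nl_cont_rep_L2p[OF u, of \<epsilon>]] fm um(2) by (auto simp: L2p_def periodic_def)
qed

text \<open>\<open>A0_pow\<close> ignores frequency zero, so there the identity comes from the
  \<open>dmean\<close> conjunct of \<open>equation\<close>, and the right side vanishes with
  \<open>lam n\<close>. At the other frequencies the equation is tested with one mode, which removes
  the mean of the nonlinearity, and multiplied by \<open>lam n\<close>.\<close>

lemma equation_mode:
  fixes u :: "'n func"
  assumes u: "u \<in> Hp 2" and v: "v \<in> Hdual 1" and w: "w \<in> Hdual 4"
    and eq: "equation \<beta> \<epsilon> u v w"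
  shows "\<beta> * w (trig n) + v (trig n) =
    - lam n * (((lam n)\<^sup>2 - 2 * lam n) * coef u n + coef (\<lambda>x. f_nl \<epsilon> (cont_rep u x)) n)"
proof (cases "fst n = 0")
  case True
  have "\<beta> * w (trig n) + v (trig n) = 0"
  proof (cases "snd n")
    case True
    then show ?thesis using eq \<open>fst n = 0\<close> by (simp add: equation_def dmean_def trig_def)
  next
    case False
    then show ?thesis
      using \<open>fst n = 0\<close> Hdual_zero_arg[OF v] Hdual_zero_arg[OF w] by (simp add: trig_def)
  qed
  then show ?thesis using True by (simp add: lam_def)
next
  case False
  let ?V = "\<lambda>w'. \<beta> * w w' + v w'"
  let ?f = "\<lambda>x. f_nl \<epsilon> (u x)"
  have "mode_symm (\<lambda>n. ?V (trig n))"
    using Hdual_mode_symm[OF v] Hdual_mode_symm[OF w] by (auto simp: mode_symm_def algebra_simps)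
  then have A: "A0_pow (- 1) ?V (trig n) = ?V (trig n) / lam n"
    using False by (rule A0_pow_minus_1_trig)
  have lap: "emb (lap u) (trig n) = - lam n * coef u n"
    using coef_lap[OF u, of n] by (simp add: emb_def coef_def)
  have "dlap (emb (lap u)) (trig n) = ip (lap (trig n)) (lap u)"
    by (simp add: dlap_def emb_def ip_commute)
  also have "\<dots> = ip (\<lambda>x. - lam n * trig n x) (lap u)"
    by (intro ip_cong_AE lap_trig_AE lap_L2p u Hp_trig L2p_scale L2p_trig)
  also have "\<dots> = - lam n * coef (lap u) n"
    unfolding coef_def ip_commute[of "lap u"] by (rule ip_scale_left)
  finally have lap2: "dlap (emb (lap u)) (trig n) = (lam n)\<^sup>2 * coef u n"
    by (simp add: coef_lap[OF u] power2_eq_square)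
  have one: "ip (\<lambda>x. 1) (trig n) = 0"
    using False mean_cosk[of "fst n"] mean_sink[of "fst n"] by (simp add: ip_def trig_def mean_def)
  have "emb (\<lambda>x. ?f x - mean ?f) (trig n) = ip ?f (trig n) - ip (\<lambda>x. mean ?f * 1) (trig n)"
    unfolding emb_def using ip_diff_left[OF f_nl_comp(1)[OF u, of \<epsilon>] L2p_const L2p_trig, of "mean ?f" n] by simp
  also have "\<dots> = ip ?f (trig n)"
    unfolding ip_scale_left one by simp
  also have "\<dots> = coef (\<lambda>x. f_nl \<epsilon> (cont_rep u x)) n"
    unfolding coef_def by (intro ip_cong_AE f_nl_comp f_nl_cont_rep_L2p u L2p_trig)
  finally have f: "emb (\<lambda>x. ?f x - mean ?f) (trig n) = coef (\<lambda>x. f_nl \<epsilon> (cont_rep u x)) n" .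
  have "A0_pow (- 1) ?V (trig n) + dlap (emb (lap u)) (trig n) + 2 * emb (lap u) (trig n) + emb (\<lambda>x. ?f x - mean ?f) (trig n) = 0"
    using eq[unfolded equation_def, THEN conjunct2, THEN bspec[OF _ Hp_trig]] .
  then have "?V (trig n) / lam n = - ((lam n)\<^sup>2 * coef u n - 2 * lam n * coef u n + coef (\<lambda>x. f_nl \<epsilon> (cont_rep u x)) n)"
    unfolding A lap lap2 f by simp
  moreover have "lam n \<noteq> 0" using lam_ge_1[OF False] by simp
  ultimately have "?V (trig n) = lam n * - ((lam n)\<^sup>2 * coef u n - 2 * lam n * coef u n + coef (\<lambda>x. f_nl \<epsilon> (cont_rep u x)) n)"
    by (simp add: divide_eq_eq mult.commute)
  then show ?thesis by (simp add: algebra_simps)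
qed

end

text \<open>Completeness of Lebesgue measure makes \<open>f\<close> measurable as soon as it agrees
  almost everywhere with \<open>g\<close>. It is applied to the modes of the second time derivative,
  whose measurability is obtained from the equation in this way.\<close>

lemma LINT_cong_AE_lebesgue_on:
  fixes f g :: "real \<Rightarrow> real"
  assumes I: "I \<in> sets lebesgue" and g: "g \<in> borel_measurable (lebesgue_on I)"
    and AE: "AE t in lebesgue_on I. f t = g t"
  shows "(LINT t|lebesgue_on I. f t) = (LINT t|lebesgue_on I. g t)"
proof -
  have eq: "(LINT t|lebesgue_on I. h t) = (LINT t|lebesgue. (if t \<in> I then h t else 0))" for h :: "real \<Rightarrow> real"
    using I by (subst integral_restrict_space) (auto simp: indicator_def intro!: Bochner_Integration.integral_cong)
  have g': "(\<lambda>t. if t \<in> I then g t else 0) \<in> borel_measurable lebesgue"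
    using g I by (simp add: borel_measurable_if)
  have AE': "AE t in lebesgue. (if t \<in> I then g t else 0) = (if t \<in> I then f t else 0)"
  proof -
    have "AE t in lebesgue. t \<in> I \<longrightarrow> f t = g t"
      using AE I by (subst (asm) AE_restrict_space_iff) auto
    then show ?thesis by eventually_elim auto
  qed
  have f': "(\<lambda>t. if t \<in> I then f t else 0) \<in> borel_measurable lebesgue"
    by (rule borel_measurable_AE[OF g' AE'])
  show ?thesis
    unfolding eq by (rule integral_cong_AE[OF f' g']) (use AE' in eventually_elim, simp)
qed

section \<open>The modes of one trajectory as classical solutions of a differential system\<close>

locale trajectory =
  fixes \<beta> \<epsilon> K :: real and z0 :: "'n::finite state" and z :: "real \<Rightarrow> 'n state"
  assumes \<beta>: "\<beta> > 0" and K0: "K > 0"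
    and K: "\<forall>F. finite F \<longrightarrow> (\<Sum>n\<in>(F :: 'n::finite mode set). 1 / (1 + (lam n)\<^sup>2)) \<le> K"
    and z0: "z0 \<in> X0"
    and sol: "energy_solution \<beta> \<epsilon> \<infinity> z0 z"
    and cont: "continuous_in_X0 z"
begin

definition \<phi> :: "real \<Rightarrow> 'n func" where "\<phi> t = fst (z t)"
definition a :: "'n mode \<Rightarrow> real \<Rightarrow> real" where "a n t = coef (\<phi> t) n"
definition b :: "'n mode \<Rightarrow> real \<Rightarrow> real" where "b n t = snd (z t) (trig n)"
definition fc :: "'n mode \<Rightarrow> real \<Rightarrow> real" where "fc n t = coef (\<lambda>x. f_nl \<epsilon> (cont_rep (\<phi> t) x)) n"
text \<open>The derivative of \<open>b\<close> that the equation dictates. It is defined at all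
  times and continuous for nonnegative ones, whereas the second time derivative of the solution is
  given only almost everywhere.\<close>

definition b' :: "'n mode \<Rightarrow> real \<Rightarrow> real" where
  "b' n t = - (b n t + lam n * (((lam n)\<^sup>2 - 2 * lam n) * a n t + fc n t)) / \<beta>"

lemma z_X0: "t \<ge> 0 \<Longrightarrow> \<phi> t \<in> Hp 2" "t \<ge> 0 \<Longrightarrow> snd (z t) \<in> Hdual 1"
  using cont by (auto simp: continuous_in_X0_def X0_def \<phi>_def mem_Times_iff)

lemma intervals: "{t. 0 < t \<and> ereal t < \<infinity>} = {0<..}" "{t. 0 \<le> t \<and> ereal t < \<infinity>} = {0..}"
  by auto

lemmas solution_facts = sol[unfolded energy_solution_def Let_def intervals]

lemma a_continuous: "continuous_on {0..} (a n)"
  using solution_facts Hp_trig[of n 1] unfolding a_def[abs_def] coef_def \<phi>_def emb_def by blast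

lemma b_continuous: "continuous_on {0..} (b n)"
  using solution_facts Hp_trig[of n 4] unfolding b_def[abs_def] by blast

lemma X0norm_ge: "Hnorm 2 (fst y) \<le> X0norm y"
  unfolding X0norm_def by (rule real_le_rsqrt) simp

lemma h2_total_diff_tendsto:
  assumes "t \<ge> 0"
  shows "((\<lambda>s. sqrt (K * h2_total (\<phi> s - \<phi> t))) \<longlongrightarrow> 0) (at t within {0..})"
proof -
  let ?c = "K * (1 + real CARD('n) * real CARD('n))"
  have "((\<lambda>s. X0norm (z s - z t)) \<longlongrightarrow> 0) (at t within {0..})"
    using cont assms by (auto simp: continuous_in_X0_def)
  then have "((\<lambda>s. sqrt (?c * (X0norm (z s - z t))\<^sup>2)) \<longlongrightarrow> sqrt (?c * 0\<^sup>2)) (at t within {0..})"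
    by (intro tendsto_intros)
  then have 0: "((\<lambda>s. sqrt (?c * (X0norm (z s - z t))\<^sup>2)) \<longlongrightarrow> 0) (at t within {0..})" by simp
  have "norm (sqrt (K * h2_total (\<phi> s - \<phi> t))) \<le> sqrt (?c * (X0norm (z s - z t))\<^sup>2)" if "s \<ge> 0" for s
  proof -
    have d: "\<phi> s - \<phi> t \<in> Hp 2"
      using z_X0 assms that by (intro Hp_diff) auto
    have "(Hnorm 2 (\<phi> s - \<phi> t))\<^sup>2 \<le> (X0norm (z s - z t))\<^sup>2"
      using X0norm_ge[of "z s - z t"] by (intro power_mono) (auto simp: \<phi>_def Hnorm_def sum_nonneg)
    then have "h2_total (\<phi> s - \<phi> t) \<le> (1 + real CARD('n) * real CARD('n)) * (X0norm (z s - z t))\<^sup>2"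
      by (intro order_trans[OF h2_total_le_Hnorm[OF d]] mult_left_mono) auto
    then show ?thesis
      using K0 h2_total_nonneg[OF d] by (simp add: mult.assoc)
  qed
  then show ?thesis
    by (intro Lim_null_comparison[OF _ 0]) (auto simp: eventually_at_filter)
qed

text \<open>Closeness in H^2 gives closeness of the continuous representatives in the supremum norm,
  where \<open>f_nl\<close> is Lipschitz on bounded sets.\<close>

lemma fc_continuous: "continuous_on {0..} (fc n)"
  unfolding continuous_on_def
proof
  fix t :: real assume "t \<in> {0..}"
  then have t: "t \<ge> 0" by simp
  let ?w = "\<lambda>s. sqrt (K * h2_total (\<phi> s - \<phi> t))"
  \<comment> \<open>The added 1 leaves room for the representative at time \<open>s\<close>, which
    stays within distance 1 for \<open>s\<close> near \<open>t\<close>.\<close>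
  define B where "B = sqrt (K * h2_total (\<phi> t)) + 1"
  define L where "L = 3 * B\<^sup>2 + \<bar>1 - \<epsilon>\<bar>"
  have L0: "L \<ge> 0" by (simp add: L_def)
  have "eventually (\<lambda>s. ?w s < 1) (at t within {0..})"
    by (rule order_tendstoD(2)[OF h2_total_diff_tendsto[OF t]]) simp
  then have ev: "eventually (\<lambda>s. norm (fc n s - fc n t) \<le> L * ?w s) (at t within {0..})"
    unfolding eventually_at_filter
  proof eventually_elim
    case (elim s)
    show ?case
    proof (intro impI)
      assume s: "s \<noteq> t" "s \<in> {0..}"
      then have w1: "?w s < 1" and s0: "s \<ge> 0" using elim by auto
      have d: "\<bar>cont_rep (\<phi> s) x - cont_rep (\<phi> t) x\<bar> \<le> ?w s" for x
        by (rule cont_rep_diff_le[OF K0 K z_X0(1)[OF s0] z_X0(1)[OF t]])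
      have B: "\<bar>cont_rep (\<phi> t) x\<bar> \<le> B - 1" for x
        using cont_rep_abs_le[OF K0 K z_X0(1)[OF t], of x] by (simp add: B_def)
      have B': "\<bar>cont_rep (\<phi> t) x\<bar> \<le> B" "\<bar>cont_rep (\<phi> s) x\<bar> \<le> B" for x
        using B[of x] d[of x] w1 by linarith+
      have "\<bar>f_nl \<epsilon> (cont_rep (\<phi> s) x) - f_nl \<epsilon> (cont_rep (\<phi> t) x)\<bar> \<le> L * ?w s" for x
        unfolding L_def
        by (rule order_trans[OF f_nl_Lipschitz[OF B'(2) B'(1)] mult_left_mono[OF d]]) simp
      then show "norm (fc n s - fc n t) \<le> L * ?w s"
        unfolding fc_def coef_def real_norm_def
        by (intro bounded_diff_ip f_nl_cont_rep_L2p[OF K0 K] z_X0 s0 t trig_abs_le L2p_trig)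
    qed
  qed
  have "((\<lambda>s. L * ?w s) \<longlongrightarrow> L * 0) (at t within {0..})"
    by (intro tendsto_intros h2_total_diff_tendsto t)
  then have "((\<lambda>s. fc n s - fc n t) \<longlongrightarrow> 0) (at t within {0..})"
    by (intro Lim_null_comparison[OF ev]) simp
  then show "(fc n \<longlongrightarrow> fc n t) (at t within {0..})"
    by (simp add: Lim_null[symmetric])
qed

lemma b'_continuous: "continuous_on {0..} (b' n)"
  unfolding b'_def[abs_def]
  using \<beta> by (intro continuous_intros b_continuous a_continuous fc_continuous) auto

lemma a_derivative: "t > 0 \<Longrightarrow> (a n has_real_derivative b n t) (at t)"
proof (rule du_Bois_Reymond)
  show "continuous_on {0<..} (a n)" "continuous_on {0<..} (b n)"
    by (rule continuous_on_subset[OF a_continuous] continuous_on_subset[OF b_continuous], force)+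
  show "(LINT t|lebesgue_on {0<..}. deriv \<eta> t * a n t) = - (LINT t|lebesgue_on {0<..}. \<eta> t * b n t)"
    if "\<eta> \<in> test_fun {0<..}" for \<eta>
    using solution_facts that Hp_trig[of n 1] unfolding has_time_deriv_def a_def b_def coef_def \<phi>_def emb_def by blast
qed

lemma test_fun_continuous: "\<eta> \<in> test_fun I \<Longrightarrow> continuous_on S \<eta>"
  by (intro continuous_at_imp_continuous_on ballI differentiable_imp_continuous_within)
    (auto simp: test_fun_def dest!: spec[of _ "0::nat"])

text \<open>The weak derivative of \<open>b n\<close> is the mode of the second time derivative,
  which the equation identifies almost everywhere with the continuous \<open>b' n\<close>; this is
  what the lemma of du Bois-Reymond asks for.\<close>

lemma b_derivative: "t > 0 \<Longrightarrow> (b n has_real_derivative b' n t) (at t)"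
proof (rule du_Bois_Reymond)
  show "continuous_on {0<..} (b n)" and b'c: "continuous_on {0<..} (b' n)"
    by (rule continuous_on_subset[OF b_continuous] continuous_on_subset[OF b'_continuous], force)+
  fix \<eta> :: "real \<Rightarrow> real" assume \<eta>: "\<eta> \<in> test_fun {0<..}"
  obtain w where w: "Linfty {0<..} (Hdual 4) (dual_norm 4) w" "has_time_deriv {0<..} 4 (\<lambda>t. snd (z t)) w"
    "AE t in lebesgue_on {0<..}. equation \<beta> \<epsilon> (fst (z t)) (snd (z t)) (w t)"
    using solution_facts by blast
  have "AE t in lebesgue_on {0<..}. w t \<in> Hdual 4"
    using w(1) by (simp add: Linfty_def)
  moreover have "AE t in lebesgue_on {0<..}. t \<in> {0<..}"
    by (rule AE_I2) simp
  ultimately have "AE t in lebesgue_on {0<..}. w t (trig n) = b' n t"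
    using w(3)
  proof eventually_elim
    case (elim t)
    then have "\<beta> * w t (trig n) + b n t = - lam n * (((lam n)\<^sup>2 - 2 * lam n) * a n t + fc n t)"
      using equation_mode[OF K0 K, of "\<phi> t" "snd (z t)" "w t" \<beta> \<epsilon> n] z_X0[of t]
      by (simp add: a_def b_def fc_def \<phi>_def)
    then have "\<beta> * w t (trig n) = \<beta> * b' n t" using \<beta> by (simp add: b'_def)
    then show ?case using \<beta> by simp
  qed
  then have AE: "AE t in lebesgue_on {0<..}. \<eta> t * w t (trig n) = \<eta> t * b' n t"
    by eventually_elim simp
  have "(LINT t|lebesgue_on {0<..}. deriv \<eta> t * b n t) = - (LINT t|lebesgue_on {0<..}. \<eta> t * w t (trig n))"
    using w(2) \<eta> Hp_trig[of n 4] unfolding has_time_deriv_def b_def by blast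
  also have "(LINT t|lebesgue_on {0<..}. \<eta> t * w t (trig n)) = (LINT t|lebesgue_on {0<..}. \<eta> t * b' n t)"
  proof (rule LINT_cong_AE_lebesgue_on[OF _ _ AE])
    show "(\<lambda>t. \<eta> t * b' n t) \<in> borel_measurable (lebesgue_on {0<..})"
      by (intro continuous_imp_measurable_on_sets_lebesgue continuous_intros test_fun_continuous[OF \<eta>] b'c) simp
  qed simp
  finally show "(LINT t|lebesgue_on {0<..}. deriv \<eta> t * b n t) = - (LINT t|lebesgue_on {0<..}. \<eta> t * b' n t)" .
qed

lemma initial: "a n 0 = coef (fst z0) n" "b n 0 = snd z0 (trig n)"
proof -
  have "AE x in lebesgue. fst (z 0) x = fst z0 x"
    using solution_facts by blast
  then have "AE x in lebesgue_on cell. fst (z 0) x = fst z0 x"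
    by (subst AE_restrict_space_iff) (auto simp: fmeasurableD)
  then show "a n 0 = coef (fst z0) n"
    unfolding a_def coef_def \<phi>_def
    using z_X0(1)[of 0] z0 by (intro ip_cong_AE) (auto simp: X0_def \<phi>_def intro: Hp_L2p)
  show "b n 0 = snd z0 (trig n)"
    using solution_facts Hp_trig[of n 1] unfolding b_def by blast
qed

lemma bounded_AE: "\<exists>C. AE t in lebesgue_on {0<..}. X0norm (z t) \<le> C"
  using solution_facts unfolding Linfty_def by blast

end

section \<open>The nonlinearity on trigonometric sums\<close>

text \<open>Integration by parts against a smooth function with one continuous directional
  derivative of \<open>h\<close>. It covers \<open>f_nl\<close> applied to a trigonometric sum
  without establishing that all higher derivatives exist.\<close>

lemma C1_weak_deriv:
  fixes h h' :: "'n::finite func"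
  assumes h: "continuous_on UNIV h" "periodic h" and h': "continuous_on UNIV h'"
    and d: "\<And>x. ((\<lambda>s. h (x + s *\<^sub>R axis i 1)) has_real_derivative h' x) (at 0)"
  shows "has_weak_deriv [i] h h'" and "periodic h'"
proof -
  show per: "periodic h'"
    unfolding periodic_def
  proof (intro allI)
    fix x j
    have "h ((x + axis j 1) + s *\<^sub>R axis i 1) = h (x + s *\<^sub>R axis i 1)" for s
      using h(2)[unfolded periodic_def, rule_format, of "x + s *\<^sub>R axis i 1" j] by (simp add: algebra_simps)
    then show "h' (x + axis j 1) = h' x"
      using d[of "x + axis j 1"] d[of x] by (auto intro: DERIV_unique)
  qed
  show "has_weak_deriv [i] h h'"
    unfolding has_weak_deriv_def
  proof
    fix \<psi> :: "'n func" assume \<psi>: "\<psi> \<in> smooth_periodic"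
    note c = smooth_continuous[OF \<psi>] smooth_continuous[OF smooth_pderiv_dir[OF \<psi>]]
    have "(LINT x|lebesgue_on cell. h' x * \<psi> x + h x * pderiv_dir i \<psi> x) = 0"
    proof (rule integral_periodic_derivative[of "\<lambda>x. h x * \<psi> x"])
      show "periodic (\<lambda>x. h x * \<psi> x)"
        using h \<psi> by (auto simp: smooth_periodic_def periodic_def)
      show "((\<lambda>s. h (x + s *\<^sub>R axis i 1) * \<psi> (x + s *\<^sub>R axis i 1)) has_real_derivative
        h' x * \<psi> x + h x * pderiv_dir i \<psi> x) (at 0)" for x
        using DERIV_mult[OF d[of x] pderiv_dir_has_derivative[OF \<psi>, of x i]] by (simp add: algebra_simps)
    qed (intro continuous_intros c h h')+
    then have "ip h' \<psi> + ip h (pderiv_dir i \<psi>) = 0"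
      using smooth_L2p[OF \<psi>] smooth_L2p[OF smooth_pderiv_dir[OF \<psi>]] L2p_continuous[OF h] L2p_continuous[OF h' per]
      by (simp add: ip_def L2p_mult_integrable)
    then show "ip h (pderivs [i] \<psi>) = (- 1) ^ length [i] * ip h' \<psi>"
      by (simp add: pderivs_def)
  qed
qed

lemma sum_wave: "(\<Sum>i\<in>UNIV. (wave [i] k)\<^sup>2) = eigval k"
  by (simp add: wave_def eigval_def power_mult_distrib sum_distrib_left)

text \<open>Cosine and sine of a frequency are taken together, as in \<open>coef_sq\<close>, and the
  squared symbols of the first derivatives add up to \<open>eigval\<close>.\<close>

lemma sum_grad_coef:
  assumes "\<And>i. has_weak_deriv [i] h (h' i)" "h \<in> L2p" "\<And>i. h' i \<in> L2p"
  shows "(\<Sum>i\<in>UNIV. \<Sum>n\<in>Modes N. (coef (h' i) n)\<^sup>2) = (\<Sum>n\<in>Modes N. lam n * (coef h n)\<^sup>2)"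
proof -
  have "(\<Sum>n\<in>Modes N. (coef (h' i) n)\<^sup>2) = (\<Sum>n\<in>Modes N. (wave [i] (fst n))\<^sup>2 * (coef h n)\<^sup>2)" for i
    using sum_Modes_sq[of "\<lambda>_. 1" "h' i" N] sum_Modes_sq[of "\<lambda>k. (wave [i] k)\<^sup>2" h N]
    by (simp add: coef_sq_weak_deriv[OF assms(1,2,3)])
  then have "(\<Sum>i\<in>UNIV. \<Sum>n\<in>Modes N. (coef (h' i) n)\<^sup>2) = (\<Sum>n\<in>Modes N. \<Sum>i\<in>UNIV. (wave [i] (fst n))\<^sup>2 * (coef h n)\<^sup>2)"
    by (simp add: sum.swap[of _ UNIV])
  then show ?thesis
    by (simp add: sum_distrib_right[symmetric] sum_wave lam_def)
qed

lemma grad_Bessel: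
  assumes "\<And>i. has_weak_deriv [i] h (h' i)" "h \<in> L2p" "\<And>i. h' i \<in> L2p"
  shows "(\<Sum>n\<in>Modes N. lam n * (coef h n)\<^sup>2) \<le> (\<Sum>i\<in>UNIV. ip (h' i) (h' i))"
  unfolding sum_grad_coef[OF assms, symmetric] by (intro sum_mono Bessel assms)

definition dsum :: "'n::finite \<Rightarrow> nat \<Rightarrow> ('n mode \<Rightarrow> real) \<Rightarrow> 'n func" where
  "dsum i N d x = (\<Sum>n\<in>Modes N. d n * pderiv_dir i (trig n) x)"

lemma dsum_continuous: "continuous_on UNIV (dsum i N d)"
  unfolding dsum_def[abs_def]
  by (intro continuous_intros smooth_continuous smooth_pderiv_dir smooth_trig)

lemma dsum_derivative: "((\<lambda>s. tsum N d (x + s *\<^sub>R axis i 1)) has_real_derivative dsum i N d x) (at 0)"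
  unfolding tsum_def dsum_def
  by (intro DERIV_sum DERIV_cmult pderiv_dir_has_derivative smooth_trig)

lemma dsum_weak: "has_weak_deriv [i] (tsum N d) (dsum i N d)"
  by (rule C1_weak_deriv[OF continuous_on_tsum periodic_tsum dsum_continuous dsum_derivative])

lemma dsum_L2p: "dsum i N d \<in> L2p"
  by (intro L2p_continuous dsum_continuous
      C1_weak_deriv(2)[OF continuous_on_tsum periodic_tsum dsum_continuous dsum_derivative])

text \<open>By Parseval the left side is a limit of coefficient sums, each of which
  \<open>sum_grad_coef\<close> evaluates in terms of the coefficients of the finite sum.\<close>

lemma sum_ip_dsum_le:
  assumes d: "mode_symm (d :: 'n::finite mode \<Rightarrow> real)"
  shows "(\<Sum>i\<in>UNIV. ip (dsum i M d) (dsum i M d)) \<le> (\<Sum>n\<in>Modes M. lam n * (d n)\<^sup>2)"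
proof (rule LIMSEQ_le_const2)
  show "(\<lambda>N. \<Sum>i\<in>UNIV. \<Sum>n\<in>Modes N. (coef (dsum i M d) n)\<^sup>2) \<longlonglongrightarrow> (\<Sum>i\<in>UNIV. ip (dsum i M d) (dsum i M d))"
    by (intro tendsto_sum Parseval dsum_L2p)
  have "(\<Sum>i\<in>UNIV. \<Sum>n\<in>Modes N. (coef (dsum i M d) n)\<^sup>2) \<le> (\<Sum>n\<in>Modes M. lam n * (d n)\<^sup>2)" for N
  proof -
    have "(\<Sum>i\<in>UNIV. \<Sum>n\<in>Modes N. (coef (dsum i M d) n)\<^sup>2) = (\<Sum>n\<in>Modes N. lam n * (coef (tsum M d) n)\<^sup>2)"
      by (rule sum_grad_coef[OF dsum_weak L2p_tsum dsum_L2p])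
    also have "\<dots> = (\<Sum>n\<in>Modes N. if n \<in> Modes M then lam n * (d n)\<^sup>2 else 0)"
      by (rule sum.cong) (auto simp: coef_tsum[OF d])
    also have "\<dots> = (\<Sum>n\<in>Modes N \<inter> Modes M. lam n * (d n)\<^sup>2)"
      by (rule sum.inter_restrict[symmetric]) simp
    also have "\<dots> \<le> (\<Sum>n\<in>Modes M. lam n * (d n)\<^sup>2)"
      by (intro sum_mono2) (auto simp: lam_nonneg)
    finally show ?thesis .
  qed
  then show "\<exists>N. \<forall>n\<ge>N. (\<Sum>i\<in>UNIV. \<Sum>n\<in>Modes n. (coef (dsum i M d) n)\<^sup>2) \<le> (\<Sum>n\<in>Modes M. lam n * (d n)\<^sup>2)"
    by blast
qed

lemma f_nl_has_derivative: "(f_nl \<epsilon> has_real_derivative 3 * s\<^sup>2 + (1 - \<epsilon>)) (at s)"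
  unfolding f_nl_def[abs_def] by (auto intro!: derivative_eq_intros)

lemma f_nl_tsum_derivative:
  "((\<lambda>s. f_nl \<epsilon> (tsum N d (x + s *\<^sub>R axis i 1))) has_real_derivative
    (3 * (tsum N d x)\<^sup>2 + (1 - \<epsilon>)) * dsum i N d x) (at 0)"
proof -
  have "(f_nl \<epsilon> has_real_derivative 3 * (tsum N d x)\<^sup>2 + (1 - \<epsilon>)) (at (tsum N d (x + 0 *\<^sub>R axis i 1)))"
    using f_nl_has_derivative by simp
  from DERIV_chain2[where g = "\<lambda>s. tsum N d (x + s *\<^sub>R axis i 1)", OF this dsum_derivative]
  show ?thesis .
qed

lemma f_nl_tsum_L2p: "(\<lambda>x. f_nl \<epsilon> (tsum N d x)) \<in> L2p"
  using periodic_tsum[of N d] by (intro L2p_continuous continuous_intros) (auto simp: periodic_def)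

context
  fixes K :: real
  assumes K0: "K > 0"
    and K: "\<forall>F. finite F \<longrightarrow> (\<Sum>n\<in>(F :: 'n::finite mode set). 1 / (1 + (lam n)\<^sup>2)) \<le> K"
begin

lemma lam_le_weight: "lam n \<le> 1 + (lam n)\<^sup>2"
  using sum_squares_bound[of 1 "lam n"] lam_nonneg[of n] by simp

text \<open>The gradient of the difference is bounded by the H^2 tail beyond \<open>N\<close>, with
  a constant depending only on \<open>Q\<close>. Comparing two finite sums keeps every function
  continuously differentiable, and the bound is uniform in \<open>M\<close>.\<close>

lemma f_nl_tsum_diff:
  fixes u :: "'n func"
  assumes u: "u \<in> Hp 2" and Q: "h2_total u \<le> Q" and NM: "N \<le> M"
  shows "(\<Sum>n\<in>Modes N. lam n * (coef (\<lambda>x. f_nl \<epsilon> (tsum M (coef u) x)) n - coef (\<lambda>x. f_nl \<epsilon> (tsum N (coef u) x)) n)\<^sup>2)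
    \<le> (2 * (3 * (K * Q) + \<bar>1 - \<epsilon>\<bar>)\<^sup>2 + 72 * K\<^sup>2 * Q\<^sup>2) * (h2_total u - h2_upto N u)"
proof -
  let ?p = "\<lambda>N. tsum N (coef u)"
  let ?D = "\<lambda>i N. dsum i N (coef u)"
  define T where "T = h2_total u - h2_upto N u"
  define L where "L = 3 * (K * Q) + \<bar>1 - \<epsilon>\<bar>"
  define h where "h x = f_nl \<epsilon> (?p M x) - f_nl \<epsilon> (?p N x)" for x
  define h' where "h' i x = (3 * (?p M x)\<^sup>2 + (1 - \<epsilon>)) * ?D i M x - (3 * (?p N x)\<^sup>2 + (1 - \<epsilon>)) * ?D i N x" for i x
  \<comment> \<open>The coefficients of \<open>?p M - ?p N\<close>. Symmetry survives because
    \<open>Modes N\<close> contains \<open>- k\<close> along with \<open>k\<close>.\<close>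
  define e where "e n = (if n \<in> Modes N then 0 else coef u n)" for n
  have T0: "T \<ge> 0" using h2_upto_le_total[OF u] by (simp add: T_def)
  have Q0: "Q \<ge> 0" using h2_total_nonneg[OF u] Q by simp
  have e: "mode_symm e"
    using mode_symm_coef[of u] by (auto simp: mode_symm_def e_def Modes_iff)
  have diff: "(\<Sum>n\<in>Modes M. coef u n * g n) - (\<Sum>n\<in>Modes N. coef u n * g n) = (\<Sum>n\<in>Modes M. e n * g n)" for g
  proof -
    have "(\<Sum>n\<in>Modes M. e n * g n) = (\<Sum>n\<in>Modes M - Modes N. coef u n * g n)"
      by (intro sum.mono_neutral_cong_right) (auto simp: e_def)
    then show ?thesis using sum_diff[OF finite_Modes Modes_mono[OF NM], of "\<lambda>n. coef u n * g n"] by simp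
  qed
  have hc: "continuous_on UNIV h"
    unfolding h_def by (intro continuous_intros)
  have hp: "periodic h"
    using periodic_tsum[of M "coef u"] periodic_tsum[of N "coef u"] by (auto simp: h_def periodic_def)
  have h'c: "continuous_on UNIV (h' i)" for i
    unfolding h'_def by (intro continuous_intros dsum_continuous)
  have d: "((\<lambda>s. h (x + s *\<^sub>R axis i 1)) has_real_derivative h' i x) (at 0)" for i x
    unfolding h_def h'_def by (intro DERIV_diff f_nl_tsum_derivative)
  note W = C1_weak_deriv[OF hc hp h'c d]
  have h'L: "h' i \<in> L2p" for i
    by (intro L2p_continuous h'c W(2))
  have coefh: "coef h n = coef (\<lambda>x. f_nl \<epsilon> (?p M x)) n - coef (\<lambda>x. f_nl \<epsilon> (?p N x)) n" for n
    unfolding coef_def h_def by (intro ip_diff_left f_nl_tsum_L2p L2p_trig)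
  have pb: "\<bar>?p N' x\<bar> \<le> sqrt (K * Q)" for N' x
    using tsum_abs_le[OF K0 K u, of N' x] mult_left_mono[OF Q, of K] K0
    by (auto intro: order_trans simp: less_imp_le)
  have psq: "(?p N' x)\<^sup>2 \<le> K * Q" for N' x
    using power_mono[OF pb[of N' x], of 2] K0 Q0 by simp
  have pd: "(?p M x - ?p N x)\<^sup>2 \<le> K * T" for x
    using power_mono[OF tsum_diff_le[OF K0 K u NM, of x], of 2] K0 T0 by (simp add: T_def)
  have ptw: "(h' i x)\<^sup>2 \<le> 2 * L\<^sup>2 * (dsum i M e x)\<^sup>2 + 72 * K\<^sup>2 * Q * T * (?D i N x)\<^sup>2" for i x
  proof -
    have dd: "?D i M x - ?D i N x = dsum i M e x"
      unfolding dsum_def by (rule diff)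
    \<comment> \<open>The split is \<open>f'(p) * (Dp - Dq) + (f'(p) - f'(q)) * Dq\<close> with
      \<open>f'(p) - f'(q) = 3 * (p + q) * (p - q)\<close>. Both summands contain a factor
      controlled by the tail; 72 arises as \<open>2 * 9 * 4\<close>.\<close>
    have 1: "h' i x = (3 * (?p M x)\<^sup>2 + (1 - \<epsilon>)) * dsum i M e x + 3 * (?p M x + ?p N x) * (?p M x - ?p N x) * ?D i N x"
      unfolding h'_def dd[symmetric] by (simp add: algebra_simps power2_eq_square)
    have "\<bar>3 * (?p M x)\<^sup>2 + (1 - \<epsilon>)\<bar> \<le> L"
      using psq[of M x] zero_le_power2[of "?p M x"] unfolding L_def by linarith
    then have a1: "(3 * (?p M x)\<^sup>2 + (1 - \<epsilon>))\<^sup>2 \<le> L\<^sup>2"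
      by (metis abs_ge_zero power2_abs power_mono)
    have a2: "(?p M x + ?p N x)\<^sup>2 \<le> 4 * (K * Q)"
      using power2_sum_le[of "?p M x" "?p N x"] psq[of M x] psq[of N x] by linarith
    have "(h' i x)\<^sup>2 \<le> 2 * ((3 * (?p M x)\<^sup>2 + (1 - \<epsilon>)) * dsum i M e x)\<^sup>2 + 2 * (3 * (?p M x + ?p N x) * (?p M x - ?p N x) * ?D i N x)\<^sup>2"
      unfolding 1 by (rule power2_sum_le)
    also have "\<dots> = 2 * ((3 * (?p M x)\<^sup>2 + (1 - \<epsilon>))\<^sup>2 * (dsum i M e x)\<^sup>2) + 18 * (((?p M x + ?p N x)\<^sup>2 * (?p M x - ?p N x)\<^sup>2) * (?D i N x)\<^sup>2)"
      by (simp only: power_mult_distrib) simp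
    also have "\<dots> \<le> 2 * (L\<^sup>2 * (dsum i M e x)\<^sup>2) + 18 * ((4 * (K * Q) * (K * T)) * (?D i N x)\<^sup>2)"
      using K0 Q0 by (intro add_mono mult_left_mono mult_right_mono mult_mono a1 a2 pd) auto
    finally show ?thesis by (simp add: power2_eq_square algebra_simps)
  qed
  have int: "ip (h' i) (h' i) \<le> 2 * L\<^sup>2 * ip (dsum i M e) (dsum i M e) + 72 * K\<^sup>2 * Q * T * ip (?D i N) (?D i N)" for i
  proof -
    have "ip (h' i) (h' i) \<le> (LINT x|lebesgue_on cell. 2 * L\<^sup>2 * (dsum i M e x)\<^sup>2 + 72 * K\<^sup>2 * Q * T * (?D i N x)\<^sup>2)"
      unfolding ip_def power2_eq_square[symmetric]
      by (rule integral_mono)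
        (rule ptw L2p_D(3)[OF h'L] Bochner_Integration.integrable_add integrable_mult_right L2p_D(3)[OF dsum_L2p])+
    also have "\<dots> = 2 * L\<^sup>2 * ip (dsum i M e) (dsum i M e) + 72 * K\<^sup>2 * Q * T * ip (?D i N) (?D i N)"
      unfolding ip_def power2_eq_square[symmetric]
      by (subst Bochner_Integration.integral_add)
        (intro integrable_mult_right L2p_D(3) dsum_L2p, intro integrable_mult_right L2p_D(3) dsum_L2p, simp)
    finally show ?thesis .
  qed
  have s1: "(\<Sum>i\<in>UNIV. ip (dsum i M e) (dsum i M e)) \<le> T"
  proof -
    have "(\<Sum>i\<in>UNIV. ip (dsum i M e) (dsum i M e)) \<le> (\<Sum>n\<in>Modes M. lam n * (e n)\<^sup>2)"
      by (rule sum_ip_dsum_le[OF e])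
    also have "\<dots> = (\<Sum>n\<in>Modes M - Modes N. lam n * (coef u n)\<^sup>2)"
      by (intro sum.mono_neutral_cong_right) (auto simp: e_def)
    also have "\<dots> \<le> (\<Sum>n\<in>Modes M - Modes N. (1 + (lam n)\<^sup>2) * (coef u n)\<^sup>2)"
      by (intro sum_mono mult_right_mono lam_le_weight) auto
    also have "\<dots> \<le> T"
      unfolding T_def by (rule sum_tail_le[OF u]) auto
    finally show ?thesis .
  qed
  have s2: "(\<Sum>i\<in>UNIV. ip (?D i N) (?D i N)) \<le> Q"
  proof -
    have "(\<Sum>i\<in>UNIV. ip (?D i N) (?D i N)) \<le> (\<Sum>n\<in>Modes N. lam n * (coef u n)\<^sup>2)"
      by (rule sum_ip_dsum_le[OF mode_symm_coef])
    also have "\<dots> \<le> h2_upto N u"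
      unfolding h2_upto_def by (intro sum_mono mult_right_mono lam_le_weight) auto
    finally show ?thesis using h2_upto_le_total[OF u, of N] Q by simp
  qed
  have "(\<Sum>n\<in>Modes N. lam n * (coef h n)\<^sup>2) \<le> (\<Sum>i\<in>UNIV. ip (h' i) (h' i))"
    by (rule grad_Bessel[OF W(1) L2p_continuous[OF hc hp] h'L])
  also have "\<dots> \<le> (\<Sum>i\<in>UNIV. 2 * L\<^sup>2 * ip (dsum i M e) (dsum i M e) + 72 * K\<^sup>2 * Q * T * ip (?D i N) (?D i N))"
    by (intro sum_mono int)
  also have "\<dots> = 2 * L\<^sup>2 * (\<Sum>i\<in>UNIV. ip (dsum i M e) (dsum i M e)) + 72 * K\<^sup>2 * Q * T * (\<Sum>i\<in>UNIV. ip (?D i N) (?D i N))"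
    by (simp add: sum.distrib sum_distrib_left)
  also have "\<dots> \<le> 2 * L\<^sup>2 * T + 72 * K\<^sup>2 * Q * T * Q"
    using Q0 T0 by (intro add_mono mult_left_mono s1 s2) auto
  also have "\<dots> = (2 * L\<^sup>2 + 72 * K\<^sup>2 * Q\<^sup>2) * T"
    by (simp add: power2_eq_square algebra_simps)
  finally show ?thesis
    unfolding coefh T_def L_def .
qed

lemma f_nl_tsum_tendsto:
  fixes u :: "'n func"
  assumes u: "u \<in> Hp 2"
  shows "(\<lambda>M. coef (\<lambda>x. f_nl \<epsilon> (tsum M (coef u) x)) n) \<longlonglongrightarrow> coef (\<lambda>x. f_nl \<epsilon> (cont_rep u x)) n"
proof -
  define B where "B = sqrt (K * h2_total u)"
  define L where "L = 3 * B\<^sup>2 + \<bar>1 - \<epsilon>\<bar>"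
  let ?w = "\<lambda>M. sqrt (K * (h2_total u - h2_upto M u))"
  have "\<bar>f_nl \<epsilon> (tsum M (coef u) x) - f_nl \<epsilon> (cont_rep u x)\<bar> \<le> L * ?w M" for M x
  proof -
    have "\<bar>f_nl \<epsilon> (tsum M (coef u) x) - f_nl \<epsilon> (cont_rep u x)\<bar> \<le> L * \<bar>tsum M (coef u) x - cont_rep u x\<bar>"
      unfolding L_def using tsum_abs_le[OF K0 K u] cont_rep_abs_le[OF K0 K u]
      by (intro f_nl_Lipschitz) (auto simp: B_def)
    also have "\<dots> \<le> L * ?w M"
      using cont_rep_tsum_le[OF K0 K u, of x M] by (intro mult_left_mono) (auto simp: L_def abs_minus_commute)
    finally show ?thesis .
  qed
  then have bd: "norm (coef (\<lambda>x. f_nl \<epsilon> (tsum M (coef u) x)) n - coef (\<lambda>x. f_nl \<epsilon> (cont_rep u x)) n) \<le> L * ?w M" for M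
    unfolding coef_def real_norm_def
    by (intro bounded_diff_ip f_nl_tsum_L2p f_nl_cont_rep_L2p[OF K0 K] u trig_abs_le L2p_trig)
  have "(\<lambda>M. L * ?w M) \<longlonglongrightarrow> L * 0"
    by (intro tendsto_mult tendsto_const tail_tendsto_0[OF K0 K u])
  then have "(\<lambda>M. L * ?w M) \<longlonglongrightarrow> 0" by simp
  then have "(\<lambda>M. coef (\<lambda>x. f_nl \<epsilon> (tsum M (coef u) x)) n - coef (\<lambda>x. f_nl \<epsilon> (cont_rep u x)) n) \<longlonglongrightarrow> 0"
    by (rule Lim_null_comparison[OF always_eventually[OF allI[OF bd]]])
  then show ?thesis by (simp add: Lim_null[symmetric])
qed

text \<open>Limit \<open>M \<rightarrow> \<infinity>\<close> in \<open>f_nl_tsum_diff\<close>: the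
  sum over \<open>Modes N\<close> is finite, so convergence of each coefficient is enough.\<close>

lemma f_nl_tsum_error:
  fixes u :: "'n func"
  assumes u: "u \<in> Hp 2" and Q: "h2_total u \<le> Q"
  shows "(\<Sum>n\<in>Modes N. lam n * (coef (\<lambda>x. f_nl \<epsilon> (tsum N (coef u) x)) n - coef (\<lambda>x. f_nl \<epsilon> (cont_rep u x)) n)\<^sup>2)
    \<le> (2 * (3 * (K * Q) + \<bar>1 - \<epsilon>\<bar>)\<^sup>2 + 72 * K\<^sup>2 * Q\<^sup>2) * (h2_total u - h2_upto N u)"
proof -
  let ?f = "\<lambda>M n. coef (\<lambda>x. f_nl \<epsilon> (tsum M (coef u) x)) n"
  let ?g = "\<lambda>n. coef (\<lambda>x. f_nl \<epsilon> (cont_rep u x)) n"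
  have "(\<lambda>M. \<Sum>n\<in>Modes N. lam n * (?f M n - ?f N n)\<^sup>2) \<longlonglongrightarrow> (\<Sum>n\<in>Modes N. lam n * (?g n - ?f N n)\<^sup>2)"
    by (intro tendsto_intros f_nl_tsum_tendsto u)
  then have "(\<Sum>n\<in>Modes N. lam n * (?g n - ?f N n)\<^sup>2)
    \<le> (2 * (3 * (K * Q) + \<bar>1 - \<epsilon>\<bar>)\<^sup>2 + 72 * K\<^sup>2 * Q\<^sup>2) * (h2_total u - h2_upto N u)"
    by (rule LIMSEQ_le_const2) (use f_nl_tsum_diff[OF u Q] in blast)
  then show ?thesis
    by (simp only: power2_commute[of "coef (\<lambda>x. f_nl \<epsilon> (cont_rep u x)) _"])
qed

end

section \<open>Pointwise bounds for the nonlinearity\<close>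

lemma square_le_quartic: "\<eta> > 0 \<Longrightarrow> c * s\<^sup>2 \<le> \<eta> * s ^ 4 + c\<^sup>2 / (4 * \<eta>)" for s c \<eta> :: real
proof -
  assume \<eta>: "\<eta> > 0"
  have "0 \<le> \<eta> * (s\<^sup>2 - c / (2 * \<eta>))\<^sup>2" using \<eta> by simp
  also have "\<dots> = \<eta> * s ^ 4 - c * s\<^sup>2 + c\<^sup>2 / (4 * \<eta>)"
    using \<eta> by (simp add: power2_eq_square power4_eq_xxxx field_simps)
  finally show ?thesis by simp
qed

lemma cube_le_quartic: "\<eta> > 0 \<Longrightarrow> \<bar>s\<bar> ^ 3 \<le> \<eta> * s ^ 4 + 1 / (4 * \<eta>) * s\<^sup>2" for s \<eta> :: real
proof -
  assume \<eta>: "\<eta> > 0"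
  have "0 \<le> \<eta> * (\<bar>s\<bar> * (\<bar>s\<bar> - 1 / (2 * \<eta>)))\<^sup>2" using \<eta> by simp
  also have "\<dots> = \<eta> * \<bar>s\<bar> ^ 4 - \<bar>s\<bar> ^ 3 + 1 / (4 * \<eta>) * \<bar>s\<bar>\<^sup>2"
    using \<eta> by (simp add: power2_eq_square power3_eq_cube power4_eq_xxxx field_simps)
  finally show ?thesis by simp
qed

lemma abs_le_one_plus_square: "\<bar>s\<bar> \<le> 1 + s\<^sup>2" for s :: real
proof -
  have "2 * 1 * \<bar>s\<bar> \<le> 1\<^sup>2 + \<bar>s\<bar>\<^sup>2" by (rule sum_squares_bound)
  then show ?thesis using abs_ge_zero[of s] unfolding power2_abs by (simp del: abs_ge_zero)
qed

text \<open>The subtracted \<open>s\<^sup>2\<close> pays for the term \<open>- 2 * lam\<close> of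
  the linear operator: half the quadratic form costs at most the integral of
  \<open>p\<^sup>2\<close>.\<close>

lemma F_nl_lower: "\<exists>C\<ge>0. \<forall>s. s ^ 4 / 8 - C \<le> F_nl \<epsilon> s - s\<^sup>2"
proof (intro exI[of _ "2 * (1 + \<bar>1 - \<epsilon>\<bar> / 2)\<^sup>2"] conjI allI)
  fix s
  have "1 - (1 - \<epsilon>) / 2 \<le> 1 + \<bar>1 - \<epsilon>\<bar> / 2"
    using abs_ge_minus_self[of "1 - \<epsilon>"] by (simp add: field_simps)
  then have "(1 - (1 - \<epsilon>) / 2) * s\<^sup>2 \<le> (1 + \<bar>1 - \<epsilon>\<bar> / 2) * s\<^sup>2"
    by (rule mult_right_mono) simp
  moreover have "(1 + \<bar>1 - \<epsilon>\<bar> / 2) * s\<^sup>2 \<le> 1 / 8 * s ^ 4 + (1 + \<bar>1 - \<epsilon>\<bar> / 2)\<^sup>2 / (4 * (1 / 8))"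
    by (rule square_le_quartic) simp
  ultimately show "s ^ 4 / 8 - 2 * (1 + \<bar>1 - \<epsilon>\<bar> / 2)\<^sup>2 \<le> F_nl \<epsilon> s - s\<^sup>2"
    unfolding F_nl_def left_diff_distrib by simp
qed simp

lemma F_nl_upper: "\<exists>C\<ge>0. \<forall>s. F_nl \<epsilon> s \<le> s ^ 4 / 2 + C"
proof (intro exI[of _ "((1 - \<epsilon>) / 2)\<^sup>2"] conjI allI)
  fix s
  have "(1 - \<epsilon>) / 2 * s\<^sup>2 \<le> 1 / 4 * s ^ 4 + ((1 - \<epsilon>) / 2)\<^sup>2 / (4 * (1 / 4))"
    by (rule square_le_quartic) simp
  then show "F_nl \<epsilon> s \<le> s ^ 4 / 2 + ((1 - \<epsilon>) / 2)\<^sup>2"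
    unfolding F_nl_def by simp
qed simp

text \<open>\<open>m0\<close> stands for the mean, which is removed from the function that
  \<open>f\<close> is tested with. Here the whole quadratic form occurs, hence
  \<open>2 * s\<^sup>2\<close>. All lower powers are absorbed by half of the quartic term, uniformly
  for bounded mean.\<close>

lemma f_nl_dissipative:
  assumes m: "m \<ge> 0"
  shows "\<exists>C\<ge>0. \<forall>s m0. \<bar>m0\<bar> \<le> m \<longrightarrow> s ^ 4 / 2 - C \<le> f_nl \<epsilon> s * (s - m0) - 2 * s\<^sup>2"
proof -
  define c where "c = \<bar>1 - \<epsilon>\<bar> + m\<^sup>2 + \<bar>1 - \<epsilon>\<bar> * m + 2"
  have "s ^ 4 / 2 - (c\<^sup>2 + \<bar>1 - \<epsilon>\<bar> * m) \<le> f_nl \<epsilon> s * (s - m0) - 2 * s\<^sup>2" if m0: "\<bar>m0\<bar> \<le> m" for s m0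
  proof -
    have 1: "c * s\<^sup>2 \<le> 1 / 4 * s ^ 4 + c\<^sup>2 / (4 * (1 / 4))"
      by (rule square_le_quartic) simp
    have 2: "m0 * s ^ 3 \<le> s ^ 4 / 4 + m\<^sup>2 * s\<^sup>2"
    proof -
      have "0 \<le> (s\<^sup>2 / 2 - m0 * s)\<^sup>2" by simp
      also have "\<dots> = s ^ 4 / 4 - m0 * s ^ 3 + m0\<^sup>2 * s\<^sup>2"
        by (simp add: power2_eq_square power3_eq_cube power4_eq_xxxx field_simps)
      finally have "m0 * s ^ 3 \<le> s ^ 4 / 4 + m0\<^sup>2 * s\<^sup>2" by simp
      moreover have "m0\<^sup>2 \<le> m\<^sup>2" using power_mono[OF m0, of 2] by simp
      then have "m0\<^sup>2 * s\<^sup>2 \<le> m\<^sup>2 * s\<^sup>2" by (intro mult_right_mono) auto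
      ultimately show ?thesis by simp
    qed
    have 3: "- (1 - \<epsilon>) * s\<^sup>2 \<le> \<bar>1 - \<epsilon>\<bar> * s\<^sup>2" by (intro mult_right_mono) auto
    have 4: "(1 - \<epsilon>) * m0 * s \<le> \<bar>1 - \<epsilon>\<bar> * m + \<bar>1 - \<epsilon>\<bar> * m * s\<^sup>2"
    proof -
      have "(1 - \<epsilon>) * m0 * s \<le> \<bar>1 - \<epsilon>\<bar> * \<bar>m0\<bar> * \<bar>s\<bar>"
        unfolding abs_mult[symmetric] by (rule abs_ge_self)
      also have "\<dots> \<le> \<bar>1 - \<epsilon>\<bar> * m * (1 + s\<^sup>2)"
        using m by (intro mult_mono m0 abs_le_one_plus_square) auto
      finally show ?thesis by (simp add: algebra_simps)
    qed
    have "f_nl \<epsilon> s * (s - m0) - 2 * s\<^sup>2 = s ^ 4 - m0 * s ^ 3 + (1 - \<epsilon>) * s\<^sup>2 - (1 - \<epsilon>) * m0 * s - 2 * s\<^sup>2"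
      by (simp add: f_nl_def power2_eq_square power3_eq_cube power4_eq_xxxx algebra_simps)
    moreover have "c * s\<^sup>2 = \<bar>1 - \<epsilon>\<bar> * s\<^sup>2 + m\<^sup>2 * s\<^sup>2 + \<bar>1 - \<epsilon>\<bar> * m * s\<^sup>2 + 2 * s\<^sup>2"
      by (simp add: c_def algebra_simps)
    moreover have "- (1 - \<epsilon>) * s\<^sup>2 = - ((1 - \<epsilon>) * s\<^sup>2)" by (rule mult_minus_left)
    ultimately show ?thesis using 1 2 3 4 by linarith
  qed
  then show ?thesis using m by (intro exI[of _ "c\<^sup>2 + \<bar>1 - \<epsilon>\<bar> * m"]) auto
qed

text \<open>Cubic growth lies below any multiple of the quartic term. The freedom in
  \<open>\<eta>\<close> allows the contribution of the mean velocity to be absorbed by the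
  dissipation.\<close>

lemma f_nl_le_quartic:
  assumes "M' \<ge> 0" "\<eta> > 0"
  shows "\<exists>C\<ge>0. \<forall>s. M' * \<bar>f_nl \<epsilon> s\<bar> \<le> \<eta> * s ^ 4 + C"
proof -
  \<comment> \<open>Strictly positive, so that dividing by it is harmless when
    \<open>M' = 0\<close>; half of \<open>\<eta>\<close> is spent on the cubic term and half on the
    quadratic one.\<close>
  define M1 where "M1 = M' + 1"
  have M1: "M1 > 0" "M' \<le> M1" using assms by (auto simp: M1_def)
  define \<eta>1 where "\<eta>1 = \<eta> / (2 * M1)"
  have \<eta>1: "\<eta>1 > 0" using assms M1 by (simp add: \<eta>1_def)
  define c where "c = M1 * (1 / (4 * \<eta>1) + \<bar>1 - \<epsilon>\<bar>)"
  have "M' * \<bar>f_nl \<epsilon> s\<bar> \<le> \<eta> * s ^ 4 + (c\<^sup>2 / (4 * (\<eta> / 2)) + M1 * \<bar>1 - \<epsilon>\<bar>)" for s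
  proof -
    have "\<bar>f_nl \<epsilon> s\<bar> \<le> \<bar>s\<bar> ^ 3 + \<bar>1 - \<epsilon>\<bar> * \<bar>s\<bar>"
      unfolding f_nl_def using abs_triangle_ineq[of "s ^ 3" "(1 - \<epsilon>) * s"] by (simp add: abs_mult power_abs)
    also have "\<dots> \<le> (\<eta>1 * s ^ 4 + 1 / (4 * \<eta>1) * s\<^sup>2) + \<bar>1 - \<epsilon>\<bar> * (1 + s\<^sup>2)"
      by (intro add_mono cube_le_quartic \<eta>1 mult_left_mono abs_le_one_plus_square) auto
    finally have "M' * \<bar>f_nl \<epsilon> s\<bar> \<le> M1 * ((\<eta>1 * s ^ 4 + 1 / (4 * \<eta>1) * s\<^sup>2) + \<bar>1 - \<epsilon>\<bar> * (1 + s\<^sup>2))"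
      using M1 by (intro mult_mono) auto
    also have "\<dots> = M1 * \<eta>1 * s ^ 4 + c * s\<^sup>2 + M1 * \<bar>1 - \<epsilon>\<bar>"
      by (simp add: c_def algebra_simps)
    also have "M1 * \<eta>1 = \<eta> / 2" using M1 by (simp add: \<eta>1_def)
    also have "\<eta> / 2 * s ^ 4 + c * s\<^sup>2 + M1 * \<bar>1 - \<epsilon>\<bar> \<le> \<eta> / 2 * s ^ 4 + (\<eta> / 2 * s ^ 4 + c\<^sup>2 / (4 * (\<eta> / 2))) + M1 * \<bar>1 - \<epsilon>\<bar>"
      using assms by (intro add_mono square_le_quartic) auto
    finally show ?thesis by simp
  qed
  then show ?thesis using assms M1
    by (intro exI[of _ "c\<^sup>2 / (4 * (\<eta> / 2)) + M1 * \<bar>1 - \<epsilon>\<bar>"]) auto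
qed

section \<open>The energy estimate\<close>

lemma F_nl_has_derivative: "(F_nl \<epsilon> has_real_derivative f_nl \<epsilon> s) (at s)"
  unfolding F_nl_def[abs_def] f_nl_def by (auto intro!: derivative_eq_intros simp: power3_eq_cube)

context trajectory
begin

definition p :: "nat \<Rightarrow> real \<Rightarrow> 'n func" where "p N t = tsum N (coef (\<phi> t))"
definition pf :: "nat \<Rightarrow> 'n mode \<Rightarrow> real \<Rightarrow> real" where "pf N n t = coef (\<lambda>x. f_nl \<epsilon> (p N t x)) n"
definition mu :: "'n mode \<Rightarrow> real" where "mu n = (lam n)\<^sup>2 - 2 * lam n"
definition nz :: "'n mode \<Rightarrow> real" where "nz n = (if fst n = 0 then 0 else 1)"
text \<open>Since \<open>x / 0 = 0\<close>, the modes with \<open>lam n = 0\<close> drop out of the sums with \<open>lam n\<close> in the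
  denominator.\<close>

definition Xs :: "nat \<Rightarrow> real \<Rightarrow> real" where "Xs N t = (\<Sum>n\<in>Modes N. (b n t)\<^sup>2 / lam n)"
definition Ys :: "nat \<Rightarrow> real \<Rightarrow> real" where "Ys N t = (\<Sum>n\<in>Modes N. (lam n)\<^sup>2 * (a n t)\<^sup>2)"
definition Zs :: "nat \<Rightarrow> real \<Rightarrow> real" where "Zs N t = (LINT x|lebesgue_on cell. p N t x ^ 4)"
text \<open>The potential energy of the truncation produces the modes \<open>pf\<close> of
  \<open>f(p)\<close>, the equation those of \<open>f(\<phi>)\<close>. The factor \<open>nz\<close>
  omits frequency zero, where the equation has no nonlinear term.\<close>

definition pairing_error :: "real \<Rightarrow> nat \<Rightarrow> real \<Rightarrow> real" where
  "pairing_error \<delta> N t = (\<Sum>n\<in>Modes N. nz n * ((pf N n t - fc n t) * (b n t + \<delta> * a n t)))"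
definition Lam :: "real \<Rightarrow> nat \<Rightarrow> real \<Rightarrow> real" where
  "Lam \<delta> N t = (\<Sum>n\<in>Modes N. \<beta> / 2 * ((b n t)\<^sup>2 / lam n) + mu n / 2 * (a n t)\<^sup>2
      + \<delta> * (\<beta> * (a n t * b n t) / lam n + (a n t)\<^sup>2 / (2 * lam n)))
    + (LINT x|lebesgue_on cell. F_nl \<epsilon> (p N t x))"
abbreviation a0 :: "real \<Rightarrow> real" where "a0 \<equiv> a (0, True)"
abbreviation b0 :: "real \<Rightarrow> real" where "b0 \<equiv> b (0, True)"

lemma p_eq: "p N t x = (\<Sum>n\<in>Modes N. a n t * trig n x)"
  by (simp add: p_def tsum_def a_def)

lemma p_continuous: "continuous_on S (p N t)"
  unfolding p_def by (rule continuous_on_tsum)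

lemma p_joint: "continuous_on ({0..} \<times> UNIV) (\<lambda>y. p N (fst y) (snd y))"
  unfolding p_eq
  by (intro continuous_intros continuous_on_compose2[OF a_continuous] continuous_on_compose2[OF continuous_on_trig[of UNIV]]) auto

lemma integrable_p:
  assumes "continuous_on UNIV g"
  shows "integrable (lebesgue_on cell) (\<lambda>x. g (p N t x) :: real)"
  by (intro continuous_cell continuous_on_compose2[OF assms] p_continuous) auto

lemma integral_p:
  assumes "continuous_on UNIV g"
  shows "(LINT x|lebesgue_on cell. g (p N t x) :: real) = integral (cbox 0 1) (\<lambda>x. g (p N t x))"
  by (intro continuous_cell continuous_on_compose2[OF assms] p_continuous) auto

lemma f_nl_p_L2p: "(\<lambda>x. f_nl \<epsilon> (p N t x)) \<in> L2p"
  unfolding p_def by (rule f_nl_tsum_L2p)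

lemma ip_f_nl_p: "ip (\<lambda>x. f_nl \<epsilon> (p N t x)) (tsum N d) = (\<Sum>n\<in>Modes N. d n * pf N n t)"
  using ip_tsum[OF f_nl_p_L2p, of N d N t] by (simp add: ip_commute pf_def)

lemma F_integral_continuous: "continuous_on {0..} (\<lambda>t. LINT x|lebesgue_on cell. F_nl \<epsilon> (p N t x))"
proof -
  have "continuous_on ({0..} \<times> cbox 0 1) (\<lambda>(t, x). F_nl \<epsilon> (p N t x))"
    unfolding case_prod_beta
    by (intro continuous_intros continuous_on_subset[OF p_joint]) auto
  then have "continuous_on {0..} (\<lambda>t. integral (cbox 0 1) (\<lambda>x. F_nl \<epsilon> (p N t x)))"
    by (rule integral_continuous_on_param)
  then show ?thesis
    by (subst integral_p) (auto intro: continuous_intros)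
qed

lemma pf_continuous: "continuous_on {0..} (pf N n)"
proof -
  have "continuous_on ({0..} \<times> cbox 0 1) (\<lambda>(t, x). f_nl \<epsilon> (p N t x) * trig n x)"
    unfolding case_prod_beta
    by (intro continuous_intros continuous_on_subset[OF p_joint] continuous_on_compose2[OF continuous_on_trig[of UNIV]]) auto
  then have "continuous_on {0..} (\<lambda>t. integral (cbox 0 1) (\<lambda>x. f_nl \<epsilon> (p N t x) * trig n x))"
    by (rule integral_continuous_on_param)
  moreover have "pf N n t = integral (cbox 0 1) (\<lambda>x. f_nl \<epsilon> (p N t x) * trig n x)" for t
    unfolding pf_def coef_def ip_def by (intro continuous_cell continuous_intros p_continuous)
  ultimately show ?thesis by simp
qed

lemma pairing_error_continuous: "continuous_on {0..} (pairing_error \<delta> N)"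
  unfolding pairing_error_def[abs_def]
  by (intro continuous_intros pf_continuous fc_continuous a_continuous b_continuous)

lemma Lam_continuous: "continuous_on {0..} (Lam \<delta> N)"
proof -
  have c: "continuous_on {0..} (\<lambda>t. \<beta> / 2 * ((b n t)\<^sup>2 / lam n) + mu n / 2 * (a n t)\<^sup>2
      + \<delta> * (\<beta> * (a n t * b n t) / lam n + (a n t)\<^sup>2 / (2 * lam n)))" for n
    unfolding divide_inverse
    by (intro continuous_on_add continuous_on_mult continuous_on_power continuous_on_const a_continuous b_continuous)
  show ?thesis
    unfolding Lam_def[abs_def] by (rule continuous_on_add[OF continuous_on_sum[OF c] F_integral_continuous])
qed

lemma F_integral_derivative:
  assumes t: "t > 0"
  shows "((\<lambda>t. LINT x|lebesgue_on cell. F_nl \<epsilon> (p N t x)) has_real_derivative (\<Sum>n\<in>Modes N. b n t * pf N n t)) (at t)"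
proof -
  let ?q = "\<lambda>t x. \<Sum>n\<in>Modes N. b n t * trig n x"
  have "((\<lambda>t. integral (cbox 0 1) (\<lambda>x. F_nl \<epsilon> (p N t x))) has_real_derivative
    integral (cbox 0 1) (\<lambda>x. f_nl \<epsilon> (p N t x) * ?q t x)) (at t within {0<..})"
  proof (rule leibniz_rule_field_derivative)
    fix s :: real and x :: "real^'n" assume s: "s \<in> {0<..}"
    have "((\<lambda>s. p N s x) has_real_derivative ?q s x) (at s)"
      unfolding p_eq using s by (intro DERIV_sum DERIV_cmult_right a_derivative) auto
    from DERIV_chain2[where g = "\<lambda>s. p N s x", OF F_nl_has_derivative this]
    show "((\<lambda>s. F_nl \<epsilon> (p N s x)) has_real_derivative f_nl \<epsilon> (p N s x) * ?q s x) (at s within {0<..})"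
      by (rule has_field_derivative_at_within)
  next
    show "(\<lambda>x. F_nl \<epsilon> (p N s x)) integrable_on cbox 0 1" for s
      by (intro integrable_continuous continuous_intros p_continuous)
    show "continuous_on ({0<..} \<times> cbox 0 1) (\<lambda>(s, x). f_nl \<epsilon> (p N s x) * ?q s x)"
      unfolding case_prod_beta
      by (intro continuous_intros continuous_on_subset[OF p_joint] continuous_on_compose2[OF b_continuous]
          continuous_on_compose2[OF continuous_on_trig[of UNIV]]) auto
  qed (use t in auto)
  moreover have "at t within {0<..} = at t"
    using t by (intro at_within_open) auto
  moreover have "integral (cbox 0 1) (\<lambda>x. f_nl \<epsilon> (p N t x) * ?q t x) = (\<Sum>n\<in>Modes N. b n t * pf N n t)"
  proof -
    have "integral (cbox 0 1) (\<lambda>x. f_nl \<epsilon> (p N t x) * ?q t x) = (LINT x|lebesgue_on cell. f_nl \<epsilon> (p N t x) * ?q t x)"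
      by (rule sym, intro continuous_cell continuous_intros p_continuous)
    also have "\<dots> = ip (\<lambda>x. f_nl \<epsilon> (p N t x)) (tsum N (\<lambda>n. b n t))"
      by (simp add: ip_def tsum_def)
    finally show ?thesis by (simp add: ip_f_nl_p)
  qed
  ultimately show ?thesis
    by (subst integral_p) (auto intro: continuous_intros)
qed

text \<open>At frequency zero the sine vanishes identically, so only the constant mode is split
  off.\<close>

lemma zero_modes:
  "(\<Sum>n\<in>Modes N. g n * pf N n t) =
    (\<Sum>n\<in>Modes N. nz n * (g n * pf N n t)) + g (0, True) * (LINT x|lebesgue_on cell. f_nl \<epsilon> (p N t x))"
proof -
  have "(\<Sum>n\<in>Modes N. g n * pf N n t) - (\<Sum>n\<in>Modes N. nz n * (g n * pf N n t)) =
    (\<Sum>n\<in>Modes N. (1 - nz n) * (g n * pf N n t))"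
    by (simp add: sum_subtractf left_diff_distrib)
  also have "\<dots> = (\<Sum>n\<in>{(0, True)}. (1 - nz n) * (g n * pf N n t))"
  proof (rule sum.mono_neutral_right)
    show "\<forall>n\<in>Modes N - {(0, True)}. (1 - nz n) * (g n * pf N n t) = 0"
    proof
      fix n :: "'n mode" assume n: "n \<in> Modes N - {(0, True)}"
      show "(1 - nz n) * (g n * pf N n t) = 0"
      proof (cases "fst n = 0")
        case True
        then have "\<not> snd n" using n by (cases n) auto
        then have "pf N n t = 0" using True by (simp add: pf_def coef_def trig_def ip_def)
        then show ?thesis by simp
      qed (simp add: nz_def)
    qed
  qed (auto simp: Modes_iff)
  also have "\<dots> = g (0, True) * (LINT x|lebesgue_on cell. f_nl \<epsilon> (p N t x))"
    by (simp add: nz_def pf_def coef_def ip_def trig_def)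
  finally show ?thesis by simp
qed

lemma ode: "\<beta> * b' n t = - (b n t + lam n * (mu n * a n t + fc n t))"
  using \<beta> by (simp add: b'_def mu_def)

text \<open>In each mode \<open>\<beta> * b'\<close> is replaced by means of the equation. The terms
  \<open>mu * a * b\<close> cancel; the part with \<open>\<delta>\<close> contributes
  \<open>\<delta> * \<beta> * b\<^sup>2 / lam\<close> and the dissipation
  \<open>- \<delta> * mu * a\<^sup>2\<close>, its terms in \<open>a * b\<close> cancelling too.
  Frequency zero leaves the term with \<open>b0\<close>.\<close>

lemma Lam_derivative:
  assumes t: "t > 0"
  shows "(Lam \<delta> N has_real_derivative
    - (1 - \<delta> * \<beta>) * Xs N t
    - \<delta> * ((\<Sum>n\<in>Modes N. mu n * (a n t)\<^sup>2) + (LINT x|lebesgue_on cell. f_nl \<epsilon> (p N t x) * (p N t x - a0 t)))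
    + b0 t * (LINT x|lebesgue_on cell. f_nl \<epsilon> (p N t x)) + pairing_error \<delta> N t) (at t)"
proof -
  let ?I = "LINT x|lebesgue_on cell. f_nl \<epsilon> (p N t x)"
  have deriv1: "((\<lambda>t. \<beta> / 2 * ((b n t)\<^sup>2 / lam n) + mu n / 2 * (a n t)\<^sup>2
      + \<delta> * (\<beta> * (a n t * b n t) / lam n + (a n t)\<^sup>2 / (2 * lam n))) has_real_derivative
     - (1 - \<delta> * \<beta>) * ((b n t)\<^sup>2 / lam n) - \<delta> * (mu n * (a n t)\<^sup>2) - nz n * (fc n t * (b n t + \<delta> * a n t))) (at t)" for n
  proof (cases "fst n = 0")
    case True
    then show ?thesis by (simp add: lam_def mu_def nz_def)
  next
    case False
    define l where "l = lam n"
    have l: "l \<ge> 1" using lam_ge_1[OF False] by (simp add: l_def)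
    have o: "\<beta> * b' n t = - (b n t + l * (mu n * a n t + fc n t))"
      unfolding l_def by (rule ode)
    have "((\<lambda>t. \<beta> / 2 * ((b n t)\<^sup>2 / l) + mu n / 2 * (a n t)\<^sup>2
      + \<delta> * (\<beta> * (a n t * b n t) / l + (a n t)\<^sup>2 / (2 * l))) has_real_derivative
      b n t * (\<beta> * b' n t) / l + mu n * a n t * b n t + \<delta> * ((\<beta> * (b n t * b n t) + a n t * (\<beta> * b' n t)) / l + a n t * b n t / l)) (at t)"
      using l by (auto intro!: derivative_eq_intros a_derivative[OF t] b_derivative[OF t] simp: field_simps)
    moreover have "b n t * (\<beta> * b' n t) / l + mu n * a n t * b n t + \<delta> * ((\<beta> * (b n t * b n t) + a n t * (\<beta> * b' n t)) / l + a n t * b n t / l)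
      = - (1 - \<delta> * \<beta>) * ((b n t)\<^sup>2 / l) - \<delta> * (mu n * (a n t)\<^sup>2) - fc n t * (b n t + \<delta> * a n t)"
      unfolding o using l by (simp add: field_simps power2_eq_square)
    ultimately show ?thesis
      using False by (simp add: nz_def l_def)
  qed
  have D: "(Lam \<delta> N has_real_derivative
    (\<Sum>n\<in>Modes N. - (1 - \<delta> * \<beta>) * ((b n t)\<^sup>2 / lam n) - \<delta> * (mu n * (a n t)\<^sup>2) - nz n * (fc n t * (b n t + \<delta> * a n t)))
    + (\<Sum>n\<in>Modes N. b n t * pf N n t)) (at t)"
    unfolding Lam_def[abs_def] by (intro DERIV_add DERIV_sum deriv1 F_integral_derivative t)
  have e1: "(\<Sum>n\<in>Modes N. - (1 - \<delta> * \<beta>) * ((b n t)\<^sup>2 / lam n) - \<delta> * (mu n * (a n t)\<^sup>2) - nz n * (fc n t * (b n t + \<delta> * a n t)))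
    = - (1 - \<delta> * \<beta>) * Xs N t - \<delta> * (\<Sum>n\<in>Modes N. mu n * (a n t)\<^sup>2) - (\<Sum>n\<in>Modes N. nz n * (fc n t * (b n t + \<delta> * a n t)))"
    unfolding Xs_def by (simp only: sum_subtractf sum_distrib_left)
  have e2: "(\<Sum>n\<in>Modes N. b n t * pf N n t) = (\<Sum>n\<in>Modes N. nz n * (b n t * pf N n t)) + b0 t * ?I"
    by (rule zero_modes)
  have e3: "(LINT x|lebesgue_on cell. f_nl \<epsilon> (p N t x) * (p N t x - a0 t)) = (\<Sum>n\<in>Modes N. nz n * (a n t * pf N n t))"
  proof -
    have "(LINT x|lebesgue_on cell. f_nl \<epsilon> (p N t x) * (p N t x - a0 t)) =
      (LINT x|lebesgue_on cell. f_nl \<epsilon> (p N t x) * p N t x - a0 t * f_nl \<epsilon> (p N t x))"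
      by (rule Bochner_Integration.integral_cong) (auto simp: algebra_simps)
    also have "\<dots> = (LINT x|lebesgue_on cell. f_nl \<epsilon> (p N t x) * p N t x) - (LINT x|lebesgue_on cell. a0 t * f_nl \<epsilon> (p N t x))"
      by (intro Bochner_Integration.integral_diff continuous_cell continuous_intros p_continuous)
    also have "\<dots> = ip (\<lambda>x. f_nl \<epsilon> (p N t x)) (tsum N (\<lambda>n. a n t)) - a0 t * ?I"
      by (simp add: ip_def tsum_def p_eq)
    also have "ip (\<lambda>x. f_nl \<epsilon> (p N t x)) (tsum N (\<lambda>n. a n t)) = (\<Sum>n\<in>Modes N. nz n * (a n t * pf N n t)) + a0 t * ?I"
      unfolding ip_f_nl_p by (rule zero_modes)
    finally show ?thesis by simp
  qed
  have e4: "pairing_error \<delta> N t = (\<Sum>n\<in>Modes N. nz n * (b n t * pf N n t)) + \<delta> * (\<Sum>n\<in>Modes N. nz n * (a n t * pf N n t))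
      - (\<Sum>n\<in>Modes N. nz n * (fc n t * (b n t + \<delta> * a n t)))"
    unfolding pairing_error_def sum_distrib_left sum.distrib[symmetric] sum_subtractf[symmetric]
    by (rule sum.cong) (auto simp: algebra_simps)
  show ?thesis
    by (rule DERIV_cong[OF D]) (unfold e1 e2 e3 e4 distrib_left[of \<delta>], linarith)
qed


section \<open>Coercivity and dissipation of the Lyapunov functional\<close>

lemma Xs_nonneg: "0 \<le> Xs N t"
  unfolding Xs_def by (intro sum_nonneg divide_nonneg_nonneg lam_nonneg) auto

lemma Ys_nonneg: "0 \<le> Ys N t"
  unfolding Ys_def by (intro sum_nonneg) auto

lemma Zs_nonneg: "0 \<le> Zs N t"
  unfolding Zs_def by (intro integral_nonneg_AE) auto

lemma mass_eq: "(\<Sum>n\<in>Modes N. (a n t)\<^sup>2) = (LINT x|lebesgue_on cell. (p N t x)\<^sup>2)"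
  using ip_tsum_self[OF mode_symm_coef[of "\<phi> t"], of N] by (simp add: a_def p_def ip_def power2_eq_square)

text \<open>The difference of \<open>lam\<^sup>2 - 2 * lam\<close> and
  \<open>lam\<^sup>2 / 2 - 2\<close> is \<open>(lam - 2)\<^sup>2 / 2\<close>.\<close>

lemma mu_sum_ge: "Ys N t / 2 - 2 * (LINT x|lebesgue_on cell. (p N t x)\<^sup>2) \<le> (\<Sum>n\<in>Modes N. mu n * (a n t)\<^sup>2)"
proof -
  have "(\<Sum>n\<in>Modes N. (lam n)\<^sup>2 * (a n t)\<^sup>2 / 2 - 2 * (a n t)\<^sup>2) \<le> (\<Sum>n\<in>Modes N. mu n * (a n t)\<^sup>2)"
  proof (rule sum_mono)
    fix n :: "'n mode"
    have "0 \<le> (lam n - 2)\<^sup>2 / 2 * (a n t)\<^sup>2" by simp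
    then show "(lam n)\<^sup>2 * (a n t)\<^sup>2 / 2 - 2 * (a n t)\<^sup>2 \<le> mu n * (a n t)\<^sup>2"
      by (simp add: mu_def power2_eq_square algebra_simps)
  qed
  then show ?thesis
    by (simp add: mass_eq[symmetric] Ys_def sum_subtractf sum_distrib_left sum_divide_distrib)
qed

lemma mu_sum_le: "(\<Sum>n\<in>Modes N. mu n * (a n t)\<^sup>2) \<le> Ys N t"
  unfolding Ys_def
proof (intro sum_mono mult_right_mono)
  show "mu n \<le> (lam n)\<^sup>2" for n :: "'n mode" using lam_nonneg[of n] by (simp add: mu_def)
qed simp

text \<open>Young's inequality together with \<open>1 / lam \<le> lam\<^sup>2\<close> for
  \<open>lam \<ge> 1\<close>. The constant \<open>(\<beta> + 1) / 2\<close> collects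
  \<open>\<beta> / 2\<close> from the product and \<open>1 / 2\<close> from the square.\<close>

lemma cross_le:
  "\<bar>\<Sum>n\<in>Modes N. \<beta> * (a n t * b n t) / lam n + (a n t)\<^sup>2 / (2 * lam n)\<bar> \<le> \<beta> / 2 * Xs N t + (\<beta> + 1) / 2 * Ys N t"
proof -
  have "\<bar>\<beta> * (a n t * b n t) / lam n + (a n t)\<^sup>2 / (2 * lam n)\<bar> \<le>
    \<beta> / 2 * ((b n t)\<^sup>2 / lam n) + (\<beta> + 1) / 2 * ((lam n)\<^sup>2 * (a n t)\<^sup>2)" for n
  proof (cases "fst n = 0")
    case True
    then show ?thesis by (simp add: lam_def)
  next
    case False
    define l where "l = lam n"
    have l: "l \<ge> 1" using lam_ge_1[OF False] by (simp add: l_def)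
    have "\<bar>a n t * b n t\<bar> \<le> (a n t)\<^sup>2 / 2 + (b n t)\<^sup>2 / 2"
      using sum_squares_bound[of "\<bar>a n t\<bar>" "\<bar>b n t\<bar>"] by (simp add: abs_mult)
    then have 1: "\<beta> * \<bar>a n t * b n t\<bar> / l \<le> \<beta> * ((a n t)\<^sup>2 / 2 + (b n t)\<^sup>2 / 2) / l"
      using \<beta> l by (intro divide_right_mono mult_left_mono) auto
    have "1 / l \<le> l\<^sup>2"
    proof -
      have "1 / l \<le> 1" using l by simp
      also have "1 \<le> l\<^sup>2" using l by simp
      finally show ?thesis .
    qed
    then have 2: "(a n t)\<^sup>2 * (1 / l) \<le> (a n t)\<^sup>2 * l\<^sup>2"
      by (intro mult_left_mono) auto
    have "\<bar>\<beta> * (a n t * b n t) / l + (a n t)\<^sup>2 / (2 * l)\<bar> \<le> \<bar>\<beta> * (a n t * b n t) / l\<bar> + \<bar>(a n t)\<^sup>2 / (2 * l)\<bar>"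
      by (rule abs_triangle_ineq)
    also have "\<dots> = \<beta> * \<bar>a n t * b n t\<bar> / l + (a n t)\<^sup>2 / (2 * l)"
      using \<beta> l by (simp add: abs_mult)
    also have "\<dots> \<le> \<beta> * ((a n t)\<^sup>2 / 2 + (b n t)\<^sup>2 / 2) / l + (a n t)\<^sup>2 / (2 * l)"
      using 1 by simp
    also have "\<dots> = \<beta> / 2 * ((b n t)\<^sup>2 / l) + (\<beta> + 1) / 2 * ((a n t)\<^sup>2 * (1 / l))"
      using l by (simp add: field_simps)
    also have "\<dots> \<le> \<beta> / 2 * ((b n t)\<^sup>2 / l) + (\<beta> + 1) / 2 * ((a n t)\<^sup>2 * l\<^sup>2)"
      using \<beta> by (intro add_left_mono mult_left_mono[OF 2]) auto
    finally show ?thesis by (simp add: l_def mult.commute)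
  qed
  then have "\<bar>\<Sum>n\<in>Modes N. \<beta> * (a n t * b n t) / lam n + (a n t)\<^sup>2 / (2 * lam n)\<bar> \<le>
    (\<Sum>n\<in>Modes N. \<beta> / 2 * ((b n t)\<^sup>2 / lam n) + (\<beta> + 1) / 2 * ((lam n)\<^sup>2 * (a n t)\<^sup>2))"
    by (intro order_trans[OF sum_abs sum_mono])
  then show ?thesis
    by (simp only: Xs_def Ys_def sum.distrib sum_distrib_left)
qed

lemma Lam_eq:
  "Lam \<delta> N t = \<beta> / 2 * Xs N t + (\<Sum>n\<in>Modes N. mu n * (a n t)\<^sup>2) / 2
    + \<delta> * (\<Sum>n\<in>Modes N. \<beta> * (a n t * b n t) / lam n + (a n t)\<^sup>2 / (2 * lam n))
    + (LINT x|lebesgue_on cell. F_nl \<epsilon> (p N t x))"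
  unfolding Lam_def Xs_def sum.distrib[symmetric] sum_distrib_left sum_divide_distrib
  by (simp add: algebra_simps)

lemma integral_p_mono:
  assumes "continuous_on UNIV g" "continuous_on UNIV h" "\<And>s. g s \<le> (h s :: real)"
  shows "(LINT x|lebesgue_on cell. g (p N t x)) \<le> (LINT x|lebesgue_on cell. h (p N t x))"
  using assms by (intro integral_mono integrable_p)

lemma integral_p_quartic: "(LINT x|lebesgue_on cell. c * (p N t x) ^ 4 + d) = c * Zs N t + d"
proof -
  have "integrable (lebesgue_on cell) (\<lambda>x. (p N t x) ^ 4)"
    by (intro integrable_p[of "\<lambda>s. s ^ 4"] continuous_intros)
  then show ?thesis by (simp add: Zs_def)
qed

text \<open>The choice of \<open>\<delta>\<close> makes \<open>\<delta> * (\<beta> + 1) / 2\<close>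
  equal to \<open>1 / 8\<close>: the cross term consumes half of the available
  \<open>Ys / 4\<close>, and at most half of \<open>\<beta> / 2 * Xs\<close>.\<close>

lemma Lam_lower:
  assumes \<delta>: "\<delta> = 1 / (4 * (\<beta> + 1))" and C1: "\<And>s. s ^ 4 / 8 - C1 \<le> F_nl \<epsilon> s - s\<^sup>2"
  shows "\<beta> / 4 * Xs N t + Ys N t / 8 - C1 \<le> Lam \<delta> N t"
proof -
  let ?J = "\<Sum>n\<in>Modes N. \<beta> * (a n t * b n t) / lam n + (a n t)\<^sup>2 / (2 * lam n)"
  let ?W = "LINT x|lebesgue_on cell. (p N t x)\<^sup>2"
  have \<delta>0: "\<delta> \<ge> 0" using \<beta> by (simp add: \<delta>)
  have J: "\<bar>\<delta> * ?J\<bar> \<le> \<beta> / 4 * Xs N t + Ys N t / 8"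
  proof -
    have "\<bar>\<delta> * ?J\<bar> \<le> \<delta> * (\<beta> / 2 * Xs N t + (\<beta> + 1) / 2 * Ys N t)"
      using cross_le[where N = N and t = t] \<delta>0 by (simp add: abs_mult mult_left_mono)
    also have "\<dots> = (\<delta> * (\<beta> / 2)) * Xs N t + Ys N t / 8"
      using \<beta> by (simp add: \<delta> field_simps)
    also have "\<dots> \<le> \<beta> / 4 * Xs N t + Ys N t / 8"
    proof (intro add_right_mono mult_right_mono Xs_nonneg)
      have "\<delta> \<le> 1 / 2" using \<beta> by (simp add: \<delta> field_simps)
      then have "\<delta> * (\<beta> / 2) \<le> 1 / 2 * (\<beta> / 2)" using \<beta> by (intro mult_right_mono) auto
      then show "\<delta> * (\<beta> / 2) \<le> \<beta> / 4" by simp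
    qed
    finally show ?thesis .
  qed
  have "(LINT x|lebesgue_on cell. 1 / 8 * (p N t x) ^ 4 + (- C1)) \<le> (LINT x|lebesgue_on cell. F_nl \<epsilon> (p N t x) - (p N t x)\<^sup>2)"
    using C1 by (intro integral_p_mono[of "\<lambda>s. 1 / 8 * s ^ 4 + (- C1)" "\<lambda>s. F_nl \<epsilon> s - s\<^sup>2"] continuous_intros) auto
  also have "\<dots> = (LINT x|lebesgue_on cell. F_nl \<epsilon> (p N t x)) - ?W"
    by (intro Bochner_Integration.integral_diff integrable_p[of "F_nl \<epsilon>"] integrable_p[of "\<lambda>s. s\<^sup>2"] continuous_intros continuous_on_F_nl[OF continuous_on_id, unfolded id_def])
  finally have "1 / 8 * Zs N t - C1 + ?W \<le> (LINT x|lebesgue_on cell. F_nl \<epsilon> (p N t x))"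
    unfolding integral_p_quartic by simp
  then show ?thesis
    unfolding Lam_eq using J mu_sum_ge[where N = N and t = t] Zs_nonneg[where N = N and t = t] by (auto simp: abs_le_iff)
qed

text \<open>The quartic integral stays on the right, because the dissipation supplies a multiple of
  it.\<close>

lemma Lam_upper:
  assumes \<delta>: "\<delta> = 1 / (4 * (\<beta> + 1))" and C2: "\<And>s. F_nl \<epsilon> s \<le> s ^ 4 / 2 + C2"
  shows "Lam \<delta> N t \<le> \<beta> * Xs N t + Ys N t + Zs N t + C2"
proof -
  let ?J = "\<Sum>n\<in>Modes N. \<beta> * (a n t * b n t) / lam n + (a n t)\<^sup>2 / (2 * lam n)"
  have \<delta>0: "\<delta> \<ge> 0" using \<beta> by (simp add: \<delta>)
  have "\<delta> * ?J \<le> \<delta> * (\<beta> / 2 * Xs N t + (\<beta> + 1) / 2 * Ys N t)"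
    using cross_le[where N = N and t = t] \<delta>0 by (intro mult_left_mono) auto
  also have "\<dots> = (\<delta> * (\<beta> / 2)) * Xs N t + Ys N t / 8"
    using \<beta> by (simp add: \<delta> field_simps)
  also have "\<dots> \<le> \<beta> / 2 * Xs N t + Ys N t / 8"
  proof (intro add_right_mono mult_right_mono Xs_nonneg)
    have "\<delta> \<le> 1" using \<beta> by (simp add: \<delta> field_simps)
    then show "\<delta> * (\<beta> / 2) \<le> \<beta> / 2" using \<beta> by (simp add: mult_left_le_one_le \<delta>0)
  qed
  finally have J: "\<delta> * ?J \<le> \<beta> / 2 * Xs N t + Ys N t / 8" .
  have "(LINT x|lebesgue_on cell. F_nl \<epsilon> (p N t x)) \<le> (LINT x|lebesgue_on cell. 1 / 2 * (p N t x) ^ 4 + C2)"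
    using C2 by (intro integral_p_mono[of "F_nl \<epsilon>" "\<lambda>s. 1 / 2 * s ^ 4 + C2"] continuous_intros continuous_on_F_nl[OF continuous_on_id, unfolded id_def]) auto
  then have "(LINT x|lebesgue_on cell. F_nl \<epsilon> (p N t x)) \<le> 1 / 2 * Zs N t + C2"
    unfolding integral_p_quartic .
  then show ?thesis
    unfolding Lam_eq using J mu_sum_le[where N = N and t = t] Ys_nonneg[where N = N and t = t] Zs_nonneg[where N = N and t = t] by linarith
qed

text \<open>The balance: the dissipation offers \<open>Xs / 2\<close>, since
  \<open>\<delta> * \<beta> \<le> 1 / 2\<close>, together with \<open>\<delta> / 2 * Ys\<close> and
  \<open>\<delta> / 2 * Zs\<close>. The mean velocity uses up \<open>\<delta> / 4 * Zs\<close>, and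
  \<open>\<kappa>\<close> is chosen so that \<open>\<kappa>\<close> times the upper bound for
  \<open>Lam\<close> fits into the rest.\<close>

lemma Lam_dissipation:
  fixes m M' :: real
  assumes \<delta>: "\<delta> = 1 / (4 * (\<beta> + 1))" and \<kappa>: "\<kappa> = min (1 / (2 * \<beta>)) (\<delta> / 4)"
    and C2: "C2 \<ge> 0" "\<And>s. F_nl \<epsilon> s \<le> s ^ 4 / 2 + C2"
    and C3: "\<And>s m0. \<bar>m0\<bar> \<le> m \<Longrightarrow> s ^ 4 / 2 - C3 \<le> f_nl \<epsilon> s * (s - m0) - 2 * s\<^sup>2"
    and C4: "\<And>s. M' * \<bar>f_nl \<epsilon> s\<bar> \<le> \<delta> / 4 * s ^ 4 + C4"
    and a0: "\<bar>a0 t\<bar> \<le> m" and b0: "\<bar>b0 t\<bar> \<le> M'"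
  shows "- (1 - \<delta> * \<beta>) * Xs N t
    - \<delta> * ((\<Sum>n\<in>Modes N. mu n * (a n t)\<^sup>2) + (LINT x|lebesgue_on cell. f_nl \<epsilon> (p N t x) * (p N t x - a0 t)))
    + b0 t * (LINT x|lebesgue_on cell. f_nl \<epsilon> (p N t x)) + pairing_error \<delta> N t
    \<le> - \<kappa> * Lam \<delta> N t + (\<kappa> * C2 + \<delta> * C3 + C4) + \<bar>pairing_error \<delta> N t\<bar>"
proof -
  let ?W = "LINT x|lebesgue_on cell. (p N t x)\<^sup>2"
  let ?G = "LINT x|lebesgue_on cell. f_nl \<epsilon> (p N t x) * (p N t x - a0 t)"
  let ?I = "LINT x|lebesgue_on cell. f_nl \<epsilon> (p N t x)"
  have fc: "continuous_on UNIV (f_nl \<epsilon>)"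
    by (rule continuous_on_f_nl[OF continuous_on_id, unfolded id_def])
  have \<delta>0: "\<delta> > 0" using \<beta> by (simp add: \<delta>)
  have \<kappa>0: "\<kappa> > 0" using \<beta> \<delta>0 by (simp add: \<kappa>)
  have "(LINT x|lebesgue_on cell. 1 / 2 * (p N t x) ^ 4 + (- C3)) \<le> (LINT x|lebesgue_on cell. f_nl \<epsilon> (p N t x) * (p N t x - a0 t) - 2 * (p N t x)\<^sup>2)"
    using C3[OF a0]
    by (intro integral_p_mono[of "\<lambda>s. 1 / 2 * s ^ 4 + (- C3)" "\<lambda>s. f_nl \<epsilon> s * (s - a0 t) - 2 * s\<^sup>2"] continuous_intros fc) auto
  also have "\<dots> = ?G - (LINT x|lebesgue_on cell. 2 * (p N t x)\<^sup>2)"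
    by (intro Bochner_Integration.integral_diff integrable_p[of "\<lambda>s. f_nl \<epsilon> s * (s - a0 t)"] integrable_p[of "\<lambda>s. 2 * s\<^sup>2"] continuous_intros fc)
  finally have G: "1 / 2 * Zs N t - C3 + 2 * ?W \<le> ?G"
    unfolding integral_p_quartic by simp
  have "\<bar>b0 t * ?I\<bar> \<le> M' * (LINT x|lebesgue_on cell. \<bar>f_nl \<epsilon> (p N t x)\<bar>)"
    using b0 integral_abs_bound[of "lebesgue_on cell" "\<lambda>x. f_nl \<epsilon> (p N t x)"]
    unfolding abs_mult by (intro mult_mono) auto
  also have "\<dots> = (LINT x|lebesgue_on cell. M' * \<bar>f_nl \<epsilon> (p N t x)\<bar>)" by simp
  also have "\<dots> \<le> (LINT x|lebesgue_on cell. \<delta> / 4 * (p N t x) ^ 4 + C4)"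
    using C4 by (intro integral_p_mono[of "\<lambda>s. M' * \<bar>f_nl \<epsilon> s\<bar>" "\<lambda>s. \<delta> / 4 * s ^ 4 + C4"] continuous_intros fc) auto
  finally have I: "b0 t * ?I \<le> \<delta> / 4 * Zs N t + C4"
    unfolding integral_p_quartic by simp
  have "Ys N t / 2 + 1 / 2 * Zs N t - C3 \<le> (\<Sum>n\<in>Modes N. mu n * (a n t)\<^sup>2) + ?G"
    using G mu_sum_ge[where N = N and t = t] by simp
  then have "\<delta> * (Ys N t / 2 + 1 / 2 * Zs N t - C3) \<le> \<delta> * ((\<Sum>n\<in>Modes N. mu n * (a n t)\<^sup>2) + ?G)"
    using \<delta>0 by (intro mult_left_mono) auto
  then have D: "\<delta> / 2 * Ys N t + \<delta> / 2 * Zs N t - \<delta> * C3 \<le> \<delta> * ((\<Sum>n\<in>Modes N. mu n * (a n t)\<^sup>2) + ?G)"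
    by (simp add: algebra_simps)
  have X: "1 / 2 * Xs N t \<le> (1 - \<delta> * \<beta>) * Xs N t"
  proof (intro mult_right_mono Xs_nonneg)
    have "\<delta> * \<beta> \<le> 1 / 2" using \<beta> by (simp add: \<delta> field_simps)
    then show "1 / 2 \<le> 1 - \<delta> * \<beta>" by simp
  qed
  have "\<kappa> * Lam \<delta> N t \<le> \<kappa> * (\<beta> * Xs N t + Ys N t + Zs N t + C2)"
    using \<kappa>0 Lam_upper[OF \<delta> C2(2), where N = N and t = t] by (intro mult_left_mono) auto
  also have "\<dots> = (\<kappa> * \<beta>) * Xs N t + \<kappa> * Ys N t + \<kappa> * Zs N t + \<kappa> * C2"
    by (simp add: algebra_simps)
  also have "\<dots> \<le> 1 / 2 * Xs N t + \<delta> / 2 * Ys N t + \<delta> / 4 * Zs N t + \<kappa> * C2"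
  proof (intro add_mono mult_right_mono Xs_nonneg Ys_nonneg Zs_nonneg order_refl)
    have "\<kappa> * \<beta> \<le> 1 / (2 * \<beta>) * \<beta>" using \<beta> by (intro mult_right_mono) (auto simp: \<kappa>)
    then show "\<kappa> * \<beta> \<le> 1 / 2" using \<beta> by simp
    show "\<kappa> \<le> \<delta> / 4" by (simp add: \<kappa>)
    then show "\<kappa> \<le> \<delta> / 2" using \<delta>0 by simp
  qed (rule C2(1))
  finally have "\<kappa> * Lam \<delta> N t \<le> 1 / 2 * Xs N t + \<delta> / 2 * Ys N t + \<delta> / 4 * Zs N t + \<kappa> * C2" .
  then show ?thesis
    using I D X abs_ge_self[of "pairing_error \<delta> N t"] mult_minus_left[of "1 - \<delta> * \<beta>" "Xs N t"]
      mult_minus_left[of \<kappa> "Lam \<delta> N t"] by linarith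
qed

text \<open>Gronwall's argument with a forcing term; derivatives exist at positive times and
  continuity takes care of the time 0.\<close>

lemma Lam_Gronwall:
  fixes m M' :: real
  assumes \<delta>: "\<delta> = 1 / (4 * (\<beta> + 1))" and \<kappa>: "\<kappa> = min (1 / (2 * \<beta>)) (\<delta> / 4)"
    and C2: "C2 \<ge> 0" "\<And>s. F_nl \<epsilon> s \<le> s ^ 4 / 2 + C2"
    and C3: "C3 \<ge> 0" "\<And>s m0. \<bar>m0\<bar> \<le> m \<Longrightarrow> s ^ 4 / 2 - C3 \<le> f_nl \<epsilon> s * (s - m0) - 2 * s\<^sup>2"
    and C4: "C4 \<ge> 0" "\<And>s. M' * \<bar>f_nl \<epsilon> s\<bar> \<le> \<delta> / 4 * s ^ 4 + C4"
    and a0: "\<And>t. t \<ge> 0 \<Longrightarrow> \<bar>a0 t\<bar> \<le> m" and b0: "\<And>t. t \<ge> 0 \<Longrightarrow> \<bar>b0 t\<bar> \<le> M'" and T: "T \<ge> 0"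
  shows "Lam \<delta> N T \<le> (\<kappa> * C2 + \<delta> * C3 + C4) / \<kappa> + exp (- \<kappa> * T) * Lam \<delta> N 0
    + integral {0..T} (\<lambda>t. \<bar>pairing_error \<delta> N t\<bar>)"
proof -
  define C where "C = \<kappa> * C2 + \<delta> * C3 + C4"
  have \<delta>0: "\<delta> > 0" using \<beta> by (simp add: \<delta>)
  have \<kappa>0: "\<kappa> > 0" using \<beta> \<delta>0 by (simp add: \<kappa>)
  have C0: "C \<ge> 0" using C2(1) C3(1) C4(1) \<delta>0 \<kappa>0 by (simp add: C_def)
  define R where "R t = integral {0..t} (\<lambda>t. \<bar>pairing_error \<delta> N t\<bar>)" for t
  have ec: "continuous_on {0..T} (\<lambda>t. \<bar>pairing_error \<delta> N t\<bar>)"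
    by (intro continuous_intros continuous_on_subset[OF pairing_error_continuous]) auto
  have Rd: "(R has_real_derivative \<bar>pairing_error \<delta> N t\<bar>) (at t within {0..T})" if "t \<in> {0..T}" for t
    unfolding R_def[abs_def] by (rule integral_has_real_derivative[OF ec that])
  have R0: "R t \<ge> 0" if "t \<in> {0..T}" for t
    unfolding R_def using that
    by (intro integral_nonneg integrable_continuous_real continuous_on_subset[OF ec]) auto
  \<comment> \<open>The running integral \<open>R\<close> of the error is subtracted before the
    integrating factor is applied: its derivative cancels the error term, and the remaining
    \<open>- \<kappa> * R\<close> has the favourable sign.\<close>
  define h where "h t = exp (\<kappa> * t) * (Lam \<delta> N t - C / \<kappa> - R t)" for t
  have "h T \<le> h 0"
  proof (rule DERIV_nonpos_imp_decreasing_open[OF T])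
    fix t assume t: "0 < t" "t < T"
    obtain D where D: "(Lam \<delta> N has_real_derivative D) (at t)" "D \<le> - \<kappa> * Lam \<delta> N t + C + \<bar>pairing_error \<delta> N t\<bar>"
      using Lam_derivative[OF t(1), of \<delta> N] Lam_dissipation[OF \<delta> \<kappa> C2 C3(2) C4(2) a0 b0, where N = N] t(1)
      unfolding C_def by (meson less_imp_le)
    have "at t within {0..T} = at t"
      by (rule at_within_interior) (use t in simp)
    then have R': "(R has_real_derivative \<bar>pairing_error \<delta> N t\<bar>) (at t)"
      using Rd[of t] t by simp
    have E: "((\<lambda>t. exp (\<kappa> * t)) has_real_derivative exp (\<kappa> * t) * \<kappa>) (at t)"
      by (auto intro!: derivative_eq_intros)
    have "(h has_real_derivative exp (\<kappa> * t) * \<kappa> * (Lam \<delta> N t - C / \<kappa> - R t) + (D - 0 - \<bar>pairing_error \<delta> N t\<bar>) * exp (\<kappa> * t)) (at t)"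
      unfolding h_def[abs_def] by (intro DERIV_mult E DERIV_diff D(1) DERIV_const R')
    moreover have "exp (\<kappa> * t) * \<kappa> * (Lam \<delta> N t - C / \<kappa> - R t) + (D - 0 - \<bar>pairing_error \<delta> N t\<bar>) * exp (\<kappa> * t) \<le> 0"
    proof -
      have "\<kappa> * (Lam \<delta> N t - C / \<kappa> - R t) + (D - \<bar>pairing_error \<delta> N t\<bar>) = (\<kappa> * Lam \<delta> N t - C + D - \<bar>pairing_error \<delta> N t\<bar>) - \<kappa> * R t"
        using \<kappa>0 by (simp add: field_simps)
      also have "\<dots> \<le> 0"
      proof -
        have "0 \<le> \<kappa> * R t" using R0[of t] t \<kappa>0 by simp
        then show ?thesis using D(2) by simp
      qed
      finally have "exp (\<kappa> * t) * (\<kappa> * (Lam \<delta> N t - C / \<kappa> - R t) + (D - \<bar>pairing_error \<delta> N t\<bar>)) \<le> 0"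
        by (simp add: mult_le_0_iff)
      moreover have "e * k * x + (D - 0 - y) * e = e * (k * x + (D - y))" for e k x y :: real
        by (simp add: algebra_simps)
      ultimately show ?thesis by (simp only:)
    qed
    ultimately show "\<exists>y. (h has_real_derivative y) (at t) \<and> y \<le> 0" by blast
  next
    have "continuous_on {0..T} R" using Rd by (rule DERIV_continuous_on)
    then show "continuous_on {0..T} h"
      unfolding h_def by (intro continuous_intros continuous_on_subset[OF Lam_continuous]) auto
  qed
  moreover have "h 0 = Lam \<delta> N 0 - C / \<kappa>" by (simp add: h_def R_def)
  ultimately have "exp (\<kappa> * T) * (Lam \<delta> N T - C / \<kappa> - R T) \<le> Lam \<delta> N 0"
    using C0 \<kappa>0 by (simp add: h_def) (smt (verit) divide_nonneg_pos)
  then have "exp (- \<kappa> * T) * (exp (\<kappa> * T) * (Lam \<delta> N T - C / \<kappa> - R T)) \<le> exp (- \<kappa> * T) * Lam \<delta> N 0"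
    by (intro mult_left_mono) auto
  moreover have "exp (- \<kappa> * T) * (exp (\<kappa> * T) * (Lam \<delta> N T - C / \<kappa> - R T)) = Lam \<delta> N T - C / \<kappa> - R T"
    by (simp add: mult.assoc[symmetric] exp_add[symmetric])
  ultimately have "Lam \<delta> N T - C / \<kappa> - R T \<le> exp (- \<kappa> * T) * Lam \<delta> N 0"
    by (simp only:)
  then show ?thesis unfolding C_def R_def by linarith
qed

end

section \<open>Removal of the truncation and bounds in the phase space\<close>

context trajectory
begin

lemma Xs_hm1_coef: "Xs N t = (\<Sum>n\<in>Modes N. (hm1_coef (snd (z t)) n)\<^sup>2)"
  unfolding Xs_def by (rule sum.cong) (auto simp: hm1_coef_sq b_def lam_def)

lemma X0norm_components: "(Hnorm 2 (fst y))\<^sup>2 \<le> (X0norm y)\<^sup>2" "(Hm1norm (snd y))\<^sup>2 \<le> (X0norm y)\<^sup>2"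
  by (simp_all add: X0norm_def)

lemma Xs_le:
  assumes "t \<ge> 0" shows "Xs N t \<le> (X0norm (z t))\<^sup>2"
proof -
  have "Xs N t \<le> (Hm1norm (snd (z t)))\<^sup>2"
    using Hm1norm_ge[OF z_X0(2)[OF assms], of N] zero_le_power2[of "dmean (snd (z t))"] unfolding Xs_hm1_coef by linarith
  then show ?thesis using X0norm_components(2) by (rule order_trans)
qed

lemma h2_total_le:
  assumes "t \<ge> 0" shows "h2_total (\<phi> t) \<le> (1 + real CARD('n) * real CARD('n)) * (X0norm (z t))\<^sup>2"
  by (rule order_trans[OF h2_total_le_Hnorm[OF z_X0(1)[OF assms]] mult_left_mono])
    (simp_all add: X0norm_components \<phi>_def)

lemma a_sq_le:
  assumes "t \<ge> 0" shows "(\<Sum>n\<in>Modes N. (a n t)\<^sup>2) \<le> h2_total (\<phi> t)"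
proof -
  have "(\<Sum>n\<in>Modes N. (a n t)\<^sup>2) \<le> h2_upto N (\<phi> t)"
    unfolding h2_upto_def a_def by (intro sum_mono) (simp add: distrib_right)
  also have "\<dots> \<le> h2_total (\<phi> t)" by (rule h2_upto_le_total[OF z_X0(1)[OF assms]])
  finally show ?thesis .
qed

lemma Ys_le:
  assumes "t \<ge> 0" shows "Ys N t \<le> h2_total (\<phi> t)"
proof -
  have "Ys N t \<le> h2_upto N (\<phi> t)"
    unfolding h2_upto_def Ys_def a_def by (intro sum_mono) (simp add: distrib_right)
  also have "\<dots> \<le> h2_total (\<phi> t)" by (rule h2_upto_le_total[OF z_X0(1)[OF assms]])
  finally show ?thesis .
qed

text \<open>The pairing of H^1 with H^-1 in modes: \<open>sqrt (lam n)\<close> goes to the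
  difference of the nonlinearities, its inverse to \<open>b + \<delta> * a\<close>, and
  Cauchy-Schwarz is applied. The first factor is small with the H^2 tail, the second merely
  bounded.\<close>

lemma pairing_error_bound:
  assumes t: "t \<ge> 0" and Q: "h2_total (\<phi> t) \<le> Q" and P: "Xs N t \<le> P"
  shows "\<bar>pairing_error \<delta> N t\<bar> \<le> sqrt ((2 * (3 * (K * Q) + \<bar>1 - \<epsilon>\<bar>)\<^sup>2 + 72 * K\<^sup>2 * Q\<^sup>2) * (h2_total (\<phi> t) - h2_upto N (\<phi> t)) * (2 * P + 2 * \<delta>\<^sup>2 * Q))"
proof (rule real_le_rsqrt)
  let ?A = "(2 * (3 * (K * Q) + \<bar>1 - \<epsilon>\<bar>)\<^sup>2 + 72 * K\<^sup>2 * Q\<^sup>2) * (h2_total (\<phi> t) - h2_upto N (\<phi> t))"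
  have pairing_error: "pairing_error \<delta> N t = (\<Sum>n\<in>Modes N. (sqrt (lam n) * (pf N n t - fc n t)) * (nz n * (b n t + \<delta> * a n t) / sqrt (lam n)))"
    unfolding pairing_error_def
  proof (rule sum.cong[OF refl])
    fix n :: "'n mode"
    show "nz n * ((pf N n t - fc n t) * (b n t + \<delta> * a n t)) = (sqrt (lam n) * (pf N n t - fc n t)) * (nz n * (b n t + \<delta> * a n t) / sqrt (lam n))"
    proof (cases "fst n = 0")
      case False
      then have "sqrt (lam n) \<noteq> 0" using lam_ge_1[OF False] by simp
      then show ?thesis by simp
    qed (simp add: nz_def)
  qed
  have 1: "(\<Sum>n\<in>Modes N. (sqrt (lam n) * (pf N n t - fc n t))\<^sup>2) \<le> ?A"
    using f_nl_tsum_error[OF K0 K z_X0(1)[OF t] Q, where N = N and \<epsilon> = \<epsilon>]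
    by (simp add: power_mult_distrib lam_nonneg pf_def fc_def p_def)
  have 2: "(\<Sum>n\<in>Modes N. (nz n * (b n t + \<delta> * a n t) / sqrt (lam n))\<^sup>2) \<le> 2 * P + 2 * \<delta>\<^sup>2 * Q"
  proof -
    have "(\<Sum>n\<in>Modes N. (nz n * (b n t + \<delta> * a n t) / sqrt (lam n))\<^sup>2) \<le> (\<Sum>n\<in>Modes N. 2 * ((b n t)\<^sup>2 / lam n) + 2 * \<delta>\<^sup>2 * (a n t)\<^sup>2)"
    proof (rule sum_mono)
      fix n :: "'n mode"
      show "(nz n * (b n t + \<delta> * a n t) / sqrt (lam n))\<^sup>2 \<le> 2 * ((b n t)\<^sup>2 / lam n) + 2 * \<delta>\<^sup>2 * (a n t)\<^sup>2"
      proof (cases "fst n = 0")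
        case True
        then show ?thesis by (simp add: nz_def lam_nonneg)
      next
        case False
        have l: "lam n \<ge> 1" by (rule lam_ge_1[OF False])
        have "(nz n * (b n t + \<delta> * a n t) / sqrt (lam n))\<^sup>2 = (b n t + \<delta> * a n t)\<^sup>2 / lam n"
          using False l by (simp add: nz_def power_divide)
        also have "\<dots> \<le> (2 * (b n t)\<^sup>2 + 2 * (\<delta> * a n t)\<^sup>2) / lam n"
          using l by (intro divide_right_mono power2_sum_le) auto
        also have "\<dots> = 2 * ((b n t)\<^sup>2 / lam n) + 2 * \<delta>\<^sup>2 * (a n t)\<^sup>2 / lam n"
          by (simp add: add_divide_distrib power_mult_distrib)
        also have "2 * \<delta>\<^sup>2 * (a n t)\<^sup>2 / lam n \<le> 2 * \<delta>\<^sup>2 * (a n t)\<^sup>2 / 1"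
          using l by (intro divide_left_mono) auto
        finally show ?thesis by simp
      qed
    qed
    also have "\<dots> = 2 * Xs N t + 2 * \<delta>\<^sup>2 * (\<Sum>n\<in>Modes N. (a n t)\<^sup>2)"
      by (simp add: Xs_def sum.distrib sum_distrib_left)
    also have "\<dots> \<le> 2 * P + 2 * \<delta>\<^sup>2 * Q"
      using P a_sq_le[OF t, of N] Q by (intro add_mono mult_left_mono) auto
    finally show ?thesis .
  qed
  have A0: "0 \<le> ?A"
    by (rule order_trans[OF _ 1]) (simp add: sum_nonneg)
  have "(pairing_error \<delta> N t)\<^sup>2 \<le> (\<Sum>n\<in>Modes N. (sqrt (lam n) * (pf N n t - fc n t))\<^sup>2) * (\<Sum>n\<in>Modes N. (nz n * (b n t + \<delta> * a n t) / sqrt (lam n))\<^sup>2)"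
    unfolding pairing_error by (rule Cauchy_Schwarz_ineq_sum)
  also have "\<dots> \<le> ?A * (2 * P + 2 * \<delta>\<^sup>2 * Q)"
    by (intro mult_mono 1 2 A0 sum_nonneg) auto
  finally show "\<bar>pairing_error \<delta> N t\<bar>\<^sup>2 \<le> ?A * (2 * P + 2 * \<delta>\<^sup>2 * Q)" by simp
qed

text \<open>Dominated convergence in time: the tail of \<open>\<phi> t\<close> tends to zero at each
  fixed \<open>t\<close>, and the essential bound of the solution dominates. No rate is obtained,
  and none that is uniform over solutions is required.\<close>

lemma pairing_error_tendsto:
  assumes T: "T \<ge> 0"
  shows "(\<lambda>N. integral {0..T} (\<lambda>t. \<bar>pairing_error \<delta> N t\<bar>)) \<longlonglongrightarrow> 0"
proof -
  let ?c = "1 + real CARD('n) * real CARD('n)"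
  obtain C where C: "AE t in lebesgue_on {0<..}. X0norm (z t) \<le> C"
    using bounded_AE by blast
  \<comment> \<open>The essential bound concerns positive times; the maximum includes the time
    0.\<close>
  define C' where "C' = max C (X0norm (z 0))"
  define Q where "Q = ?c * C'\<^sup>2"
  define P where "P = C'\<^sup>2"
  define B where "B = 2 * (3 * (K * Q) + \<bar>1 - \<epsilon>\<bar>)\<^sup>2 + 72 * K\<^sup>2 * Q\<^sup>2"
  define V where "V = 2 * P + 2 * \<delta>\<^sup>2 * Q"
  have B0: "B \<ge> 0" by (simp add: B_def)
  have Q0: "Q \<ge> 0" by (simp add: Q_def)
  have V0: "V \<ge> 0" using Q0 by (simp add: V_def P_def)
  have "AE t in lebesgue. t \<in> {0<..} \<longrightarrow> X0norm (z t) \<le> C"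
    using C by (subst (asm) AE_restrict_space_iff) auto
  then have "AE t in lebesgue. t \<in> {0..T} \<longrightarrow> X0norm (z t) \<le> C'"
  proof eventually_elim
    case (elim t)
    show ?case using elim by (cases "t = 0") (auto simp: C'_def)
  qed
  then have AE: "AE t in lebesgue_on {0..T}. t \<in> {0..T} \<and> X0norm (z t) \<le> C'"
    by (subst AE_restrict_space_iff) auto
  have bd: "\<bar>pairing_error \<delta> N t\<bar> \<le> sqrt (B * (h2_total (\<phi> t) - h2_upto N (\<phi> t)) * V)" "h2_total (\<phi> t) \<le> Q"
    if t: "t \<in> {0..T}" "X0norm (z t) \<le> C'" for t N
  proof -
    have t0: "t \<ge> 0" using t by simp
    have "0 \<le> X0norm (z t)" by (simp add: X0norm_def)
    then have sq: "(X0norm (z t))\<^sup>2 \<le> C'\<^sup>2" using t(2) by (intro power_mono) auto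
    show Q: "h2_total (\<phi> t) \<le> Q"
      unfolding Q_def by (rule order_trans[OF h2_total_le[OF t0] mult_left_mono[OF sq]]) simp
    have "Xs N t \<le> P" using Xs_le[OF t0, of N] sq by (simp add: P_def)
    from pairing_error_bound[OF t0 Q this] show "\<bar>pairing_error \<delta> N t\<bar> \<le> sqrt (B * (h2_total (\<phi> t) - h2_upto N (\<phi> t)) * V)"
      by (simp add: B_def V_def)
  qed
  have ec: "continuous_on {0..T} (\<lambda>t. \<bar>pairing_error \<delta> N t\<bar>)" for N
    by (intro continuous_intros continuous_on_subset[OF pairing_error_continuous]) auto
  have int: "(LINT t|lebesgue_on {0..T}. \<bar>pairing_error \<delta> N t\<bar>) = integral {0..T} (\<lambda>t. \<bar>pairing_error \<delta> N t\<bar>)" for N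
  proof (rule lebesgue_integral_eq_integral)
    show "integrable (lebesgue_on {0..T}) (\<lambda>t. \<bar>pairing_error \<delta> N t\<bar>)"
      using absolutely_integrable_continuous_real[OF ec[of N]]
      by (subst integrable_restrict_space) (auto simp: set_integrable_def)
  qed simp
  have "(\<lambda>N. LINT t|lebesgue_on {0..T}. \<bar>pairing_error \<delta> N t\<bar>) \<longlonglongrightarrow> (LINT t|lebesgue_on {0..T}. 0)"
  proof (rule integral_dominated_convergence[where w = "\<lambda>t. sqrt (B * Q * V)"])
    show "(\<lambda>t. \<bar>pairing_error \<delta> N t\<bar>) \<in> borel_measurable (lebesgue_on {0..T})" for N
      by (intro continuous_imp_measurable_on_sets_lebesgue ec) simp
    show "integrable (lebesgue_on {0..T}) (\<lambda>t. sqrt (B * Q * V))"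
      by (intro finite_measure.integrable_const finite_measure_lebesgue_on) simp
    show "AE t in lebesgue_on {0..T}. (\<lambda>N. \<bar>pairing_error \<delta> N t\<bar>) \<longlonglongrightarrow> 0"
      using AE
    proof eventually_elim
      case (elim t)
      then have t0: "t \<ge> 0" by simp
      have "(\<lambda>N. sqrt (B * (h2_total (\<phi> t) - h2_upto N (\<phi> t)) * V)) \<longlonglongrightarrow> sqrt (B * (h2_total (\<phi> t) - h2_total (\<phi> t)) * V)"
        by (intro tendsto_real_sqrt tendsto_mult tendsto_diff tendsto_const h2_upto_tendsto z_X0 t0)
      then have 0: "(\<lambda>N. sqrt (B * (h2_total (\<phi> t) - h2_upto N (\<phi> t)) * V)) \<longlonglongrightarrow> 0" by simp
      show ?case
        by (rule Lim_null_comparison[OF always_eventually 0]) (use bd(1) elim in simp)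
    qed
    show "AE t in lebesgue_on {0..T}. norm \<bar>pairing_error \<delta> N t\<bar> \<le> sqrt (B * Q * V)" for N
      using AE
    proof eventually_elim
      case (elim t)
      have "sqrt (B * (h2_total (\<phi> t) - h2_upto N (\<phi> t)) * V) \<le> sqrt (B * Q * V)"
        using bd(2)[of t] elim h2_upto_nonneg[of N "\<phi> t"] B0 V0
        by (intro real_sqrt_le_mono mult_right_mono mult_left_mono) auto
      moreover have "\<bar>pairing_error \<delta> N t\<bar> \<le> sqrt (B * (h2_total (\<phi> t) - h2_upto N (\<phi> t)) * V)"
        using bd(1)[of t N] elim by blast
      ultimately show ?case unfolding real_norm_def abs_idempotent by (rule order_trans[rotated])
    qed
  qed simp
  then show ?thesis by (simp add: int)
qed

text \<open>At frequency zero the system is linear, and \<open>b0 t * exp (t / \<beta>)\<close> and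
  \<open>a0 + \<beta> * b0\<close> are conserved. The two constraints of the phase space bound
  exactly these quantities at time 0.\<close>

lemma zero_mode:
  assumes M: "\<bar>\<beta> * dmean (snd z0) + mean (fst z0)\<bar> \<le> M" and M': "\<bar>dmean (snd z0)\<bar> \<le> M'" and t: "t \<ge> 0"
  shows "\<bar>b0 t\<bar> \<le> M'" "\<bar>a0 t\<bar> \<le> M + \<beta> * M'"
proof -
  have lam0: "lam (0 :: int^'n, True) = 0" by (simp add: lam_def)
  have b00: "b0 0 = dmean (snd z0)" by (simp add: initial dmean_def trig_def)
  have a00: "a0 0 = mean (fst z0)" by (simp add: initial coef_def mean_eq trig_def)
  have b'0: "b' (0, True) s = - b0 s / \<beta>" for s
    by (simp add: b'_def lam0)
  have c: "b0 t * exp (t / \<beta>) = b0 0 \<and> a0 t + \<beta> * b0 t = a0 0 + \<beta> * b0 0"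
  proof (cases "t = 0")
    case False
    then have t0: "0 < t" using t by simp
    have "b0 t * exp (t / \<beta>) = b0 0 * exp (0 / \<beta>)"
    proof (rule DERIV_isconst2[OF t0])
      show "continuous_on {0..t} (\<lambda>s. b0 s * exp (s / \<beta>))"
        using \<beta> by (intro continuous_intros continuous_on_subset[OF b_continuous]) auto
      fix s assume s: "0 < s" "s < t"
      have "((\<lambda>s. exp (s / \<beta>)) has_real_derivative exp (s / \<beta>) * (1 / \<beta>)) (at s)"
        using \<beta> by (auto intro!: derivative_eq_intros)
      from DERIV_mult[OF b_derivative[OF s(1), of "(0, True)"] this]
      show "((\<lambda>s. b0 s * exp (s / \<beta>)) has_real_derivative 0) (at s)"
        by (simp add: b'0)
    qed (use t0 in auto)
    moreover have "a0 t + \<beta> * b0 t = a0 0 + \<beta> * b0 0"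
    proof (rule DERIV_isconst2[OF t0])
      show "continuous_on {0..t} (\<lambda>s. a0 s + \<beta> * b0 s)"
        by (intro continuous_intros continuous_on_subset[OF b_continuous] continuous_on_subset[OF a_continuous]) auto
      fix s assume s: "0 < s" "s < t"
      from DERIV_add[OF a_derivative[OF s(1), of "(0, True)"] DERIV_cmult[OF b_derivative[OF s(1), of "(0, True)"], of \<beta>]]
      show "((\<lambda>s. a0 s + \<beta> * b0 s) has_real_derivative 0) (at s)"
        using \<beta> by (simp add: b'0)
    qed (use t0 in auto)
    ultimately show ?thesis by simp
  qed simp
  have "\<bar>b0 t\<bar> * 1 \<le> \<bar>b0 t\<bar> * exp (t / \<beta>)"
    using t \<beta> by (intro mult_left_mono) auto
  also have "\<dots> = \<bar>b0 0\<bar>" using c by (metis abs_exp_cancel abs_mult)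
  finally show b: "\<bar>b0 t\<bar> \<le> M'" using M' b00 by simp
  have "\<bar>a0 t\<bar> \<le> \<bar>a0 t + \<beta> * b0 t\<bar> + \<bar>\<beta> * b0 t\<bar>" by linarith
  also have "\<dots> \<le> M + \<beta> * M'"
    using c M a00 b00 b \<beta> by (intro add_mono) (auto simp: abs_mult add.commute)
  finally show "\<bar>a0 t\<bar> \<le> M + \<beta> * M'" .
qed

text \<open>The bound depends on \<open>r\<close> and not on \<open>N\<close>. The quartic integral
  is estimated through the supremum bound for truncations. Since \<open>\<phi> 0\<close> and the
  initial datum agree only almost everywhere, they are compared through their coefficients.\<close>

lemma Lam_initial:
  assumes \<delta>: "\<delta> = 1 / (4 * (\<beta> + 1))" and C2: "\<And>s. F_nl \<epsilon> s \<le> s ^ 4 / 2 + C2" and r: "X0norm z0 \<le> r"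
  shows "Lam \<delta> N 0 \<le> \<beta> * r\<^sup>2 + (1 + real CARD('n) * real CARD('n)) * r\<^sup>2
    + (K * ((1 + real CARD('n) * real CARD('n)) * r\<^sup>2))\<^sup>2 + C2"
proof -
  let ?c = "1 + real CARD('n) * real CARD('n)"
  have u: "fst z0 \<in> Hp 2" and v: "snd z0 \<in> Hdual 1"
    using z0 by (auto simp: X0_def mem_Times_iff)
  have "0 \<le> X0norm z0" by (simp add: X0norm_def)
  then have r2: "(X0norm z0)\<^sup>2 \<le> r\<^sup>2" using r by (intro power_mono) auto
  have H: "h2_total (\<phi> 0) \<le> ?c * r\<^sup>2"
  proof -
    have "h2_total (\<phi> 0) = h2_total (fst z0)"
      using initial(1) unfolding h2_total_def h2_upto_def a_def by simp
    also have "\<dots> \<le> ?c * (Hnorm 2 (fst z0))\<^sup>2" by (rule h2_total_le_Hnorm[OF u])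
    also have "\<dots> \<le> ?c * r\<^sup>2"
      by (intro mult_left_mono order_trans[OF X0norm_components(1) r2]) auto
    finally show ?thesis .
  qed
  have X: "Xs N 0 \<le> r\<^sup>2"
  proof -
    have "Xs N 0 = (\<Sum>n\<in>Modes N. (hm1_coef (snd z0) n)\<^sup>2)"
      unfolding Xs_def by (rule sum.cong) (auto simp: hm1_coef_sq initial lam_def)
    also have "\<dots> \<le> (Hm1norm (snd z0))\<^sup>2"
      using Hm1norm_ge[OF v, of N] zero_le_power2[of "dmean (snd z0)"] by linarith
    also have "\<dots> \<le> r\<^sup>2" by (rule order_trans[OF X0norm_components(2) r2])
    finally show ?thesis .
  qed
  have Z: "Zs N 0 \<le> (K * (?c * r\<^sup>2))\<^sup>2"
  proof -
    have "p N 0 x ^ 4 \<le> (K * (?c * r\<^sup>2))\<^sup>2" for x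
    proof -
      have "\<bar>p N 0 x\<bar>\<^sup>2 \<le> (sqrt (K * h2_total (\<phi> 0)))\<^sup>2"
        unfolding p_def by (intro power_mono tsum_abs_le[OF K0 K] z_X0) auto
      also have "\<dots> = K * h2_total (\<phi> 0)"
        using K0 h2_total_nonneg[OF z_X0(1)[of 0]] by simp
      also have "\<dots> \<le> K * (?c * r\<^sup>2)" using H K0 by (intro mult_left_mono) auto
      finally have "((p N 0 x)\<^sup>2)\<^sup>2 \<le> (K * (?c * r\<^sup>2))\<^sup>2"
        by (intro power_mono) auto
      then show ?thesis by (simp add: power_mult[symmetric])
    qed
    then have "Zs N 0 \<le> (LINT x|lebesgue_on (cell :: (real^'n) set). (K * (?c * r\<^sup>2))\<^sup>2)"
      unfolding Zs_def by (intro integral_mono integrable_p[of "\<lambda>s. s ^ 4"] continuous_intros) auto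
    then show ?thesis by simp
  qed
  have "\<beta> * Xs N 0 \<le> \<beta> * r\<^sup>2" using X \<beta> by (intro mult_left_mono) auto
  moreover have "Ys N 0 \<le> ?c * r\<^sup>2" using Ys_le[of 0 N] H by simp
  ultimately show ?thesis
    using Lam_upper[OF \<delta> C2, where N = N and t = 0] Z by linarith
qed

text \<open>For nonzero frequency \<open>1 + lam\<^sup>2 \<le> 2 * lam\<^sup>2\<close>, so the H^2
  norm is controlled by \<open>Ys\<close> and the mean; the factor 16 is this 2 times the 8 from
  \<open>Ys / 8 \<le> E\<close>.\<close>

lemma X0norm_bound:
  assumes t: "t \<ge> 0" and E: "\<And>N. \<beta> / 4 * Xs N t + Ys N t / 8 \<le> E"
    and a0: "\<bar>a0 t\<bar> \<le> m" and b0: "\<bar>b0 t\<bar> \<le> M'"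
  shows "X0norm (z t) \<le> sqrt (real (card {js :: 'n list. length js \<le> 2}) * (m\<^sup>2 + 16 * E) + (M'\<^sup>2 + 4 / \<beta> * E))"
proof -
  have X: "Xs N t \<le> 4 / \<beta> * E" for N
  proof -
    have "\<beta> / 4 * Xs N t \<le> E" using E[of N] Ys_nonneg[of N t] by linarith
    then have "4 / \<beta> * (\<beta> / 4 * Xs N t) \<le> 4 / \<beta> * E" using \<beta> by (intro mult_left_mono) auto
    then show ?thesis using \<beta> by simp
  qed
  have Y: "Ys N t \<le> 8 * E" for N
  proof -
    have "0 \<le> \<beta> / 4 * Xs N t" using \<beta> Xs_nonneg[of N t] by simp
    then show ?thesis using E[of N] by linarith
  qed
  have "\<bar>a0 t\<bar>\<^sup>2 \<le> m\<^sup>2" "\<bar>b0 t\<bar>\<^sup>2 \<le> M'\<^sup>2" using a0 b0 by (intro power_mono; simp)+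
  then have a0s: "(a0 t)\<^sup>2 \<le> m\<^sup>2" and b0s: "(b0 t)\<^sup>2 \<le> M'\<^sup>2" by simp_all
  have "(Hnorm 2 (\<phi> t))\<^sup>2 \<le> real (card {js :: 'n list. length js \<le> 2}) * (m\<^sup>2 + 16 * E)"
  proof (rule Hnorm_le[OF z_X0(1)[OF t]])
    fix N
    have "(\<Sum>n\<in>Modes N. (1 + lam n ^ 2) * (coef (\<phi> t) n)\<^sup>2) \<le>
      (\<Sum>n\<in>Modes N. (if n = (0, True) then (a0 t)\<^sup>2 else 0) + 2 * ((lam n)\<^sup>2 * (a n t)\<^sup>2))"
    proof (rule sum_mono)
      fix n :: "'n mode"
      show "(1 + lam n ^ 2) * (coef (\<phi> t) n)\<^sup>2 \<le> (if n = (0, True) then (a0 t)\<^sup>2 else 0) + 2 * ((lam n)\<^sup>2 * (a n t)\<^sup>2)"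
      proof (cases "fst n = 0")
        case True
        then show ?thesis
          by (cases n; cases "snd n") (auto simp: lam_def a_def coef_def trig_def ip_def)
      next
        case False
        then have "1 \<le> (lam n)\<^sup>2" using lam_ge_1[OF False] by simp
        then have "1 * (a n t)\<^sup>2 \<le> (lam n)\<^sup>2 * (a n t)\<^sup>2" by (intro mult_right_mono) auto
        then show ?thesis using False by (auto simp: a_def distrib_right)
      qed
    qed
    also have "\<dots> = (a0 t)\<^sup>2 + 2 * Ys N t"
      by (simp add: sum.distrib Ys_def sum_distrib_left Modes_iff)
    also have "\<dots> \<le> m\<^sup>2 + 16 * E" using a0s Y[of N] by linarith
    finally show "(\<Sum>n\<in>Modes N. (1 + lam n ^ 2) * (coef (\<phi> t) n)\<^sup>2) \<le> m\<^sup>2 + 16 * E" .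
  qed
  moreover have "(Hm1norm (snd (z t)))\<^sup>2 \<le> M'\<^sup>2 + 4 / \<beta> * E"
  proof (rule Hm1norm_le[OF z_X0(2)[OF t]])
    have "dmean (snd (z t)) = b0 t" by (simp add: dmean_def b_def trig_def)
    then show "(dmean (snd (z t)))\<^sup>2 + (\<Sum>n\<in>Modes N. (hm1_coef (snd (z t)) n)\<^sup>2) \<le> M'\<^sup>2 + 4 / \<beta> * E" for N
      using X[of N] b0s unfolding Xs_hm1_coef by simp
  qed
  ultimately show ?thesis
    unfolding X0norm_def \<phi>_def by (intro real_sqrt_le_mono add_mono)
qed

text \<open>The left side at level \<open>N\<close> increases with the level, so it is bounded by
  the Lyapunov functional at any level \<open>L \<ge> N\<close>. Letting \<open>L\<close> tend to
  infinity removes the error integral while \<open>N\<close> stays fixed.\<close>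

lemma energy_bound:
  fixes m M' :: real
  assumes \<delta>: "\<delta> = 1 / (4 * (\<beta> + 1))" and \<kappa>: "\<kappa> = min (1 / (2 * \<beta>)) (\<delta> / 4)"
    and C1: "\<And>s. s ^ 4 / 8 - C1 \<le> F_nl \<epsilon> s - s\<^sup>2"
    and C2: "C2 \<ge> 0" "\<And>s. F_nl \<epsilon> s \<le> s ^ 4 / 2 + C2"
    and C3: "C3 \<ge> 0" "\<And>s m0. \<bar>m0\<bar> \<le> m \<Longrightarrow> s ^ 4 / 2 - C3 \<le> f_nl \<epsilon> s * (s - m0) - 2 * s\<^sup>2"
    and C4: "C4 \<ge> 0" "\<And>s. M' * \<bar>f_nl \<epsilon> s\<bar> \<le> \<delta> / 4 * s ^ 4 + C4"
    and a0: "\<And>t. t \<ge> 0 \<Longrightarrow> \<bar>a0 t\<bar> \<le> m" and b0: "\<And>t. t \<ge> 0 \<Longrightarrow> \<bar>b0 t\<bar> \<le> M'" and T: "T \<ge> 0"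
    and G: "\<And>N. Lam \<delta> N 0 \<le> G"
  shows "\<beta> / 4 * Xs N T + Ys N T / 8 \<le> C1 + (\<kappa> * C2 + \<delta> * C3 + C4) / \<kappa> + exp (- \<kappa> * T) * G"
proof -
  let ?D = "C1 + (\<kappa> * C2 + \<delta> * C3 + C4) / \<kappa> + exp (- \<kappa> * T) * G"
  have "(\<lambda>L. ?D + integral {0..T} (\<lambda>t. \<bar>pairing_error \<delta> L t\<bar>)) \<longlonglongrightarrow> ?D + 0"
    by (intro tendsto_add tendsto_const pairing_error_tendsto T)
  moreover have "\<beta> / 4 * Xs N T + Ys N T / 8 \<le> ?D + integral {0..T} (\<lambda>t. \<bar>pairing_error \<delta> L t\<bar>)" if "L \<ge> N" for L
  proof -
    have "Xs N T \<le> Xs L T" "Ys N T \<le> Ys L T"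
      unfolding Xs_def Ys_def using that by (intro sum_Modes_mono; simp add: lam_nonneg)+
    then have "\<beta> / 4 * Xs N T + Ys N T / 8 \<le> \<beta> / 4 * Xs L T + Ys L T / 8"
      using \<beta> by (intro add_mono mult_left_mono divide_right_mono) auto
    moreover have "exp (- \<kappa> * T) * Lam \<delta> L 0 \<le> exp (- \<kappa> * T) * G"
      by (intro mult_left_mono G) simp
    ultimately show ?thesis
      using Lam_lower[OF \<delta> C1, where N = L and t = T] Lam_Gronwall[OF \<delta> \<kappa> C2 C3 C4 a0 b0 T, where N = L]
      by linarith
  qed
  ultimately show ?thesis
    by (intro LIMSEQ_le_const[where X = "\<lambda>L. ?D + integral {0..T} (\<lambda>t. \<bar>pairing_error \<delta> L t\<bar>)"]) auto
qed

end

section \<open>The absorbing radius\<close>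

theorem theorem4p2:
  fixes \<beta> \<epsilon> M M' :: real
    and S :: "real \<Rightarrow> 'n::finite state \<Rightarrow> 'n state"
  assumes "CARD('n) \<le> 3"
    and "\<beta> > 0"
    and "M \<ge> 0" and "M' \<ge> 0"
    and "solution_semigroup \<beta> \<epsilon> S"
  shows "\<exists>R0. \<forall>B0. B0 \<subseteq> X0_MM \<beta> M M' \<and> (\<exists>r. \<forall>z\<in>B0. X0norm z \<le> r) \<longrightarrow>
           (\<exists>tB>0. \<forall>z\<in>B0. \<forall>t\<ge>tB. X0norm (S t z) \<le> R0)"
proof -
  let ?c = "1 + real CARD('n) * real CARD('n)"
  obtain K where K: "K > 0" "\<forall>F. finite F \<longrightarrow> (\<Sum>n\<in>(F :: 'n mode set). 1 / (1 + (lam n)\<^sup>2)) \<le> K"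
    using weight_bound[OF assms(1)] by blast
  define \<delta> where "\<delta> = 1 / (4 * (\<beta> + 1))"
  define \<kappa> where "\<kappa> = min (1 / (2 * \<beta>)) (\<delta> / 4)"
  define m where "m = M + \<beta> * M'"
  have \<delta>0: "\<delta> > 0" using assms(2) by (simp add: \<delta>_def)
  have \<kappa>0: "\<kappa> > 0" using assms(2) \<delta>0 by (simp add: \<kappa>_def)
  have m0: "m \<ge> 0" using assms(2,3,4) by (simp add: m_def)
  obtain C1 where C1: "C1 \<ge> 0" "\<And>s. s ^ 4 / 8 - C1 \<le> F_nl \<epsilon> s - s\<^sup>2"
    using F_nl_lower by blast
  obtain C2 where C2: "C2 \<ge> 0" "\<And>s. F_nl \<epsilon> s \<le> s ^ 4 / 2 + C2"
    using F_nl_upper by blast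
  obtain C3 where C3: "C3 \<ge> 0" "\<And>s m0. \<bar>m0\<bar> \<le> m \<Longrightarrow> s ^ 4 / 2 - C3 \<le> f_nl \<epsilon> s * (s - m0) - 2 * s\<^sup>2"
    using f_nl_dissipative[OF m0] by blast
  have "\<delta> / 4 > 0" using \<delta>0 by simp
  then obtain C4 where C4: "C4 \<ge> 0" "\<And>s. M' * \<bar>f_nl \<epsilon> s\<bar> \<le> \<delta> / 4 * s ^ 4 + C4"
    using f_nl_le_quartic[OF assms(4)] by blast
  \<comment> \<open>The asymptotic level of the energy estimate plus 1, where the 1 is room for the
    decaying initial contribution. Everything so far is fixed before the bounded set
    \<open>B0\<close> appears.\<close>
  define E where "E = C1 + (\<kappa> * C2 + \<delta> * C3 + C4) / \<kappa> + 1"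
  define R0 where "R0 = sqrt (real (card {js :: 'n list. length js \<le> 2}) * (m\<^sup>2 + 16 * E) + (M'\<^sup>2 + 4 / \<beta> * E))"
  have "\<exists>tB>0. \<forall>z\<in>B0. \<forall>t\<ge>tB. X0norm (S t z) \<le> R0"
    if B0: "B0 \<subseteq> X0_MM \<beta> M M'" and r: "\<forall>z\<in>B0. X0norm z \<le> r" for B0 r
  proof -
    define G where "G = \<beta> * r\<^sup>2 + ?c * r\<^sup>2 + (K * (?c * r\<^sup>2))\<^sup>2 + C2"
    have G0: "G \<ge> 0" using assms(2) C2(1) by (simp add: G_def)
    \<comment> \<open>The inequality \<open>exp (\<kappa> * t) \<ge> 1 + \<kappa> * t\<close> turns
      this waiting time into \<open>exp (- \<kappa> * t) * G \<le> 1\<close>; the added 1 keeps it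
      positive. Only \<open>G\<close> and \<open>tB\<close> depend on the bounded set.\<close>
    define tB where "tB = (G + 1) / \<kappa>"
    have tB: "tB > 0" using G0 \<kappa>0 by (simp add: tB_def)
    have small: "exp (- \<kappa> * t) * G \<le> 1" if "t \<ge> tB" for t
    proof -
      have "G + 1 \<le> \<kappa> * t"
        using that \<kappa>0 by (simp add: tB_def divide_le_eq mult.commute)
      then have "G \<le> exp (\<kappa> * t)" using exp_ge_add_one_self[of "\<kappa> * t"] by linarith
      then show ?thesis by (simp add: exp_minus divide_simps)
    qed
    have "X0norm (S t z) \<le> R0" if z: "z \<in> B0" and t: "t \<ge> tB" for z t
    proof -
      have zX: "z \<in> X0" and zM: "\<bar>\<beta> * dmean (snd z) + mean (fst z)\<bar> \<le> M" "\<bar>dmean (snd z)\<bar> \<le> M'"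
        using B0 z by (auto simp: X0_MM_def)
      interpret trajectory \<beta> \<epsilon> K z "\<lambda>t. S t z"
        by unfold_locales (use assms(2,5) K zX in \<open>auto simp: solution_semigroup_def\<close>)
      have t0: "t \<ge> 0" using t tB by simp
      have b0: "\<And>t. t \<ge> 0 \<Longrightarrow> \<bar>b (0, True) t\<bar> \<le> M'" and a0: "\<And>t. t \<ge> 0 \<Longrightarrow> \<bar>a (0, True) t\<bar> \<le> m"
        using zero_mode[OF zM] by (auto simp: m_def)
      have G: "Lam \<delta> N 0 \<le> G" for N
        unfolding G_def using r z by (intro Lam_initial[OF \<delta>_def C2(2)]) auto
      have "\<beta> / 4 * Xs N t + Ys N t / 8 \<le> E" for N
        using energy_bound[OF \<delta>_def \<kappa>_def C1(2) C2 C3 C4 a0 b0 t0 G, of N] small[OF t]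
        by (simp add: E_def)
      from X0norm_bound[OF t0 this a0[OF t0] b0[OF t0]] show ?thesis
        by (simp add: R0_def)
    qed
    then show ?thesis using tB by blast
  qed
  then show ?thesis by blast
qed

end
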